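(* Let $0\le k\le n$. For any $I\subset[n]$ with $|I|=k$ the section $c^*w_I^+$ of a line bundle on $\hat E_T(X_{k,n})$ satisfies the following properties. (1) It is a meromorphic section of an admissible line bundle $p_T^*\mathcal L(N,0)\otimes\mathcal T_{k,n}$ (for some integral quadratic form $N$ in the variables $z_1,\dots,z_n,y,\lambda$). (2) The restriction of $c^*w_I^+$ to $Y_I$, written as a function $\mathbb C^{n+2}\to\mathbb C$ with transformation properties determined by $p_T^*\mathcal L(N,0)\otimes\mathcal T_{k,n}$, is $$\frac{\prod_{a\in I,\,b\in\bar I}\theta(z_a-z_b+\epsilon(a,b)y)}{\prod_{a\in I}\theta(\lambda-(w(a,I)+1)y)}.$$ (3) The restriction of $c^*w_I^+$ to any $Y_J$ ($J\subset[n]$, $|J|=k$), written as a function $\mathbb C^{n+2}\to\mathbb C$ with transformation properties determined by $p_T^*\mathcal L(N,0)\otimes\mathcal T_{k,n}$, is of the form $$\frac1{\psi_I}\prod_{a\in J}\prod_{b\in\bar J,\,b<a}\theta(z_a-z_b+y)\cdot F_{I,J},$$ where $F_{I,J}$ is a holomorphic function. Moreover, these three properties uniquely determine $c^*w_I^+$.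
   Context: Fix $\tau$ in the upper half plane, $q=e^{2\pi i\tau}$, $E=\mathbb C/(\mathbb Z+\tau\mathbb Z)$, $\theta(z)=\frac{\sin\pi z}{\pi}\prod_{j\ge1}\frac{(1-q^je^{2\pi iz})(1-q^je^{-2\pi iz})}{(1-q^j)^2}$. For an integral symmetric $p\times p$ matrix $N$ (identified with the quadratic form $N(x)=x^tNx$) and $v\in\mathbb C^p$ let $\mathcal L(N,v)$ be the line bundle on $E^p$ whose sections are functions $f$ on $\mathbb C^p$ with $f(x+e_j)=(-1)^{N_{jj}}f(x)$ and $f(x+\tau e_j)=(-1)^{N_{jj}}e^{-2\pi i(\sum_kN_{jk}x_k+v_j)-\pi i\tau N_{jj}}f(x)$. $[n]=\{1,\dots,n\}$, $\bar K=[n]\smallsetminus K$, $z_K=(z_a)_{a\in K}$, $E^{(m)}=E^m/S_m$. $\hat E_T(\mathrm{pt})=E^n\times E\times E$ with coordinates $(z_1,\dots,z_n,y,\lambda)$ on its universal cover $\mathbb C^{n+2}$. The extended $T$-equivariant elliptic cohomology scheme of $X_{k,n}=T^*\mathrm{Gr}(k,n)$, $T=U(1)^n\times U(1)$, is $\hat E_T(X_{k,n})=(E^{(k)}\times E^{(n-k)})\times_{E^{(n)}}E^n\times E\times E$, with projection $p_T$ to $\hat E_T(\mathrm{pt})$ and projection $\hat\chi$ to $E^{(k)}\times E^{(n-k)}\times E\times E$. It is the union of the components $Y_K=\iota_K\hat E_T(\mathrm{pt})\cong E^{n+2}$, $K\subset[n]$, $|K|=k$, $\iota_K(z,y,\lambda)=(z_K,z_{\bar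 K},z,y,\lambda)$. The twisting bundle is $\mathcal T_{k,n}=\hat\chi^*\mathcal L(N_{k,n},0)$ with $N_{k,n}(t,s,y,\lambda)=2\sum_{i=1}^kt_i(\lambda+(n-k)y)+\sum_{i=1}^k\sum_{j=1}^{n-k}(t_i-s_j)^2$. Admissible line bundles are those of the form $p_T^*\mathcal L\otimes\mathcal T_{k,n}$ with $\mathcal L$ a line bundle on $\hat E_T(\mathrm{pt})$. A meromorphic section of a line bundle $\mathcal M$ on $\hat E_T(X_{k,n})$ is a collection of meromorphic sections $s_K$ of $\mathcal M|_{Y_K}$ which restrict to meromorphic sections on all intersections $Y_{I_1}\cap\dots\cap Y_{I_s}$ (the polar divisor contains no component of the intersection) and with $s_I=s_J$ on $Y_I\cap Y_J$. For $\mathcal M=p_T^*\mathcal L(N,0)\otimes\mathcal T_{k,n}$, the restriction to $Y_K$ is a (meromorphic) function on $\mathbb C^{n+2}$ with the transformation properties of sections of $\mathcal L(N+N_{k,n}(z_K,z_{\bar K},y,\lambda),0)$. For $I=\{i_1<\dots<i_k\}\subset[n]$: $n(j,I)=|\{l\in I:l>j\}|$, $w(j,I)=n(j,I)-n(j,\bar I)$, $\psi_I=\psi_I(y,\lambda)=\prod_{j\in I}\theta(\lambda-(w(j,I)+1)y)\theta(\lambda-w(j,I)y)$; $\epsilon(a,b)=1$ if $a>b$ and $0$ if $a<b$. The normalized weight function is $$w_I^+(t;z,y,\lambda)=\frac1{\psi_I}\sum_{\sigma\in S_k}\sigma\cdot\frac{\prod_{r=1}^k\Big(\prod_{a<i_r}\theta(t_r-z_a+y)\;\theta(\lambda+t_r-z_{i_r}-w(i_r,I)y)\prod_{a>i_r}\theta(t_r-z_a)\Big)}{\prod_{1\le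 i<j\le k}\theta(t_i-t_j)\theta(t_j-t_i+y)},$$ $\sigma$ permuting $t_1,\dots,t_k$. $c:\hat E_T(X_{k,n})\to E^{(k)}\times E^{(n-k)}\times E^n\times E\times E$ is the canonical embedding, and $c^*w_I^+$ is the section whose restriction to $Y_J$ is $w_I^+(z_J;z,y,\lambda)$, i.e. the result of substituting $t=z_J=(z_a)_{a\in J}$. *)

theory Defs
  imports "HOL-Analysis.Analysis" "HOL-Library.Multiset"
begin

section \<open>Holomorphic and meromorphic functions of several variables\<close>

definition holo_on :: "(complex ^ 'm \<Rightarrow> complex) \<Rightarrow> (complex ^ 'm::finite) set \<Rightarrow> bool" where
  "holo_on f U \<longleftrightarrow>
     (\<forall>x\<in>U. \<exists>f'. (f has_derivative f') (at x) \<and> (\<forall>c v. f' (c *s v) = c * f' v))"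

text \<open>
  A meromorphic function is represented by a total function that may take arbitrary values on a
  nowhere dense closed set (for instance, the values that result from division by zero on the
  zero set of a denominator). Two representatives of the same meromorphic function agree on a
  dense open set, and every notion below is invariant under such a change of representative.
\<close>

definition agree_on :: "(complex ^ 'm) set \<Rightarrow> (complex ^ 'm \<Rightarrow> complex) \<Rightarrow>
    (complex ^ 'm::finite \<Rightarrow> complex) \<Rightarrow> bool" where
  "agree_on U f g \<longleftrightarrow> (\<exists>D. open D \<and> D \<subseteq> U \<and> U \<subseteq> closure D \<and> (\<forall>x\<in>D. f x = g x))"

abbreviation mero_eq :: "(complex ^ 'm \<Rightarrow> complex) \<Rightarrow> (complex ^ 'm::finite \<Rightarrow> complex) \<Rightarrow> bool" where
  "mero_eq \<equiv> agree_on UNIV"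

definition mero :: "(complex ^ 'm::finite \<Rightarrow> complex) \<Rightarrow> bool" where
  "mero f \<longleftrightarrow> (\<forall>x. \<exists>U g h. open U \<and> x \<in> U \<and> holo_on g U \<and> holo_on h U \<and>
      U \<subseteq> closure {p \<in> U. h p \<noteq> 0} \<and> agree_on U f (\<lambda>p. g p / h p))"

text \<open>The meromorphic function represented by \<open>f\<close> is holomorphic near \<open>x\<close>, with value \<open>c\<close>
  at \<open>x\<close>. The number \<open>f x\<close> itself plays no role.\<close>

definition has_value :: "(complex ^ 'm::finite \<Rightarrow> complex) \<Rightarrow> complex ^ 'm \<Rightarrow> complex \<Rightarrow> bool" where
  "has_value f x c \<longleftrightarrow> (\<exists>U g. open U \<and> x \<in> U \<and> holo_on g U \<and> agree_on U f g \<and> g x = c)"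

text \<open>The support of the polar divisor.\<close>

definition polar_set :: "(complex ^ 'm::finite \<Rightarrow> complex) \<Rightarrow> (complex ^ 'm) set" where
  "polar_set f = {x. \<nexists>c. has_value f x c}"


section \<open>Theta function and line bundles on powers of the elliptic curve\<close>

definition nome :: "complex \<Rightarrow> complex" where
  "nome \<tau> = exp (2 * of_real pi * \<i> * \<tau>)"

definition theta :: "complex \<Rightarrow> complex \<Rightarrow> complex" where
  "theta \<tau> z = sin (of_real pi * z) / of_real pi *
     (\<Prod>j. (1 - nome \<tau> ^ Suc j * exp (2 * of_real pi * \<i> * z)) *
           (1 - nome \<tau> ^ Suc j * exp (- (2 * of_real pi * \<i> * z))) /
           (1 - nome \<tau> ^ Suc j) ^ 2)"

definition quad_form :: "int ^ 'm ^ 'm \<Rightarrow> complex ^ 'm::finite \<Rightarrow> complex" where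
  "quad_form N x = (\<Sum>i\<in>UNIV. \<Sum>j\<in>UNIV. of_int (N $ i $ j) * x $ i * x $ j)"

text \<open>The transformation properties of meromorphic sections of the line bundle
  \<open>\<L>(N, v)\<close>, as identities of meromorphic functions.\<close>

definition transforms :: "complex \<Rightarrow> int ^ 'm ^ 'm \<Rightarrow> complex ^ 'm \<Rightarrow>
    (complex ^ 'm::finite \<Rightarrow> complex) \<Rightarrow> bool" where
  "transforms \<tau> N v f \<longleftrightarrow> (\<forall>j.
     mero_eq (\<lambda>x. f (x + axis j 1)) (\<lambda>x. (-1) powi (N $ j $ j) * f x) \<and>
     mero_eq (\<lambda>x. f (x + axis j \<tau>))
       (\<lambda>x. (-1) powi (N $ j $ j) *
            exp (- (2 * of_real pi * \<i> * ((\<Sum>k\<in>UNIV. of_int (N $ j $ k) * x $ k) + v $ j))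
                 - of_real pi * \<i> * \<tau> * of_int (N $ j $ j)) * f x))"


section \<open>The extended equivariant elliptic cohomology scheme\<close>

text \<open>
  A point of \<open>\<complex>\<^sup>n\<^sup>+\<^sup>2\<close> is a vector \<open>x\<close> whose coordinates are labelled by a bijection
  \<open>e\<close> from \<open>{1..n+2}\<close> onto the index type: \<open>z\<^sub>a\<close> is \<open>x $ e a\<close> for \<open>a \<in> {1..n}\<close>, \<open>y\<close> is
  \<open>x $ e (n + 1)\<close> and \<open>\<lambda>\<close> is \<open>x $ e (n + 2)\<close>.
\<close>

definition ycoord :: "nat \<Rightarrow> (nat \<Rightarrow> 'm) \<Rightarrow> complex ^ 'm::finite \<Rightarrow> complex" where
  "ycoord n e x = x $ e (n + 1)"

definition lcoord :: "nat \<Rightarrow> (nat \<Rightarrow> 'm) \<Rightarrow> complex ^ 'm::finite \<Rightarrow> complex" where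
  "lcoord n e x = x $ e (n + 2)"

definition ksub :: "nat \<Rightarrow> nat \<Rightarrow> nat set set" where
  "ksub n k = {K. K \<subseteq> {1..n} \<and> card K = k}"

text \<open>\<open>elem K r\<close> is the \<open>r\<close>-th smallest element of \<open>K\<close>, counted from 1.\<close>

definition elem :: "nat set \<Rightarrow> nat \<Rightarrow> nat" where
  "elem K r = sorted_list_of_set K ! (r - 1)"

definition zsub :: "(nat \<Rightarrow> 'm) \<Rightarrow> complex ^ 'm::finite \<Rightarrow> nat set \<Rightarrow> nat \<Rightarrow> complex" where
  "zsub e x K r = x $ e (elem K r)"

text \<open>Points of \<open>E\<close> are the cosets of the lattice.\<close>

definition curve_pt :: "complex \<Rightarrow> complex \<Rightarrow> complex set" where
  "curve_pt \<tau> z = {z + of_int a + of_int b * \<tau> | a b. True}"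

text \<open>Points of the symmetric powers \<open>E\<^sup>(\<^sup>k\<^sup>)\<close> are multisets. The pair
  \<open>(z\<^sub>K, z\<^bsub>K'\<^esub>)\<close>, where \<open>K'\<close> is the complement of \<open>K\<close>, is first formed over \<open>\<complex>\<close>.\<close>

definition chi_lift :: "nat \<Rightarrow> (nat \<Rightarrow> 'm) \<Rightarrow> nat set \<Rightarrow> complex ^ 'm::finite \<Rightarrow>
    complex multiset \<times> complex multiset" where
  "chi_lift n e K x = (image_mset (\<lambda>a. x $ e a) (mset_set K),
                       image_mset (\<lambda>a. x $ e a) (mset_set ({1..n} - K)))"

definition iota :: "complex \<Rightarrow> nat \<Rightarrow> (nat \<Rightarrow> 'm) \<Rightarrow> nat set \<Rightarrow> complex ^ 'm::finite \<Rightarrow>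
    complex set multiset \<times> complex set multiset \<times>
    (nat \<Rightarrow> complex set) \<times> complex set \<times> complex set" where
  "iota \<tau> n e K x =
     (image_mset (curve_pt \<tau>) (fst (chi_lift n e K x)),
      image_mset (curve_pt \<tau>) (snd (chi_lift n e K x)),
      restrict (\<lambda>a. curve_pt \<tau> (x $ e a)) {1..n},
      curve_pt \<tau> (ycoord n e x), curve_pt \<tau> (lcoord n e x))"

definition Ycomp :: "complex \<Rightarrow> nat \<Rightarrow> (nat \<Rightarrow> 'm::finite) \<Rightarrow> nat set \<Rightarrow>
    (complex set multiset \<times> complex set multiset \<times>
     (nat \<Rightarrow> complex set) \<times> complex set \<times> complex set) set" where
  "Ycomp \<tau> n e K = range (iota \<tau> n e K)"

text \<open>
  The preimage in \<open>\<complex>\<^sup>n\<^sup>+\<^sup>2\<close> of an intersection of components \<open>Y\<^sub>I\<close> is given by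
  conditions \<open>z\<^sub>a - z\<^sub>b \<in> \<int> + \<tau>\<int>\<close>, so it is a locally finite union of affine subspaces. Its
  irreducible components are the maximal affine subspaces it contains, and the components
  of the intersection are their images.
\<close>

definition irr_components :: "(complex ^ 'm::finite) set \<Rightarrow> (complex ^ 'm) set set" where
  "irr_components X = {A. affine A \<and> A \<noteq> {} \<and> A \<subseteq> X \<and>
     (\<forall>B. affine B \<and> A \<subseteq> B \<and> B \<subseteq> X \<longrightarrow> B = A)}"


section \<open>Meromorphic sections of admissible line bundles\<close>

definition twist_form :: "nat \<Rightarrow> nat \<Rightarrow> (nat \<Rightarrow> complex) \<Rightarrow> (nat \<Rightarrow> complex) \<Rightarrow>
    complex \<Rightarrow> complex \<Rightarrow> complex" where
  "twist_form k n t s y l =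
     2 * (\<Sum>i=1..k. t i * (l + of_nat (n - k) * y)) +
     (\<Sum>i=1..k. \<Sum>j=1..n-k. (t i - s j) ^ 2)"

text \<open>
  Meromorphic sections of \<open>p\<^sub>T\<^sup>* \<L>(N, 0) \<otimes> \<T>\<^bsub>k,n\<^esub>\<close>. The matrix \<open>M\<close> is the symmetric matrix of
  the quadratic form \<open>N + N\<^bsub>k,n\<^esub>(z\<^sub>K, z\<^bsub>K'\<^esub>, y, \<lambda>)\<close>.

  In the last clause, \<open>s\<^sub>I = s\<^sub>J\<close> on \<open>Y\<^sub>I \<inter> Y\<^sub>J\<close> is expressed on the universal cover.
  If \<open>x\<close> satisfies \<open>chi_lift n e I x = chi_lift n e J x\<close>, then \<open>\<iota>\<^sub>I\<close> and \<open>\<iota>\<^sub>J\<close> send \<open>x\<close> to the same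
  point, and the fibre of the line bundle there is trivialised by the same lift up to a
  permutation of coordinates, so that the values may be compared directly. By the lemma
  \<open>exact_lift\<close> below each point of \<open>Y\<^sub>I \<inter> Y\<^sub>J\<close> has such a lift; at the other lifts the values
  differ by the factors prescribed by the transformation properties.
\<close>

definition mero_section :: "complex \<Rightarrow> nat \<Rightarrow> nat \<Rightarrow> (nat \<Rightarrow> 'm) \<Rightarrow> int ^ 'm ^ 'm \<Rightarrow>
    (nat set \<Rightarrow> complex ^ 'm::finite \<Rightarrow> complex) \<Rightarrow> bool" where
  "mero_section \<tau> n k e N s \<longleftrightarrow>
     (\<forall>K\<in>ksub n k. mero (s K) \<and>
        (\<exists>M. transpose M = M \<and>
             (\<forall>x. quad_form M x = quad_form N x +
                twist_form k n (zsub e x K) (zsub e x ({1..n} - K)) (ycoord n e x) (lcoord n e x)) \<and>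
             transforms \<tau> M 0 (s K))) \<and>
     (\<forall>F\<subseteq>ksub n k. \<forall>J\<in>F. \<forall>A\<in>irr_components (iota \<tau> n e J -` (\<Inter>I\<in>F. Ycomp \<tau> n e I)).
        \<not> A \<subseteq> polar_set (s J)) \<and>
     (\<forall>I\<in>ksub n k. \<forall>J\<in>ksub n k. \<forall>x c d.
        chi_lift n e I x = chi_lift n e J x \<and> has_value (s I) x c \<and> has_value (s J) x d \<longrightarrow> c = d)"

lemma curve_pt_self: "z \<in> curve_pt \<tau> z"
  unfolding curve_pt_def by (force intro: exI[of _ 0])

lemma curve_pt_eq:
  assumes "w \<in> curve_pt \<tau> z"
  shows "curve_pt \<tau> w = curve_pt \<tau> z"
proof -
  obtain a b where w: "w = z + of_int a + of_int b * \<tau>"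
    using assms unfolding curve_pt_def by blast
  have "w + of_int c + of_int d * \<tau> = z + of_int (a + c) + of_int (b + d) * \<tau>" for c d
    by (simp add: w algebra_simps)
  moreover have "z + of_int c + of_int d * \<tau> = w + of_int (c - a) + of_int (d - b) * \<tau>" for c d
    by (simp add: w algebra_simps)
  ultimately show ?thesis
    unfolding curve_pt_def by blast
qed

lemma exact_lift:
  fixes e :: "nat \<Rightarrow> 'm::finite"
  assumes "J \<in> F" and x: "iota \<tau> n e J x \<in> (\<Inter>I\<in>F. Ycomp \<tau> n e I)" and F: "\<forall>I\<in>F. I \<subseteq> {1..n}"
  obtains x' where "\<And>i. curve_pt \<tau> (x' $ i) = curve_pt \<tau> (x $ i)"
    and "\<And>I. I \<in> F \<Longrightarrow> chi_lift n e I x' = chi_lift n e J x'"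
proof -
  define rep :: "complex set \<Rightarrow> complex" where "rep c = (SOME z. z \<in> c)" for c
  define x' :: "complex ^ 'm" where "x' = (\<chi> i. rep (curve_pt \<tau> (x $ i)))"
  have "rep (curve_pt \<tau> z) \<in> curve_pt \<tau> z" for z
    unfolding rep_def by (rule someI, rule curve_pt_self)
  hence 1: "curve_pt \<tau> (x' $ i) = curve_pt \<tau> (x $ i)" for i
    unfolding x'_def by (simp add: curve_pt_eq)
  have 2: "chi_lift n e I x' = chi_lift n e J x'" if I: "I \<in> F" for I
  proof -
    obtain u where u: "iota \<tau> n e J x = iota \<tau> n e I u"
      using x I unfolding Ycomp_def by blast
    have z: "curve_pt \<tau> (u $ e a) = curve_pt \<tau> (x $ e a)" if "a \<in> {1..n}" for a
      using u that unfolding iota_def by (metis (no_types, lifting) prod.inject restrict_apply')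
    have fin: "finite I" using F I finite_subset by blast
    have ch: "image_mset (\<lambda>a. x' $ e a) (mset_set B) =
       image_mset rep (image_mset (curve_pt \<tau>) (image_mset (\<lambda>a. x $ e a) (mset_set B)))" for B
      by (simp add: x'_def image_mset.compositionality comp_def)
    have cu: "image_mset (curve_pt \<tau>) (image_mset (\<lambda>a. u $ e a) (mset_set B)) =
        image_mset (curve_pt \<tau>) (image_mset (\<lambda>a. x $ e a) (mset_set B))" if "B \<subseteq> {1..n}" for B
      using that z finite_subset[OF that]
      by (auto simp: image_mset.compositionality comp_def intro!: image_mset_cong)
    show ?thesis
      using u cu[of I] cu[of "{1..n} - I"] F I unfolding iota_def chi_lift_def ch by simp
  qed
  show ?thesis using that 1 2 by blast
qed


section \<open>Weight functions\<close>

definition wnum :: "nat \<Rightarrow> nat \<Rightarrow> nat set \<Rightarrow> int" where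
  "wnum n j I = int (card {l \<in> I. l > j}) - int (card {l \<in> {1..n} - I. l > j})"

definition psi :: "complex \<Rightarrow> nat \<Rightarrow> nat set \<Rightarrow> complex \<Rightarrow> complex \<Rightarrow> complex" where
  "psi \<tau> n I y l = (\<Prod>j\<in>I. theta \<tau> (l - (of_int (wnum n j I) + 1) * y) *
                           theta \<tau> (l - of_int (wnum n j I) * y))"

definition eps :: "nat \<Rightarrow> nat \<Rightarrow> complex" where
  "eps a b = (if a > b then 1 else 0)"

definition weight_summand :: "complex \<Rightarrow> nat \<Rightarrow> nat \<Rightarrow> nat set \<Rightarrow> (nat \<Rightarrow> complex) \<Rightarrow>
    (nat \<Rightarrow> complex) \<Rightarrow> complex \<Rightarrow> complex \<Rightarrow> complex" where
  "weight_summand \<tau> n k I t z y l =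
     (\<Prod>r=1..k. (\<Prod>a\<in>{1..<elem I r}. theta \<tau> (t r - z a + y)) *
        theta \<tau> (l + t r - z (elem I r) - of_int (wnum n (elem I r) I) * y) *
        (\<Prod>a\<in>{elem I r<..n}. theta \<tau> (t r - z a))) /
     (\<Prod>i=1..k. \<Prod>j=Suc i..k. theta \<tau> (t i - t j) * theta \<tau> (t j - t i + y))"

definition weight_fun :: "complex \<Rightarrow> nat \<Rightarrow> nat \<Rightarrow> nat set \<Rightarrow> (nat \<Rightarrow> complex) \<Rightarrow>
    (nat \<Rightarrow> complex) \<Rightarrow> complex \<Rightarrow> complex \<Rightarrow> complex" where
  "weight_fun \<tau> n k I t z y l =
     1 / psi \<tau> n I y l *
     (\<Sum>\<sigma> | \<sigma> permutes {1..k}. weight_summand \<tau> n k I (t \<circ> \<sigma>) z y l)"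

definition pullback_weight :: "complex \<Rightarrow> nat \<Rightarrow> nat \<Rightarrow> (nat \<Rightarrow> 'm) \<Rightarrow> nat set \<Rightarrow>
    nat set \<Rightarrow> complex ^ 'm::finite \<Rightarrow> complex" where
  "pullback_weight \<tau> n k e I J x =
     weight_fun \<tau> n k I (zsub e x J) (\<lambda>a. x $ e a) (ycoord n e x) (lcoord n e x)"


section \<open>The characterising properties\<close>

definition section_of_admissible :: "complex \<Rightarrow> nat \<Rightarrow> nat \<Rightarrow> (nat \<Rightarrow> 'm) \<Rightarrow>
    (nat set \<Rightarrow> complex ^ 'm::finite \<Rightarrow> complex) \<Rightarrow> bool" where
  "section_of_admissible \<tau> n k e s \<longleftrightarrow>
     (\<exists>N :: int ^ 'm ^ 'm. transpose N = N \<and> mero_section \<tau> n k e N s)"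

definition diagonal_restriction :: "complex \<Rightarrow> nat \<Rightarrow> (nat \<Rightarrow> 'm) \<Rightarrow> nat set \<Rightarrow>
    (nat set \<Rightarrow> complex ^ 'm::finite \<Rightarrow> complex) \<Rightarrow> bool" where
  "diagonal_restriction \<tau> n e I s \<longleftrightarrow>
     mero_eq (s I) (\<lambda>x.
       (\<Prod>a\<in>I. \<Prod>b\<in>{1..n} - I. theta \<tau> (x $ e a - x $ e b + eps a b * ycoord n e x)) /
       (\<Prod>a\<in>I. theta \<tau> (lcoord n e x - (of_int (wnum n a I) + 1) * ycoord n e x)))"

definition restriction_form :: "complex \<Rightarrow> nat \<Rightarrow> nat \<Rightarrow> (nat \<Rightarrow> 'm) \<Rightarrow> nat set \<Rightarrow>
    (nat set \<Rightarrow> complex ^ 'm::finite \<Rightarrow> complex) \<Rightarrow> bool" where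
  "restriction_form \<tau> n k e I s \<longleftrightarrow>
     (\<forall>J\<in>ksub n k. \<exists>F. holo_on F UNIV \<and>
        mero_eq (s J) (\<lambda>x.
          1 / psi \<tau> n I (ycoord n e x) (lcoord n e x) *
          (\<Prod>a\<in>J. \<Prod>b\<in>{b \<in> {1..n} - J. b < a}. theta \<tau> (x $ e a - x $ e b + ycoord n e x)) *
          F x))"

end

theory Submission
  imports Defs "HOL-Complex_Analysis.Complex_Singularities"
begin

text \<open>
  Uniqueness. The restriction to \<open>Y\<^sub>I\<close> determines the quadratic form, hence the multipliers on every
  component. By property (3) the difference of two such sections on \<open>Y\<^sub>J\<close> is given by an entire
  function \<open>D\<^sub>J\<close>. We show \<open>D\<^sub>J = 0\<close> by descending induction on the sum of the elements of \<open>J\<close>,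
  starting from \<open>D\<^sub>I = 0\<close>. For \<open>a \<in> J - I\<close> and \<open>b > a\<close> outside \<open>J\<close>, the components \<open>Y\<^sub>J\<close> and
  \<open>Y\<^sub>K\<close>, \<open>K = J - {a} \<union> {b}\<close>, meet along \<open>z\<^sub>a = z\<^sub>b\<close>, so \<open>D\<^sub>J\<close> vanishes there and is divisible by
  \<open>\<theta>(z\<^sub>a - z\<^sub>b)\<close>. The quotient by all these theta functions is \<open>1\<close>-periodic in \<open>z\<^sub>a\<close> with constant
  multiplier \<open>exp(-2\<pi>\<i>(\<lambda> + m y))\<close> under \<open>z\<^sub>a \<mapsto> z\<^sub>a + \<tau>\<close>, which forces it to vanish.

  Existence. On \<open>Y\<^sub>J\<close> the summand of \<open>\<sigma>\<close> vanishes unless the \<open>\<sigma>(r)\<close>-th element of \<open>J\<close> is at most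
  \<open>i\<^sub>r\<close> for all \<open>r\<close>. In that case its numerator contains the factors \<open>\<theta>(t\<^sub>j - t\<^sub>i + y)\<close> of the
  denominator as well as the product in property (3). The remaining poles at \<open>t\<^sub>i = t\<^sub>j\<close> cancel because
  the numerators add up to an antisymmetric function. For \<open>J = I\<close> only \<open>\<sigma> = id\<close> contributes.
\<close>

section \<open>The theta function\<close>

text \<open>Meromorphic functions are known only off a nowhere dense set, and the defining sum has
  zero denominators exactly on the diagonals where components meet. Identities are therefore first
  shown at general points and then extended by continuity of entire functions, or reached along a
  complex line that stays inside the diagonal and leaves every bad divisor. Directions with real
  \<open>z\<close>-part, \<open>y = \<i>\<close> and \<open>\<lambda> = 1\<close> serve throughout.

  Multipliers are encoded by quadratic forms, so that products of theta functions become sums of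
  squares. Uniqueness is then a degree count in \<open>z_a\<close>. The \<open>n - k\<close> squares
  \<open>(z_a - z_b)^2\<close> in the twist of \<open>J\<close> are used up by the factors with
  \<open>b < a\<close> from property (3) and those with \<open>b > a\<close> supplied by the
  induction, so no \<open>z_a^2\<close> remains and only exchanges that increase the sum of
  \<open>J\<close> are needed. As \<open>a\<close> is outside \<open>I\<close>, the form fixed by
  \<open>Y_I\<close> cannot cancel the term \<open>2 z_a \<lambda>\<close> of that twist: the
  surviving exponent \<open>\<lambda> + m y\<close> is generically not in the lattice, and an entire
  function of \<open>z_a\<close> with such a multiplier is zero.\<close>

definition qpoch :: "complex \<Rightarrow> complex \<Rightarrow> complex" where
  "qpoch q w = (\<Prod>j. 1 - q ^ Suc j * w)"

lemma summable_qpoch: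
  fixes q w :: complex
  assumes "norm q < 1"
  shows "summable (\<lambda>j. norm ((1 - q ^ Suc j * w) - 1))"
proof -
  have "summable (\<lambda>j. norm q ^ j * (norm q * norm w))"
    using assms by (intro summable_mult2 summable_geometric) auto
  moreover have "(\<lambda>j. norm ((1 - q ^ Suc j * w) - 1)) = (\<lambda>j. norm q ^ j * (norm q * norm w))"
    by (simp add: norm_mult norm_power mult_ac)
  ultimately show ?thesis by (simp only:)
qed

lemma convergent_qpoch: "norm (q::complex) < 1 \<Longrightarrow> convergent_prod (\<lambda>j. 1 - q ^ Suc j * w)"
  by (intro abs_convergent_prod_imp_convergent_prod summable_imp_abs_convergent_prod summable_qpoch)

text \<open>A convergent infinite product is zero only if one of its factors is; this later locates
  the zeros of theta.\<close>

lemma qpoch_eq_0_iff: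
  assumes "norm q < 1"
  shows "qpoch q w = 0 \<longleftrightarrow> (\<exists>j. q ^ Suc j * w = 1)"
proof -
  have "qpoch q w = 0 \<longleftrightarrow> 0 \<in> range (\<lambda>j. 1 - q ^ Suc j * w)"
    using has_prod_eq_0_iff[OF convergent_prod_has_prod[OF convergent_qpoch[OF assms, of w]]]
    unfolding qpoch_def .
  also have "\<dots> \<longleftrightarrow> (\<exists>j. q ^ Suc j * w = 1)"
    by (metis (no_types, lifting) eq_iff_diff_eq_0 rangeE rangeI)
  finally show ?thesis .
qed

text \<open>The product starts at \<open>q^1\<close>, so replacing \<open>w\<close> by
  \<open>q * w\<close> deletes the factor \<open>1 - q * w\<close>. A vanishing first factor is
  treated separately because it cannot be divided out.\<close>

lemma qpoch_rec:
  assumes "norm q < 1"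
  shows "qpoch q w = (1 - q * w) * qpoch q (q * w)"
proof (cases "1 - q * w = 0")
  case True
  hence "q ^ Suc 0 * w = 1" by simp
  hence "qpoch q w = 0" using qpoch_eq_0_iff[OF assms] by blast
  thus ?thesis using True by simp
next
  case False
  thus ?thesis
    using prodinf_split_head[OF convergent_qpoch[OF assms, of w]]
    unfolding qpoch_def by (simp add: field_simps)
qed

text \<open>Locally uniform limit of polynomials: on the unit disc around \<open>z\<close> the
  factors differ from 1 by at most \<open>|q|^j * |q| * (|z| + 1)\<close>, a summable
  majorant.\<close>

lemma holomorphic_qpoch:
  assumes "norm q < 1"
  shows "qpoch q holomorphic_on UNIV"
proof (rule holomorphic_uniform_sequence[where f = "\<lambda>N w. \<Prod>j<N. 1 - q ^ Suc j * w"])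
  fix z :: complex
  let ?A = "cball z 1"
  have "uniformly_convergent_on ?A (\<lambda>N w. \<Sum>j<N. norm ((1 - q ^ Suc j * w) - 1))"
  proof (rule Weierstrass_m_test')
    show "norm (norm (1 - q ^ Suc j * w - 1)) \<le> norm q ^ j * (norm q * (norm z + 1))"
      if "w \<in> ?A" for j w
    proof -
      have "norm w \<le> norm z + 1"
        using that norm_triangle_ineq2[of w z] by (auto simp: dist_norm norm_minus_commute)
      hence "norm q ^ j * (norm q * norm w) \<le> norm q ^ j * (norm q * (norm z + 1))"
        by (intro mult_left_mono) auto
      thus ?thesis
        by (simp add: norm_mult norm_power mult_ac)
    qed
    show "summable (\<lambda>j. norm q ^ j * (norm q * (norm z + 1)))"
      using assms by (intro summable_mult2 summable_geometric) auto
  qed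
  hence "uniformly_convergent_on ?A (\<lambda>N w. \<Prod>j<N. 1 - q ^ Suc j * w)"
    by (intro uniformly_convergent_on_prod') (auto intro!: continuous_intros)
  then obtain g where g: "uniform_limit ?A (\<lambda>N w. \<Prod>j<N. 1 - q ^ Suc j * w) g sequentially"
    by (auto simp: uniformly_convergent_on_def)
  have "g w = qpoch q w" if "w \<in> ?A" for w
  proof -
    \<comment> \<open>Limits of infinite products are taken over \<open>j \<le> N\<close>, the
      partial products here run over \<open>j < N\<close>; hence the \<open>Suc\<close>.\<close>
    have "(\<lambda>N. \<Prod>j<Suc N. 1 - q ^ Suc j * w) \<longlonglongrightarrow> g w"
      using tendsto_uniform_limitI[OF g that]
      by (subst filterlim_sequentially_Suc[where f = "\<lambda>N. \<Prod>j<N. 1 - q ^ Suc j * w"])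
    moreover have "(\<lambda>N. \<Prod>j<Suc N. 1 - q ^ Suc j * w) \<longlonglongrightarrow> qpoch q w"
      using convergent_prod_LIMSEQ[OF convergent_qpoch[OF assms, of w]]
      unfolding qpoch_def lessThan_Suc_atMost .
    ultimately show ?thesis using LIMSEQ_unique by blast
  qed
  hence "uniform_limit ?A (\<lambda>N w. \<Prod>j<N. 1 - q ^ Suc j * w) (qpoch q) sequentially"
    using g by (subst uniform_limit_cong'[where g = "\<lambda>N w. \<Prod>j<N. 1 - q ^ Suc j * w" and i = g]) auto
  thus "\<exists>d>0. cball z d \<subseteq> UNIV \<and>
      uniform_limit (cball z d) (\<lambda>N w. \<Prod>j<N. 1 - q ^ Suc j * w) (qpoch q) sequentially"
    by (intro exI[of _ 1]) auto
qed (auto intro!: holomorphic_intros)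

locale elliptic =
  fixes \<tau> :: complex
  assumes im_tau: "Im \<tau> > 0"
begin


lemma norm_nome: "norm (nome \<tau>) < 1"
  using im_tau by (simp add: nome_def norm_exp_eq_Re)

lemma nome_neq_0: "nome \<tau> \<noteq> 0"
  by (simp add: nome_def)

definition lattice :: "complex set" where
  "lattice = {of_int a + of_int b * \<tau> | a b. True}"

lemma half_notin_lattice: "1 / 2 \<notin> lattice"
proof
  assume "1 / 2 \<in> lattice"
  then obtain a b where ab: "1 / 2 = of_int a + of_int b * \<tau>"
    by (auto simp: lattice_def)
  hence "b = 0" using im_tau by (auto simp: complex_eq_iff)
  hence "(2 :: complex) * of_int a = 1" using ab by (simp add: field_simps)
  hence "of_int (2 * a) = (of_int 1 :: complex)" by simp
  hence "2 * a = 1" by (simp only: of_int_eq_iff)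
  thus False by presburger
qed

text \<open>The product splits because each part converges and no denominator \<open>1 - q^j\<close>
  vanishes. The factor \<open>1 - w\<close> with \<open>w = exp (2 pi i z)\<close>, which
  \<open>qpoch\<close> omits, is supplied up to a unit by the sine.\<close>

lemma theta_altdef:
  "theta \<tau> z = sin (of_real pi * z) / of_real pi *
     (qpoch (nome \<tau>) (exp (2 * of_real pi * \<i> * z)) * qpoch (nome \<tau>) (exp (- (2 * of_real pi * \<i> * z)))
       / qpoch (nome \<tau>) 1 ^ 2)"
proof -
  note [simp] = norm_nome
  let ?f = "\<lambda>w j. 1 - nome \<tau> ^ Suc j * w"
  have "?f 1 j \<noteq> 0" for j
  proof
    assume "?f 1 j = 0"
    hence "norm (nome \<tau>) ^ Suc j = 1"
      by (metis eq_iff_diff_eq_0 mult.right_neutral norm_one norm_power)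
    thus False
      using norm_nome power_strict_mono[of "norm (nome \<tau>)" 1 "Suc j"] by simp
  qed
  hence "(\<Prod>j. ?f w j * ?f w' j / (?f 1 j) ^ 2) = qpoch (nome \<tau>) w * qpoch (nome \<tau>) w' / qpoch (nome \<tau>) 1 ^ 2" for w w'
    unfolding qpoch_def
    by (simp only: prodinf_mult prodinf_divide convergent_qpoch convergent_prod_mult norm_nome
         prodinf_power[symmetric] convergent_prod_power power_eq_0_iff)
  thus ?thesis unfolding theta_def by simp
qed

lemma theta_plus1: "theta \<tau> (z + 1) = - theta \<tau> z"
proof -
  have "exp (2 * of_real pi * \<i> * (z + 1)) = exp (2 * of_real pi * \<i> * z)"
    by (simp add: algebra_simps exp_add)
  moreover have "exp (- (2 * of_real pi * \<i> * (z + 1))) = exp (- (2 * of_real pi * \<i> * z))"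
    using calculation by (simp only: exp_minus)
  moreover have "sin (of_real pi * (z + 1)) = - sin (of_real pi * z)"
    by (simp add: algebra_simps sin_add flip: sin_of_real cos_of_real)
  ultimately show ?thesis unfolding theta_altdef by simp
qed

lemma theta_minus: "theta \<tau> (- z) = - theta \<tau> z"
  unfolding theta_altdef by simp

lemma theta_0 [simp]: "theta \<tau> 0 = 0"
  by (simp add: theta_def)

text \<open>The shift \<open>w \<mapsto> q w\<close> removes \<open>1 - q w\<close> from one product
  and adds \<open>1 - 1 / w\<close> to the other; together with the change of the sine this leaves
  \<open>- 1 / (w r)\<close>. The square roots \<open>u\<close> of \<open>w\<close> and
  \<open>r\<close> of \<open>q\<close> appear because the sine and the multiplier involve half
  exponents.\<close>

lemma theta_plus_tau:
  "theta \<tau> (z + \<tau>) = - exp (- (2 * of_real pi * \<i> * z) - of_real pi * \<i> * \<tau>) * theta \<tau> z"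
proof -
  define q where "q = nome \<tau>"
  define w where "w = exp (2 * of_real pi * \<i> * z)"
  define u where "u = exp (of_real pi * \<i> * z)"
  define r where "r = exp (of_real pi * \<i> * \<tau>)"
  have nz: "u \<noteq> 0" "r \<noteq> 0" by (auto simp: u_def r_def)
  have w: "w = u ^ 2" and q: "q = r ^ 2"
    by (auto simp: u_def w_def q_def r_def nome_def power2_eq_square mult_ac simp flip: exp_add)
  have 1: "exp (2 * of_real pi * \<i> * (z + \<tau>)) = q * w"
    by (simp add: q_def w_def nome_def algebra_simps exp_add)
  have 2: "exp (- (2 * of_real pi * \<i> * (z + \<tau>))) = 1 / (q * w)"
    by (simp only: exp_minus 1) (simp add: field_simps)
  have 3: "exp (- (2 * of_real pi * \<i> * z)) = 1 / w"
    by (simp add: exp_minus w_def field_simps)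
  have s: "sin x = (exp (\<i> * x) - 1 / exp (\<i> * x)) / (2 * \<i>)" for x :: complex
    by (simp add: sin_exp_eq exp_minus inverse_eq_divide)
  have s1: "sin (of_real pi * z) = (u - 1 / u) / (2 * \<i>)"
    unfolding s by (simp add: u_def mult_ac)
  have "exp (\<i> * (of_real pi * (z + \<tau>))) = u * r"
    unfolding u_def r_def exp_add[symmetric] by (simp add: algebra_simps)
  hence s2: "sin (of_real pi * (z + \<tau>)) = (u * r - 1 / (u * r)) / (2 * \<i>)"
    unfolding s by simp
  have e: "exp (- (2 * of_real pi * \<i> * z) - of_real pi * \<i> * \<tau>) = 1 / (w * r)"
    unfolding w_def r_def exp_add[symmetric] by (simp add: exp_diff exp_minus exp_add divide_inverse)
  have p1: "qpoch q w = (1 - q * w) * qpoch q (q * w)"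
    using qpoch_rec norm_nome q_def by blast
  have p2: "qpoch q (1 / (q * w)) = (1 - 1 / w) * qpoch q (1 / w)"
    using qpoch_rec[OF norm_nome, of "1 / (q * w)"] nome_neq_0 by (simp add: q_def)
  have *: "(u * r - 1 / (u * r)) * (X * ((1 - 1 / w) * Y)) =
      - (1 / (w * r)) * ((u - 1 / u) * (((1 - q * w) * X) * Y))" for X Y
  proof -
    have "(u * r - 1 / (u * r)) * (1 - 1 / w) = - (1 / (w * r)) * ((u - 1 / u) * (1 - q * w))"
      using nz unfolding w q by (simp add: divide_simps) (simp add: algebra_simps power2_eq_square)
    hence "(u * r - 1 / (u * r)) * (1 - 1 / w) * (X * Y) = - (1 / (w * r)) * ((u - 1 / u) * (1 - q * w)) * (X * Y)"
      by (rule arg_cong)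
    thus ?thesis by (simp only: mult_ac)
  qed
  define K where "K = 1 / (2 * \<i>) / of_real pi / qpoch q 1 ^ 2"
  have K: "s / (2 * \<i>) / of_real pi * (M / qpoch q 1 ^ 2) = s * M * K" for s M
    by (simp add: K_def)
  have "theta \<tau> (z + \<tau>) = (u * r - 1 / (u * r)) * (qpoch q (q * w) * ((1 - 1 / w) * qpoch q (1 / w))) * K"
    unfolding theta_altdef 1 2 s2 q_def[symmetric] p2 K ..
  also have "\<dots> = - (1 / (w * r)) * ((u - 1 / u) * (qpoch q w * qpoch q (1 / w))) * K"
    by (simp only: * p1)
  also have "\<dots> = - (1 / (w * r)) * theta \<tau> z"
    unfolding theta_altdef 3 s1 q_def[symmetric] w_def[symmetric] K by (simp only: mult.assoc)
  finally show ?thesis unfolding e .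
qed

text \<open>The sign \<open>(-1)^(a + b)\<close> is written as an exponential so that it merges with
  the other exponents, also for negative shifts.\<close>

lemma theta_shift:
  "theta \<tau> (z + of_int a + of_int b * \<tau>) =
     exp (of_real pi * \<i> * of_int (a + b) - 2 * of_real pi * \<i> * of_int b * z
         - of_real pi * \<i> * \<tau> * of_int b ^ 2) * theta \<tau> z"
proof -
  have 1: "theta \<tau> (z + of_int a) = exp (of_real pi * \<i> * of_int a) * theta \<tau> z" for z
  proof (induction a rule: int_induct[where k = 0])
    case (step1 i)
    have "theta \<tau> (z + of_int (i + 1)) = theta \<tau> ((z + of_int i) + 1)" by (simp add: add_ac)
    also have "\<dots> = exp (of_real pi * \<i>) * exp (of_real pi * \<i> * of_int i) * theta \<tau> z"
      using step1 by (simp add: theta_plus1)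
    finally show ?case by (simp add: algebra_simps exp_add)
  next
    case (step2 i)
    have "theta \<tau> (z + of_int i) = theta \<tau> ((z + of_int (i - 1)) + 1)" by simp
    also have "\<dots> = exp (of_real pi * \<i>) * theta \<tau> (z + of_int (i - 1))"
      by (subst theta_plus1) simp
    finally show ?case using step2 by (simp add: algebra_simps exp_diff)
  qed auto
  have 2: "theta \<tau> (z + of_int b * \<tau>) = exp (of_real pi * \<i> * of_int b - 2 * of_real pi * \<i> * of_int b * z
         - of_real pi * \<i> * \<tau> * of_int b ^ 2) * theta \<tau> z" for z
  proof -
    let ?c = "\<lambda>b z. exp (of_real pi * \<i> * of_int b - 2 * of_real pi * \<i> * of_int b * z
         - of_real pi * \<i> * \<tau> * of_int b ^ 2)"
    have c: "exp (of_real pi * \<i>) * exp (- (2 * of_real pi * \<i> * (z + of_int i * \<tau>)) - of_real pi * \<i> * \<tau>) * ?c i z = ?c (i + 1) z" for i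
      unfolding exp_add[symmetric] by (rule arg_cong[where f = exp]) (simp add: algebra_simps power2_eq_square)
    have s: "theta \<tau> (z + of_int (i + 1) * \<tau>) =
       exp (of_real pi * \<i>) * exp (- (2 * of_real pi * \<i> * (z + of_int i * \<tau>)) - of_real pi * \<i> * \<tau>) * theta \<tau> (z + of_int i * \<tau>)" for i
      using theta_plus_tau[of "z + of_int i * \<tau>"] by (simp add: algebra_simps)
    show ?thesis
    proof (induction b rule: int_induct[where k = 0])
      case (step1 i)
      show ?case unfolding s step1 using c[of i] by (simp only: mult.assoc[symmetric])
    next
      case (step2 i)
      let ?d = "exp (of_real pi * \<i>) * exp (- (2 * of_real pi * \<i> * (z + of_int (i - 1) * \<tau>)) - of_real pi * \<i> * \<tau>)"
      have "?d * theta \<tau> (z + of_int (i - 1) * \<tau>) = ?d * (?c (i - 1) z * theta \<tau> z)"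
        using s[of "i - 1"] step2 c[of "i - 1"] by (simp only: mult.assoc[symmetric] diff_add_cancel)
      thus ?case by simp
    qed auto
  qed
  have "theta \<tau> (z + of_int a + of_int b * \<tau>) = theta \<tau> ((z + of_int b * \<tau>) + of_int a)"
    by (simp add: add_ac)
  also have "\<dots> = exp (of_real pi * \<i> * of_int a) *
      exp (of_real pi * \<i> * of_int b - 2 * of_real pi * \<i> * of_int b * z
         - of_real pi * \<i> * \<tau> * of_int b ^ 2) * theta \<tau> z"
    by (simp only: 1 2 mult.assoc)
  also have "\<dots> = exp (of_real pi * \<i> * of_int (a + b) - 2 * of_real pi * \<i> * of_int b * z
         - of_real pi * \<i> * \<tau> * of_int b ^ 2) * theta \<tau> z"
    by (simp only: exp_add[symmetric]) (simp add: algebra_simps)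
  finally show ?thesis .
qed

lemma qpoch_1_nonzero: "qpoch (nome \<tau>) 1 \<noteq> 0"
proof
  assume "qpoch (nome \<tau>) 1 = 0"
  then obtain j where "nome \<tau> ^ Suc j = 1"
    using qpoch_eq_0_iff[OF norm_nome] by auto
  hence "norm (nome \<tau>) ^ Suc j = 1"
    by (metis norm_one norm_power)
  thus False
    using norm_nome power_strict_mono[of "norm (nome \<tau>)" 1 "Suc j"] by simp
qed

lemma holomorphic_theta: "theta \<tau> holomorphic_on UNIV"
proof -
  have *: "(\<lambda>z. qpoch (nome \<tau>) (f z)) holomorphic_on UNIV" if "f holomorphic_on UNIV" for f
    using holomorphic_on_compose[OF that holomorphic_on_subset[OF holomorphic_qpoch[OF norm_nome]]]
    by (simp add: o_def)
  show ?thesis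
    unfolding theta_altdef[abs_def] by (intro holomorphic_intros * qpoch_1_nonzero) auto
qed

text \<open>A zero comes from one of three factors: the sine gives the integers, the two products
  give the lattice points with negative and with positive coefficient of
  \<open>\<tau>\<close>.\<close>

lemma theta_eq_0_iff: "theta \<tau> z = 0 \<longleftrightarrow> z \<in> lattice"
proof
  assume "z \<in> lattice"
  then obtain a b where "z = 0 + of_int a + of_int b * \<tau>" by (auto simp: lattice_def)
  thus "theta \<tau> z = 0" by (simp only: theta_shift theta_0 mult_zero_right)
next
  assume z: "theta \<tau> z = 0"
  have ex: "z \<in> lattice" if "exp (2 * of_real pi * \<i> * (z + of_int m * \<tau>)) = 1" for m
  proof -
    have "exp (2 * of_real pi * \<i> * (z + of_int m * \<tau>)) = exp 0" using that by simp
    then obtain n :: int where "2 * of_real pi * \<i> * (z + of_int m * \<tau>) = of_real (of_int (2 * n) * pi) * \<i>"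
      unfolding exp_eq by auto
    hence "2 * of_real pi * \<i> * (z + of_int m * \<tau>) = 2 * of_real pi * \<i> * of_int n"
      by (simp add: mult_ac)
    hence "z + of_int m * \<tau> = of_int n" by simp
    hence "z = of_int n + of_int (- m) * \<tau>" by (simp add: algebra_simps)
    thus ?thesis unfolding lattice_def by blast
  qed
  have q: "nome \<tau> ^ j = exp (2 * of_real pi * \<i> * (of_int (int j) * \<tau>))" for j
    by (simp add: nome_def exp_of_nat_mult[symmetric] mult_ac)
  consider "sin (of_real pi * z) = 0" | "qpoch (nome \<tau>) (exp (2 * of_real pi * \<i> * z)) = 0"
    | "qpoch (nome \<tau>) (exp (- (2 * of_real pi * \<i> * z))) = 0"
    using z qpoch_1_nonzero unfolding theta_altdef by auto
  thus "z \<in> lattice"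
  proof cases
    case 1
    then obtain n :: int where "of_real pi * z = of_real (of_int n * pi)"
      unfolding sin_eq_0 by auto
    hence "z = of_int n + of_int 0 * \<tau>" by (simp add: mult.commute)
    thus ?thesis unfolding lattice_def by blast
  next
    case 2
    then obtain j where "nome \<tau> ^ Suc j * exp (2 * of_real pi * \<i> * z) = 1"
      using qpoch_eq_0_iff[OF norm_nome] by auto
    thus ?thesis
      unfolding q exp_add[symmetric] by (intro ex[of "int (Suc j)"]) (simp add: algebra_simps)
  next
    case 3
    then obtain j where "nome \<tau> ^ Suc j * exp (- (2 * of_real pi * \<i> * z)) = 1"
      using qpoch_eq_0_iff[OF norm_nome] by auto
    hence "exp (- (2 * of_real pi * \<i> * (z + of_int (- int (Suc j)) * \<tau>))) = 1"
      unfolding q exp_add[symmetric] by (simp add: algebra_simps)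
    thus ?thesis
      by (intro ex[of "- int (Suc j)"]) (simp only: exp_minus inverse_eq_1_iff)
  qed
qed

text \<open>The zero at 0 is simple: the sine has a simple zero there and the cofactor
  \<open>K\<close> does not vanish.\<close>

lemma deriv_theta_0: "deriv (theta \<tau>) 0 \<noteq> 0"
proof -
  define K where "K z = qpoch (nome \<tau>) (exp (2 * of_real pi * \<i> * z)) *
      qpoch (nome \<tau>) (exp (- (2 * of_real pi * \<i> * z))) / qpoch (nome \<tau>) 1 ^ 2 / of_real pi" for z
  have *: "(\<lambda>z. qpoch (nome \<tau>) (f z)) holomorphic_on UNIV" if "f holomorphic_on UNIV" for f
    using holomorphic_on_compose[OF that holomorphic_on_subset[OF holomorphic_qpoch[OF norm_nome]]]
    by (simp add: o_def)
  have "K holomorphic_on UNIV"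
    unfolding K_def[abs_def] by (intro holomorphic_intros * qpoch_1_nonzero) (auto simp: qpoch_1_nonzero)
  hence "(K has_field_derivative deriv K 0) (at 0)"
    by (auto intro: holomorphic_derivI)
  hence "((\<lambda>z. sin (of_real pi * z) * K z) has_field_derivative of_real pi * K 0) (at 0)"
    by (auto intro!: derivative_eq_intros)
  moreover have "(\<lambda>z. sin (of_real pi * z) * K z) = theta \<tau>"
    by (rule ext) (simp add: theta_altdef K_def)
  ultimately have "deriv (theta \<tau>) 0 = of_real pi * K 0"
    by (auto intro: DERIV_imp_deriv)
  thus ?thesis by (simp add: K_def qpoch_1_nonzero)
qed

text \<open>Simplicity is transported from 0 by quasi-periodicity. In the derivative of
  \<open>m z * theta \<tau> z\<close> at 0 the term with the derivative of \<open>m\<close> drops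
  out because theta vanishes there.\<close>

lemma deriv_theta_nonzero:
  assumes "w \<in> lattice"
  shows "deriv (theta \<tau>) w \<noteq> 0"
proof -
  obtain a b where w: "w = of_int a + of_int b * \<tau>"
    using assms by (auto simp: lattice_def)
  define m where "m z = exp (of_real pi * \<i> * of_int (a + b) - 2 * of_real pi * \<i> * of_int b * z
         - of_real pi * \<i> * \<tau> * of_int b ^ 2)" for z
  have D: "(theta \<tau> has_field_derivative deriv (theta \<tau>) z) (at z)" for z
    using holomorphic_theta by (auto intro: holomorphic_derivI)
  have "m holomorphic_on UNIV"
    unfolding m_def[abs_def] by (intro holomorphic_intros)
  hence "(m has_field_derivative deriv m 0) (at 0)"
    by (auto intro: holomorphic_derivI)
  hence "((\<lambda>z. m z * theta \<tau> z) has_field_derivative m 0 * deriv (theta \<tau>) 0) (at 0)"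
    using D[of 0] by (auto intro!: derivative_eq_intros)
  moreover have "(\<lambda>z. m z * theta \<tau> z) = (\<lambda>z. theta \<tau> (z + w))"
    by (rule ext) (simp only: m_def theta_shift w add.assoc[symmetric])
  moreover have "((\<lambda>z. theta \<tau> (z + w)) has_field_derivative deriv (theta \<tau>) w) (at 0)"
    using D[of "0 + w"] unfolding DERIV_shift by simp
  ultimately have "deriv (theta \<tau>) w = m 0 * deriv (theta \<tau>) 0"
    by (metis DERIV_unique)
  thus ?thesis using deriv_theta_0 by (simp add: m_def)
qed

text \<open>Multiplication by an exponential makes both multipliers unimodular, so that
  Liouville's theorem applies.\<close>

lemma entire_quasiperiodic_eq_0:
  assumes g: "g holomorphic_on UNIV"
    and p1: "\<And>z. g (z + 1) = g z"
    and p2: "\<And>z. g (z + \<tau>) = exp (2 * of_real pi * \<i> * c) * g z"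
    and c: "c \<notin> lattice"
  shows "g z = 0"
proof -
  \<comment> \<open>With \<open>\<beta>\<close> real, \<open>exp (\<i> \<beta> z)\<close> keeps its
    norm under \<open>z + 1\<close>, and under \<open>z + \<tau>\<close> its norm changes by
    \<open>exp (2 pi Im c)\<close>, which compensates the norm of
    \<open>exp (2 pi i c)\<close>.\<close>
  define \<beta> where "\<beta> = - 2 * pi * Im c / Im \<tau>"
  define h where "h z = exp (\<i> * of_real \<beta> * z) * g z" for z
  have h: "h holomorphic_on UNIV"
    unfolding h_def[abs_def] using g by (intro holomorphic_intros)
  have n1: "norm (h (z + 1)) = norm (h z)" for z
    by (simp add: h_def p1 norm_mult)
  have "\<beta> * Im \<tau> = - 2 * pi * Im c"
    using im_tau by (simp add: \<beta>_def)
  hence b: "- (\<beta> * Im (z + \<tau>)) + (- 2 * pi * Im c) = - (\<beta> * Im z)" for z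
    by (simp add: algebra_simps)
  have n2: "norm (h (z + \<tau>)) = norm (h z)" for z
  proof -
    have "norm (h (z + \<tau>)) = exp (- (\<beta> * Im (z + \<tau>))) * (exp (- 2 * pi * Im c) * norm (g z))"
      unfolding h_def p2 norm_mult norm_exp_eq_Re by simp
    thus ?thesis
      unfolding mult.assoc[symmetric] exp_add[symmetric] b by (simp add: h_def norm_mult)
  qed
  have n1': "norm (h (z + of_int a)) = norm (h z)" for z a
  proof (induction a rule: int_induct[where k = 0])
    case (step1 i)
    thus ?case using n1[of "z + of_int i"] by (simp add: add_ac)
  next
    case (step2 i)
    thus ?case using n1[of "z + of_int (i - 1)"] by simp
  qed auto
  have n2': "norm (h (z + of_int b * \<tau>)) = norm (h z)" for z b
  proof (induction b rule: int_induct[where k = 0])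
    case (step1 i)
    thus ?case using n2[of "z + of_int i * \<tau>"] by (simp add: algebra_simps)
  next
    case (step2 i)
    thus ?case using n2[of "z + of_int (i - 1) * \<tau>"] by (simp add: algebra_simps)
  qed auto
  let ?K = "(\<lambda>(s, t). of_real s + of_real t * \<tau>) ` ({0..1} \<times> {0..1})"
  have "compact ?K"
    by (intro compact_continuous_image compact_Times) (auto intro!: continuous_intros simp: case_prod_beta)
  hence "compact (h ` ?K)"
    by (rule compact_continuous_image[OF continuous_on_subset[OF holomorphic_on_imp_continuous_on[OF h] subset_UNIV]])
  then obtain B where B: "\<And>z. z \<in> ?K \<Longrightarrow> norm (h z) \<le> B"
    using compact_imp_bounded bounded_iff by (metis imageI)
  have "norm (h z) \<le> B" for z
  proof -
    define t where "t = Im z / Im \<tau>"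
    define s where "s = Re z - t * Re \<tau>"
    have "z = of_real s + of_real t * \<tau>"
      using im_tau by (simp add: complex_eq_iff s_def t_def)
    hence "z + of_int (- \<lfloor>s\<rfloor>) + of_int (- \<lfloor>t\<rfloor>) * \<tau> = of_real (frac s) + of_real (frac t) * \<tau>"
      by (simp add: frac_def algebra_simps)
    moreover have "of_real (frac s) + of_real (frac t) * \<tau> \<in> ?K"
      using frac_lt_1[of s] frac_lt_1[of t]
      by (intro image_eqI[of _ _ "(frac s, frac t)"]) (auto intro: less_imp_le)
    ultimately show ?thesis
      using B n1'[of z "- \<lfloor>s\<rfloor>"] n2'[of "z + of_int (- \<lfloor>s\<rfloor>)" "- \<lfloor>t\<rfloor>"] by metis
  qed
  hence "bounded (range h)" unfolding bounded_iff by blast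
  then obtain C where C: "\<And>z. h z = C"
    using Liouville_theorem[OF h] unfolding constant_on_def by auto
  have gC: "g z = C * exp (- (\<i> * of_real \<beta> * z))" for z
    using C[of z] by (simp add: h_def exp_minus field_simps)
  \<comment> \<open>If \<open>C\<close> were nonzero, the two relations would become
    \<open>exp (- i \<beta>) = 1\<close> and
    \<open>exp (- i \<beta> \<tau>) = exp (2 pi i c)\<close>, and together they put \<open>c\<close>
    into the lattice.\<close>
  show ?thesis
  proof (rule ccontr)
    assume "g z \<noteq> 0"
    hence "C \<noteq> 0" using gC by auto
    have "exp (- (\<i> * of_real \<beta>)) = 1"
      using p1[of 0] \<open>C \<noteq> 0\<close> unfolding gC by simp
    hence "exp (- (\<i> * of_real \<beta>)) = exp 0" by simp
    then obtain n :: int where n: "- (\<i> * of_real \<beta>) = of_real (of_int (2 * n) * pi) * \<i>"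
      unfolding exp_eq by auto
    have "exp (- (\<i> * of_real \<beta> * \<tau>)) = exp (2 * of_real pi * \<i> * c)"
      using p2[of 0] \<open>C \<noteq> 0\<close> unfolding gC by simp
    then obtain m :: int where "- (\<i> * of_real \<beta>) * \<tau> = 2 * of_real pi * \<i> * c + of_real (of_int (2 * m) * pi) * \<i>"
      unfolding exp_eq by auto
    hence "2 * of_real pi * \<i> * (of_int n * \<tau>) = 2 * of_real pi * \<i> * (c + of_int m)"
      unfolding n by (simp add: algebra_simps)
    hence "of_int n * \<tau> = c + of_int m" by simp
    hence "c = of_int (- m) + of_int n * \<tau>" by (simp add: algebra_simps)
    thus False using c unfolding lattice_def by blast
  qed
qed

end

section \<open>Holomorphic functions of several variables\<close>

text \<open>The filter generated by the dense open sets. It turns agreement of representatives into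
  \<open>eventually\<close>, so that finitely many general-position conditions can be
  combined.\<close>

definition generic :: "('a::topological_space) filter" where
  "generic = Abs_filter (\<lambda>P. \<exists>D. open D \<and> closure D = UNIV \<and> (\<forall>x\<in>D. P x))"

lemma eventually_generic:
  "eventually P generic \<longleftrightarrow> (\<exists>D. open D \<and> closure D = UNIV \<and> (\<forall>x\<in>D. P x))"
  unfolding generic_def
proof (rule eventually_Abs_filter, unfold_locales)
  show "\<exists>D. open D \<and> closure D = UNIV \<and> (\<forall>x\<in>D. True)"
    by (rule exI[of _ UNIV]) auto
next
  fix P Q :: "'a \<Rightarrow> bool"
  assume "\<exists>D. open D \<and> closure D = UNIV \<and> (\<forall>x\<in>D. P x)" "\<exists>D. open D \<and> closure D = UNIV \<and> (\<forall>x\<in>D. Q x)"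
  then obtain D E where D: "open D" "closure D = UNIV" "\<forall>x\<in>D. P x"
    and E: "open E" "closure E = UNIV" "\<forall>x\<in>E. Q x" by blast
  have "closure (D \<inter> E) = UNIV"
    using closure_open_Int_superset[of D E] D E by simp
  thus "\<exists>D. open D \<and> closure D = UNIV \<and> (\<forall>x\<in>D. P x \<and> Q x)"
    using D E by (intro exI[of _ "D \<inter> E"]) auto
next
  fix P Q :: "'a \<Rightarrow> bool"
  assume "\<forall>x. P x \<longrightarrow> Q x" "\<exists>D. open D \<and> closure D = UNIV \<and> (\<forall>x\<in>D. P x)"
  thus "\<exists>D. open D \<and> closure D = UNIV \<and> (\<forall>x\<in>D. Q x)" by blast
qed

lemma mero_eq_iff_generic: "mero_eq f g \<longleftrightarrow> eventually (\<lambda>x. f x = g x) generic"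
  unfolding agree_on_def eventually_generic by (metis subset_UNIV top.extremum_uniqueI)

lemma generic_shift:
  fixes v :: "'a::real_normed_vector"
  assumes "eventually P generic"
  shows "eventually (\<lambda>x. P (x + v)) generic"
proof -
  obtain D where D: "open D" "closure D = UNIV" "\<forall>x\<in>D. P x"
    using assms by (auto simp: eventually_generic)
  have "closure ((+) (- v) ` D) = UNIV"
    unfolding closure_translation D by (simp add: surj_plus)
  thus ?thesis
    unfolding eventually_generic using D open_translation[OF D(1), of "- v"]
    by (intro exI[of _ "(+) (- v) ` D"]) auto
qed

lemma generic_imp_open:
  assumes "eventually P generic" "open V" "V \<noteq> {}"
  obtains x where "x \<in> V" "P x"
proof -
  obtain D where D: "open D" "closure D = UNIV" "\<forall>x\<in>D. P x"
    using assms(1) by (auto simp: eventually_generic)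
  have "V \<inter> D \<noteq> {}"
    using open_Int_closure_eq_empty[OF assms(2), of D] D assms(3) by auto
  thus ?thesis using D that by blast
qed

text \<open>The way back from generic to pointwise identities: the set where two continuous maps
  into a Hausdorff space agree is closed, and here it is dense.\<close>

lemma generic_eq_imp_eq:
  fixes f g :: "'a::topological_space \<Rightarrow> 'b::t2_space"
  assumes "eventually (\<lambda>x. f x = g x) generic" "continuous_on UNIV f" "continuous_on UNIV g"
  shows "f = g"
proof -
  obtain D where D: "closure D = UNIV" "\<forall>x\<in>D. f x = g x"
    using assms(1) by (auto simp: eventually_generic)
  have "closed {x. f x = g x}"
    using closed_Collect_eq[OF assms(2,3)] .
  hence "closure D \<subseteq> {x. f x = g x}"
    using D by (intro closure_minimal) auto
  thus ?thesis using D by auto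
qed

abbreviation holo_at :: "(complex ^ 'm \<Rightarrow> complex) \<Rightarrow> complex ^ 'm::finite \<Rightarrow> bool" where
  "holo_at f x \<equiv> \<exists>f'. (f has_derivative f') (at x) \<and> (\<forall>c v. f' (c *s v) = c * f' v)"

abbreviation entire :: "(complex ^ 'm::finite \<Rightarrow> complex) \<Rightarrow> bool" where
  "entire f \<equiv> holo_on f UNIV"

named_theorems holo_intros

lemma holo_on_imp_continuous_on: "holo_on f U \<Longrightarrow> continuous_on U f"
  unfolding holo_on_def
  by (metis continuous_at_imp_continuous_on has_derivative_continuous)

lemma holo_on_subset: "holo_on f U \<Longrightarrow> V \<subseteq> U \<Longrightarrow> holo_on f V"
  unfolding holo_on_def by blast

lemma holo_on_const [holo_intros]: "holo_on (\<lambda>x. c) U"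
  unfolding holo_on_def by (intro ballI exI[of _ "\<lambda>x. 0"]) auto

lemma holo_on_add [holo_intros]: "holo_on f U \<Longrightarrow> holo_on g U \<Longrightarrow> holo_on (\<lambda>x. f x + g x) U"
  unfolding holo_on_def
proof
  fix x assume *: "\<forall>x\<in>U. holo_at f x" "\<forall>x\<in>U. holo_at g x" "x \<in> U"
  obtain f' where f': "(f has_derivative f') (at x)" "\<forall>c v. f' (c *s v) = c * f' v" using * by blast
  obtain g' where g': "(g has_derivative g') (at x)" "\<forall>c v. g' (c *s v) = c * g' v" using * by blast
  show "holo_at (\<lambda>x. f x + g x) x"
    using f' g' by (intro exI[of _ "\<lambda>v. f' v + g' v"]) (auto intro!: derivative_eq_intros simp: algebra_simps)
qed

lemma holo_on_mult [holo_intros]: "holo_on f U \<Longrightarrow> holo_on g U \<Longrightarrow> holo_on (\<lambda>x. f x * g x) U"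
  unfolding holo_on_def
proof
  fix x assume *: "\<forall>x\<in>U. holo_at f x" "\<forall>x\<in>U. holo_at g x" "x \<in> U"
  obtain f' where f': "(f has_derivative f') (at x)" "\<forall>c v. f' (c *s v) = c * f' v" using * by blast
  obtain g' where g': "(g has_derivative g') (at x)" "\<forall>c v. g' (c *s v) = c * g' v" using * by blast
  show "holo_at (\<lambda>x. f x * g x) x"
    using f' g' by (intro exI[of _ "\<lambda>v. f x * g' v + f' v * g x"]) (auto intro!: derivative_eq_intros simp: algebra_simps)
qed

lemma holo_on_compose:
  assumes "holo_on f U" "\<phi> holomorphic_on A" "open A" "\<And>x. x \<in> U \<Longrightarrow> f x \<in> A"
  shows "holo_on (\<lambda>x. \<phi> (f x)) U"
  unfolding holo_on_def
proof
  fix x assume x: "x \<in> U"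
  obtain f' where f': "(f has_derivative f') (at x)" "\<forall>c v. f' (c *s v) = c * f' v"
    using x assms(1) unfolding holo_on_def by blast
  have "(\<phi> has_field_derivative deriv \<phi> (f x)) (at (f x))"
    using assms x by (auto intro: holomorphic_derivI)
  hence "(\<phi> has_derivative (*) (deriv \<phi> (f x))) (at (f x))"
    by (simp add: has_field_derivative_def)
  hence "((\<phi> \<circ> f) has_derivative (*) (deriv \<phi> (f x)) \<circ> f') (at x)"
    using diff_chain_at[OF f'(1)] by blast
  thus "holo_at (\<lambda>x. \<phi> (f x)) x"
    using f'(2) by (intro exI[of _ "(*) (deriv \<phi> (f x)) \<circ> f'"]) (auto simp: o_def)
qed

lemma holo_on_inverse: "holo_on f U \<Longrightarrow> (\<And>x. x \<in> U \<Longrightarrow> f x \<noteq> 0) \<Longrightarrow> holo_on (\<lambda>x. inverse (f x)) U"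
  by (rule holo_on_compose[of f U inverse "- {0}"]) (auto intro!: holomorphic_intros)

lemma holo_on_divide: "holo_on f U \<Longrightarrow> holo_on g U \<Longrightarrow> (\<And>x. x \<in> U \<Longrightarrow> g x \<noteq> 0) \<Longrightarrow> holo_on (\<lambda>x. f x / g x) U"
  unfolding divide_inverse by (intro holo_intros holo_on_inverse)

lemma holo_on_minus [holo_intros]: "holo_on f U \<Longrightarrow> holo_on (\<lambda>x. - f x) U"
  using holo_on_mult[of "\<lambda>_. - 1" U f] by (simp add: holo_on_const)

lemma holo_on_diff [holo_intros]: "holo_on f U \<Longrightarrow> holo_on g U \<Longrightarrow> holo_on (\<lambda>x. f x - g x) U"
  using holo_on_add[of f U "\<lambda>x. - g x"] by (simp add: holo_on_minus)

lemma holo_on_sum [holo_intros]: "(\<And>i. i \<in> A \<Longrightarrow> holo_on (f i) U) \<Longrightarrow> holo_on (\<lambda>x. \<Sum>i\<in>A. f i x) U"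
  by (induction A rule: infinite_finite_induct) (auto intro!: holo_intros)

lemma holo_on_prod [holo_intros]: "(\<And>i. i \<in> A \<Longrightarrow> holo_on (f i) U) \<Longrightarrow> holo_on (\<lambda>x. \<Prod>i\<in>A. f i x) U"
  by (induction A rule: infinite_finite_induct) (auto intro!: holo_intros)

lemma holo_on_component [holo_intros]: "holo_on (\<lambda>x. x $ i) U"
  unfolding holo_on_def by (intro ballI exI[of _ "\<lambda>x. x $ i"])
    (auto intro!: bounded_linear_imp_has_derivative bounded_linear_vec_nth)

lemma holo_on_transform:
  assumes "holo_on f U" "open U" "\<And>x. x \<in> U \<Longrightarrow> f x = g x"
  shows "holo_on g U"
  unfolding holo_on_def
proof
  fix x assume x: "x \<in> U"
  obtain f' where f': "(f has_derivative f') (at x)" "\<forall>c v. f' (c *s v) = c * f' v"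
    using x assms(1) unfolding holo_on_def by blast
  have "(g has_derivative f') (at x)"
    using has_derivative_transform_within_open[OF f'(1) assms(2) x] assms(3) by blast
  thus "holo_at g x" using f'(2) by blast
qed

lemma has_derivative_line:
  fixes x v :: "complex ^ 'm::finite"
  shows "((\<lambda>\<zeta>. x + \<zeta> *s v) has_derivative (\<lambda>t. t *s v)) (at (\<zeta> :: complex))"
proof -
  have "bounded_linear (\<lambda>t::complex. t *s v)"
    by (intro linear_conv_bounded_linear[THEN iffD1] linearI)
      (auto simp: vec_eq_iff algebra_simps)
  thus ?thesis
    by (auto intro!: derivative_eq_intros bounded_linear_imp_has_derivative)
qed

text \<open>Complex linearity of the derivative makes the restriction to a complex line holomorphic
  in one variable. All one-variable theorems enter through this restriction.\<close>

lemma holo_on_line: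
  assumes "holo_on f U"
  shows "(\<lambda>\<zeta>. f (x + \<zeta> *s v)) holomorphic_on {\<zeta>. x + \<zeta> *s v \<in> U}"
  unfolding holomorphic_on_def
proof
  fix \<zeta> assume "\<zeta> \<in> {\<zeta>. x + \<zeta> *s v \<in> U}"
  then obtain f' where f': "(f has_derivative f') (at (x + \<zeta> *s v))" "\<forall>c v. f' (c *s v) = c * f' v"
    using assms unfolding holo_on_def by blast
  have "((f \<circ> (\<lambda>\<zeta>. x + \<zeta> *s v)) has_derivative f' \<circ> (\<lambda>t. t *s v)) (at \<zeta>)"
    using diff_chain_at[OF has_derivative_line f'(1)] .
  moreover have "f' \<circ> (\<lambda>t. t *s v) = (*) (f' v)"
    using f'(2) by (auto simp: o_def mult.commute)
  ultimately have "((\<lambda>\<zeta>. f (x + \<zeta> *s v)) has_field_derivative f' v) (at \<zeta>)"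
    by (simp add: has_field_derivative_def o_def)
  thus "(\<lambda>\<zeta>. f (x + \<zeta> *s v)) field_differentiable at \<zeta> within {\<zeta>. x + \<zeta> *s v \<in> U}"
    using field_differentiable_at_within field_differentiable_def by blast
qed

lemma holo_on_entire_line: "entire f \<Longrightarrow> (\<lambda>\<zeta>. f (x + \<zeta> *s v)) holomorphic_on UNIV"
  using holo_on_line[of f UNIV x v] by simp

lemma entire_shift: "entire f \<Longrightarrow> entire (\<lambda>x. f (x + v))"
  unfolding holo_on_def
proof
  fix x assume "\<forall>x\<in>UNIV. holo_at f x"
  then obtain f' where f': "(f has_derivative f') (at (x + v))" "\<forall>c v. f' (c *s v) = c * f' v" by blast
  have "((\<lambda>x. x + v) has_derivative (\<lambda>x. x)) (at x)"
    by (auto intro!: derivative_eq_intros)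
  hence "((\<lambda>x. f (x + v)) has_derivative f') (at x)"
    using has_derivative_compose[of "\<lambda>x. x + v" "\<lambda>x. x" x UNIV f f'] f'(1) by simp
  thus "holo_at (\<lambda>x. f (x + v)) x" using f'(2) by blast
qed

lemma entire_line_nonzero:
  assumes "entire h" "h (x + c *s v) \<noteq> 0"
  shows "eventually (\<lambda>\<zeta>. h (x + \<zeta> *s v) \<noteq> 0) (at \<zeta>0)"
  using non_zero_neighbour_alt[OF holo_on_entire_line[OF assms(1), of x v], of \<zeta>0 c] assms(2) by (simp add: connected_UNIV)

lemma tendsto_line: "((\<lambda>\<zeta>. x + \<zeta> *s v) \<longlongrightarrow> x) (at (0::complex))"
  using has_derivative_continuous[OF has_derivative_line[of x v 0]]
  by (simp add: isCont_def)

text \<open>Any point \<open>x\<close> is joined to \<open>p\<close> by a complex line. On it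
  \<open>h\<close> is not identically zero, so its zeros are isolated and \<open>x\<close> is a
  limit of points where \<open>h\<close> does not vanish.\<close>

lemma generic_nonzero:
  assumes "entire h" "h p \<noteq> 0"
  shows "eventually (\<lambda>x. h x \<noteq> 0) generic"
proof -
  have "open {x. h x \<noteq> 0}"
    using open_Collect_neq[OF holo_on_imp_continuous_on[OF assms(1)] continuous_on_const] by simp
  moreover have "x \<in> closure {x. h x \<noteq> 0}" for x
  proof -
    define w where "w = p - x"
    have "h (x + 1 *s w) \<noteq> 0" using assms(2) by (simp add: w_def)
    from entire_line_nonzero[OF assms(1) this, of 0]
    have "\<forall>\<^sub>F \<zeta> in at 0. x + \<zeta> *s w \<in> closure {x. h x \<noteq> 0}"
      by eventually_elim (rule subsetD[OF closure_subset], simp)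
    thus ?thesis
      by (intro Lim_in_closed_set[OF closed_closure _ _ tendsto_line]) auto
  qed
  ultimately show ?thesis
    unfolding eventually_generic by (intro exI[of _ "{x. h x \<noteq> 0}"]) auto
qed

text \<open>Cancels a factor \<open>h\<close> that may vanish at \<open>x\<close> itself: its zeros
  on the line are isolated, so \<open>f\<close> vanishes on the line near \<open>x\<close> and, by
  continuity, at \<open>x\<close>. The line has to stay inside the locus where the product is known
  to vanish.\<close>

lemma line_cancel:
  assumes "entire f" "entire h" "\<And>\<zeta>. f (x + \<zeta> *s v) * h (x + \<zeta> *s v) = 0" "h (x + c *s v) \<noteq> 0"
  shows "f x = 0"
proof -
  have "\<forall>\<^sub>F \<zeta> in at 0. f (x + \<zeta> *s v) = 0"
    using entire_line_nonzero[OF assms(2,4), of 0]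
    by eventually_elim (use assms(3) in auto)
  moreover have "((\<lambda>\<zeta>. f (x + \<zeta> *s v)) \<longlongrightarrow> f x) (at 0)"
    using continuous_on_tendsto_compose[OF holo_on_imp_continuous_on[OF assms(1)] tendsto_line] by simp
  ultimately show ?thesis
    by (metis tendsto_eventually tendsto_unique trivial_limit_at)
qed

subsection \<open>Division by theta\<close>

text \<open>Cauchy's formula with \<open>du / u\<close> cancelled against the parametrisation of the
  circle. The resulting real integral can be differentiated with respect to parameters.\<close>

lemma circle_mean:
  assumes "F holomorphic_on UNIV" "r > 0"
  shows "F 0 = integral {0..1} (\<lambda>t. F (circlepath 0 r t))"
proof -
  have "((\<lambda>u. F u / (u - 0)) has_contour_integral 2 * of_real pi * \<i> * F 0) (circlepath 0 r)"
    using assms by (intro Cauchy_integral_circlepath_simple) (auto intro: holomorphic_on_subset)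
  hence "contour_integral (circlepath 0 r) (\<lambda>u. F u / u) = 2 * of_real pi * \<i> * F 0"
    by (simp add: contour_integral_unique)
  hence "2 * of_real pi * \<i> * F 0 =
      integral {0..1} (\<lambda>t. F (circlepath 0 r t) / circlepath 0 r t * vector_derivative (circlepath 0 r) (at t))"
    by (simp add: contour_integral_integral)
  also have "\<dots> = integral {0..1} (\<lambda>t. 2 * of_real pi * \<i> * F (circlepath 0 r t))"
    unfolding vector_derivative_circlepath using assms(2)
    by (intro integral_cong) (simp add: circlepath)
  finally show ?thesis by simp
qed

lemma circle_deriv:
  assumes "F holomorphic_on cball 0 r" "r > 0" "(F has_field_derivative D) (at 0)"
  shows "D = integral {0..1} (\<lambda>t. F (circlepath 0 r t) / circlepath 0 r t)"
proof -
  have "(F has_field_derivative (1 / (2 * of_real pi * \<i>) * contour_integral (circlepath 0 r) (\<lambda>u. F u / (u - 0)^2))) (at 0)"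
    using assms by (intro Cauchy_derivative_integral_circlepath)
       (auto intro: holomorphic_on_subset holomorphic_on_imp_continuous_on)
  hence "2 * of_real pi * \<i> * D = contour_integral (circlepath 0 r) (\<lambda>u. F u / (u - 0)^2)"
    using assms(3) DERIV_unique by fastforce
  also have "\<dots> = integral {0..1} (\<lambda>t. 2 * of_real pi * \<i> * (F (circlepath 0 r t) / circlepath 0 r t))"
    unfolding contour_integral_integral vector_derivative_circlepath using assms(2)
    by (intro integral_cong) (simp add: circlepath power2_eq_square)
  finally show ?thesis unfolding integral_mult_right by simp
qed

lemma continuous_on_smult [continuous_intros]:
  fixes g :: "_ \<Rightarrow> complex ^ 'm::finite"
  assumes "continuous_on S f" "continuous_on S g"
  shows "continuous_on S (\<lambda>x. f x *s g x)"
  unfolding vector_scalar_mult_def using assms by (intro continuous_intros) 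

lemma norm_smult: "norm (c *s x) = norm c * norm (x :: complex ^ 'm::finite)"
  unfolding norm_vec_def by (simp add: norm_mult L2_set_right_distrib)

text \<open>\<open>holo_on\<close> asks only for a derivative at each point. Its continuity, needed
  to differentiate under an integral, follows since Cauchy's formula writes each directional
  derivative as an integral depending continuously on the base point.\<close>

lemma holo_on_C1:
  fixes f :: "complex ^ 'm::finite \<Rightarrow> complex"
  assumes f: "holo_on f W" and W: "open W"
  obtains f' :: "complex ^ 'm \<Rightarrow> (complex ^ 'm) \<Rightarrow>\<^sub>L complex" where
    "continuous_on W f'" "\<And>x. x \<in> W \<Longrightarrow> (f has_derivative blinfun_apply (f' x)) (at x)"
    "\<And>x c v. x \<in> W \<Longrightarrow> f' x (c *s v) = c * f' x v"
proof -
  have "\<forall>x\<in>W. \<exists>g :: (complex ^ 'm) \<Rightarrow>\<^sub>L complex. (f has_derivative blinfun_apply g) (at x) \<and> (\<forall>c v. g (c *s v) = c * g v)"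
  proof
    fix x assume "x \<in> W"
    then obtain f' where f': "(f has_derivative f') (at x)" "\<forall>c v. f' (c *s v) = c * f' v"
      using f unfolding holo_on_def by blast
    have "blinfun_apply (Blinfun f') = f'"
      using f'(1) by (intro bounded_linear_Blinfun_apply has_derivative_bounded_linear)
    thus "\<exists>g :: (complex ^ 'm) \<Rightarrow>\<^sub>L complex. (f has_derivative blinfun_apply g) (at x) \<and> (\<forall>c v. g (c *s v) = c * g v)"
      using f' by (intro exI[of _ "Blinfun f'"]) auto
  qed
  then obtain f' :: "complex ^ 'm \<Rightarrow> (complex ^ 'm) \<Rightarrow>\<^sub>L complex"
    where f': "\<And>x. x \<in> W \<Longrightarrow> (f has_derivative blinfun_apply (f' x)) (at x)"
      "\<And>x c v. x \<in> W \<Longrightarrow> f' x (c *s v) = c * f' x v"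
    by metis
  have "continuous_on W (\<lambda>x. f' x b)" if b: "b \<in> Basis" for b
  proof (rule continuous_at_imp_continuous_on, rule ballI)
    fix x0 assume "x0 \<in> W"
    then obtain d where d: "d > 0" "ball x0 d \<subseteq> W"
      using W open_contains_ball by blast
    \<comment> \<open>One half of the radius is left for moving \<open>x\<close>, the other half for
      the circle in the direction of the unit vector \<open>b\<close>.\<close>
    define r where "r = d / 2"
    have r: "r > 0" using d by (simp add: r_def)
    have in_W: "x + \<zeta> *s b \<in> W" if "x \<in> ball x0 r" "norm \<zeta> \<le> r" for x \<zeta>
    proof -
      have "dist x0 (x + \<zeta> *s b) \<le> dist x0 x + norm (\<zeta> *s b)"
        unfolding dist_norm by (metis diff_add_eq_diff_diff_swap norm_triangle_ineq4 add.commute)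
      also have "\<dots> < d"
        using that b by (simp add: norm_smult r_def)
      finally show ?thesis using d by auto
    qed
    have eq: "f' x b = integral (cbox 0 1) (\<lambda>t. f (x + circlepath 0 r t *s b) / circlepath 0 r t)"
      if x: "x \<in> ball x0 r" for x
      unfolding cbox_interval
    proof (rule circle_deriv[where F = "\<lambda>\<zeta>. f (x + \<zeta> *s b)"])
      show "(\<lambda>\<zeta>. f (x + \<zeta> *s b)) holomorphic_on cball 0 r"
        using in_W[OF x] by (intro holomorphic_on_subset[OF holo_on_line[OF f]]) auto
      have "x \<in> W" using in_W[OF x, of 0] r by simp
      have "((f \<circ> (\<lambda>\<zeta>. x + \<zeta> *s b)) has_derivative f' x \<circ> (\<lambda>t. t *s b)) (at 0)"
        by (rule diff_chain_at[OF has_derivative_line]) (use f'(1) \<open>x \<in> W\<close> in simp)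
      moreover have "f' x \<circ> (\<lambda>t. t *s b) = (*) (f' x b)"
        using f'(2)[OF \<open>x \<in> W\<close>] by (auto simp: o_def mult.commute)
      ultimately show "((\<lambda>\<zeta>. f (x + \<zeta> *s b)) has_field_derivative f' x b) (at 0)"
        by (simp add: has_field_derivative_def o_def)
    qed (rule r)
    have "continuous_on (ball x0 r) (\<lambda>x. integral (cbox 0 1) (\<lambda>t. f (x + circlepath 0 r t *s b) / circlepath 0 r t))"
    proof (rule integral_continuous_on_param, unfold case_prod_beta)
      have c: "norm (circlepath 0 r t) = r" for t
        using r by (simp add: circlepath norm_mult)
      show "continuous_on (ball x0 r \<times> cbox 0 1) (\<lambda>p. f (fst p + circlepath 0 r (snd p) *s b) / circlepath 0 r (snd p))"
        using r c in_W
        by (intro continuous_on_divide continuous_on_compose2[OF holo_on_imp_continuous_on[OF f]])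
          (auto intro!: continuous_intros simp: circlepath)
    qed
    hence "continuous_on (ball x0 r) (\<lambda>x. f' x b)"
      by (rule continuous_on_eq) (use eq in auto)
    thus "isCont (\<lambda>x. f' x b) x0"
      using r by (simp add: continuous_on_eq_continuous_at)
  qed
  hence "continuous_on W f'"
    by (intro continuous_on_blinfun_componentwise)
  thus ?thesis using that f' by blast
qed

text \<open>At a zero of \<open>T\<close> both functions can be divided by \<open>z - a\<close>, and
  the zero of \<open>T\<close> is simple. The filled-in value is expressed by derivatives at the
  point, so that quotients formed on different lines fit together to one function.\<close>

lemma holomorphic_quotient:
  assumes F: "F holomorphic_on UNIV" and T: "T holomorphic_on UNIV"
    and zero: "\<And>z. T z = 0 \<Longrightarrow> F z = 0 \<and> deriv T z \<noteq> 0"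
  shows "(\<lambda>z. if T z = 0 then deriv F z / deriv T z else F z / T z) holomorphic_on UNIV"
    (is "?g holomorphic_on _")
proof -
  have "\<exists>V. open V \<and> a \<in> V \<and> ?g holomorphic_on V" for a
  proof (cases "T a = 0")
    case False
    have op: "open {z. T z \<noteq> 0}"
      using open_Collect_neq[OF holomorphic_on_imp_continuous_on[OF T] continuous_on_const] by simp
    have "(\<lambda>z. F z / T z) holomorphic_on {z. T z \<noteq> 0}"
      by (intro holomorphic_intros holomorphic_on_subset[OF F] holomorphic_on_subset[OF T]) auto
    hence "?g holomorphic_on {z. T z \<noteq> 0}"
      by (rule holomorphic_transform) auto
    thus ?thesis using op False by blast
  next
    case True
    have hol: "(\<lambda>z. if z = a then deriv G a else G z / (z - a)) holomorphic_on UNIV"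
      if "G holomorphic_on UNIV" "G a = 0" for G
      by (rule pole_theorem_0[OF that(1), of a]) (use that in auto)
    define F1 where "F1 z = (if z = a then deriv F a else F z / (z - a))" for z
    define T1 where "T1 z = (if z = a then deriv T a else T z / (z - a))" for z
    have F1: "F1 holomorphic_on UNIV" unfolding F1_def[abs_def] using F zero True by (intro hol) auto
    have T1: "T1 holomorphic_on UNIV" unfolding T1_def[abs_def] using T True by (intro hol) auto
    have op: "open {z. T1 z \<noteq> 0}"
      using open_Collect_neq[OF holomorphic_on_imp_continuous_on[OF T1] continuous_on_const] by simp
    have "(\<lambda>z. F1 z / T1 z) holomorphic_on {z. T1 z \<noteq> 0}"
      by (intro holomorphic_intros holomorphic_on_subset[OF F1] holomorphic_on_subset[OF T1]) auto
    moreover have "F1 z / T1 z = ?g z" if "z \<in> {z. T1 z \<noteq> 0}" for z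
      using that True by (auto simp: F1_def T1_def)
    ultimately have "?g holomorphic_on {z. T1 z \<noteq> 0}"
      by (rule holomorphic_transform)
    moreover have "T1 a \<noteq> 0" using zero True by (simp add: T1_def)
    ultimately show ?thesis using op by blast
  qed
  thus ?thesis
    by (metis (no_types, lifting) UNIV_I at_within_open field_differentiable_at_within holomorphic_on_def)
qed

context elliptic
begin

lemma entire_theta [holo_intros]: "holo_on f U \<Longrightarrow> holo_on (\<lambda>x. theta \<tau> (f x)) U"
  using holo_on_compose[of f U "theta \<tau>" UNIV] holomorphic_theta by simp

text \<open>On every line in direction \<open>i\<close> the quotient is holomorphic because the
  zeros of theta are simple. Joint holomorphy at a zero follows from the mean value over a circle in
  direction \<open>i\<close>: on the circle theta does not vanish, \<open>g\<close> is there the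
  honest quotient \<open>H\<close>, and one may differentiate under the integral.\<close>

lemma theta_division:
  fixes f :: "complex ^ 'm::finite \<Rightarrow> complex"
  assumes ij: "i \<noteq> j" and f: "entire f" and zero: "\<And>x. x $ i - x $ j \<in> lattice \<Longrightarrow> f x = 0"
  obtains g where "entire g" "\<And>x. f x = theta \<tau> (x $ i - x $ j) * g x"
proof -
  define v :: "complex ^ 'm" where "v = axis i 1"
  define l :: "complex ^ 'm \<Rightarrow> complex" where "l x = x $ i - x $ j" for x
  define T where "T z = theta \<tau> z" for z
  define g where "g x = (if T (l x) = 0 then deriv (\<lambda>\<zeta>. f (x + \<zeta> *s v)) 0 / deriv T (l x)
      else f x / T (l x))" for x
  have l_v: "l (x + \<zeta> *s v) = l x + \<zeta>" for x \<zeta>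
    using ij by (simp add: l_def v_def axis_def)
  have T: "T holomorphic_on UNIV" unfolding T_def[abs_def] by (rule holomorphic_theta)
  have T0: "T z = 0 \<longleftrightarrow> z \<in> lattice" for z by (simp add: T_def theta_eq_0_iff)
  have Tl: "entire (\<lambda>x. T (l x))" unfolding T_def l_def by (intro holo_intros)
  have line: "(\<lambda>\<zeta>. g (x + \<zeta> *s v)) holomorphic_on UNIV" for x
  proof -
    have dT: "deriv (\<lambda>\<zeta>. T (l x + \<zeta>)) \<zeta> = deriv T (l x + \<zeta>)" for \<zeta>
      using deriv_shift_0[of "\<lambda>\<zeta>. T (l x + \<zeta>)" \<zeta>] deriv_shift_0[of T "l x + \<zeta>"]
      by (simp add: o_def add.assoc)
    have dF: "deriv (\<lambda>\<zeta>. f (x + \<zeta> *s v)) \<zeta> = deriv (\<lambda>\<zeta>'. f ((x + \<zeta> *s v) + \<zeta>' *s v)) 0" for \<zeta>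
      using deriv_shift_0[of "\<lambda>\<zeta>. f (x + \<zeta> *s v)" \<zeta>]
      by (simp add: o_def vector_sadd_rdistrib add.assoc)
    have hT: "(\<lambda>\<zeta>. T (l x + \<zeta>)) holomorphic_on UNIV"
    proof -
      have "(\<lambda>\<zeta>. l x + \<zeta>) holomorphic_on UNIV" by (intro holomorphic_intros)
      from holomorphic_on_compose[OF this holomorphic_on_subset[OF T]] show ?thesis
        by (simp add: o_def)
    qed
    have z: "f (x + \<zeta> *s v) = 0 \<and> deriv (\<lambda>\<zeta>. T (l x + \<zeta>)) \<zeta> \<noteq> 0" if "T (l x + \<zeta>) = 0" for \<zeta>
    proof -
      have "l x + \<zeta> \<in> lattice" using that T0 by simp
      thus ?thesis
        using zero[of "x + \<zeta> *s v", folded l_def] deriv_theta_nonzero[of "l x + \<zeta>"]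
        unfolding dT l_v by (simp add: T_def[abs_def])
    qed
    show ?thesis
      using holomorphic_quotient[OF holo_on_entire_line[OF f, of x v] hT z]
      unfolding dT dF g_def l_v .
  qed
  have "holo_at g x0" for x0
  proof (cases "T (l x0) = 0")
    case False
    have op: "open {x. T (l x) \<noteq> 0}"
      using open_Collect_neq[OF holo_on_imp_continuous_on[OF Tl] continuous_on_const] by simp
    have "holo_on (\<lambda>x. f x / T (l x)) {x. T (l x) \<noteq> 0}"
      by (intro holo_on_divide holo_on_subset[OF f] holo_on_subset[OF Tl]) auto
    hence "holo_on g {x. T (l x) \<noteq> 0}"
      using op by (rule holo_on_transform) (simp add: g_def)
    thus ?thesis using False unfolding holo_on_def by blast
  next
    case True
    \<comment> \<open>A point outside the zero set shows that \<open>T\<close> is not identically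
      zero, so that its zeros are isolated.\<close>
    have half: "T (1 / 2) \<noteq> 0" using T0 half_notin_lattice by simp
    obtain R where R: "R > 0" "\<And>z. z \<in> ball (l x0) R - {l x0} \<Longrightarrow> T z \<noteq> 0"
      by (rule isolated_zeros[OF T open_UNIV connected_UNIV UNIV_I True UNIV_I half]) (rule that, auto)
    \<comment> \<open>For \<open>x\<close> in the ball \<open>U\<close> of radius
      \<open>r / 2\<close> the difference \<open>l x\<close> of two coordinates moves by less than
      \<open>r\<close>. On a circle of radius \<open>2 * r\<close> the argument therefore keeps a
      distance strictly between \<open>r\<close> and \<open>3 * r = R\<close> from
      \<open>l x0\<close>, where \<open>T\<close> has no zero.\<close>
    define r where "r = R / 3"
    have r: "r > 0" using R by (simp add: r_def)
    define W where "W = {x. T (l x) \<noteq> 0}"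
    have W: "open W"
      unfolding W_def using open_Collect_neq[OF holo_on_imp_continuous_on[OF Tl] continuous_on_const] by simp
    define H where "H x = f x / T (l x)" for x
    have H: "holo_on H W"
      unfolding H_def W_def by (intro holo_on_divide holo_on_subset[OF f] holo_on_subset[OF Tl]) auto
    obtain H' where H': "continuous_on W H'" "\<And>x. x \<in> W \<Longrightarrow> (H has_derivative blinfun_apply (H' x)) (at x)"
      "\<And>x c v. x \<in> W \<Longrightarrow> H' x (c *s v) = c * H' x v"
      using holo_on_C1[OF H W] by metis
    define \<gamma> where "\<gamma> = circlepath 0 (2 * r)"
    have \<gamma>: "norm (\<gamma> t) = 2 * r" for t
      using r by (simp add: \<gamma>_def circlepath norm_mult)
    define U where "U = ball x0 (r / 2)"
    have in_W: "x + \<gamma> t *s v \<in> W" if "x \<in> U" for x t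
    proof -
      have "norm (l x - l x0) = norm ((x - x0) $ i - (x - x0) $ j)"
        by (simp add: l_def algebra_simps)
      also have "\<dots> \<le> norm (x - x0) + norm (x - x0)"
        by (intro order_trans[OF norm_triangle_ineq4] add_mono Finite_Cartesian_Product.norm_nth_le)
      also have "\<dots> < r" using that by (simp add: U_def dist_norm norm_minus_commute)
      finally have 1: "norm (l x - l x0) < r" .
      have "norm ((l x - l x0) + \<gamma> t) \<le> norm (l x - l x0) + norm (\<gamma> t)"
        by (rule norm_triangle_ineq)
      hence "norm ((l x + \<gamma> t) - l x0) < R" using 1 by (simp add: \<gamma> r_def algebra_simps)
      moreover have "l x + \<gamma> t \<noteq> l x0"
      proof
        assume "l x + \<gamma> t = l x0"
        hence "norm (l x - l x0) = norm (\<gamma> t)"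
          by (metis add_diff_cancel_left' minus_diff_eq norm_minus_cancel)
        thus False using 1 \<gamma>[of t] r by simp
      qed
      ultimately have "T (l x + \<gamma> t) \<noteq> 0"
        using R(2)[of "l x + \<gamma> t"] by (simp add: dist_norm norm_minus_commute)
      thus ?thesis by (simp add: W_def l_v)
    qed
    have eq: "g x = integral (cbox 0 1) (\<lambda>t. H (x + \<gamma> t *s v))" if "x \<in> U" for x
    proof -
      have "g x = integral {0..1} (\<lambda>t. g (x + \<gamma> t *s v))"
        using circle_mean[OF line, of "2 * r" x] r unfolding \<gamma>_def by simp
      also have "\<dots> = integral {0..1} (\<lambda>t. H (x + \<gamma> t *s v))"
        using in_W[OF that] by (intro integral_cong) (auto simp: g_def H_def W_def)
      finally show ?thesis by (simp add: cbox_interval)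
    qed
    have cont: "continuous_on (U \<times> cbox 0 1) (\<lambda>p. H' (fst p + \<gamma> (snd p) *s v))"
      using in_W by (intro continuous_on_compose2[OF H'(1)])
        (auto intro!: continuous_intros simp: \<gamma>_def circlepath)
    have contH: "continuous_on (cbox 0 1) (\<lambda>t. H (x + \<gamma> t *s v))" if "x \<in> U" for x
      using in_W[OF that] by (intro continuous_on_compose2[OF holo_on_imp_continuous_on[OF H]])
        (auto intro!: continuous_intros simp: \<gamma>_def circlepath)
    have contH': "continuous_on (cbox 0 1) (\<lambda>t. H' (x + \<gamma> t *s v))" if "x \<in> U" for x
      using in_W[OF that] by (intro continuous_on_compose2[OF H'(1)])
        (auto intro!: continuous_intros simp: \<gamma>_def circlepath)
    have x0: "x0 \<in> U" using r by (simp add: U_def)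
    have at: "at x0 within U = at x0"
      using x0 by (intro at_within_open) (auto simp: U_def)
    have "((\<lambda>x. integral (cbox 0 1) (\<lambda>t. H (x + \<gamma> t *s v))) has_derivative
        integral (cbox 0 1) (\<lambda>t. H' (x0 + \<gamma> t *s v))) (at x0 within U)"
    proof (rule leibniz_rule)
      fix x and t :: real assume x: "x \<in> U"
      have "((\<lambda>x. x + \<gamma> t *s v) has_derivative (\<lambda>x. x)) (at x within U)"
        by (auto intro!: derivative_eq_intros)
      from has_derivative_compose[OF this H'(2)[OF in_W[OF x]]]
      show "((\<lambda>x. H (x + \<gamma> t *s v)) has_derivative H' (x + \<gamma> t *s v)) (at x within U)" .
    next
      fix x assume "x \<in> U"
      thus "(\<lambda>t. H (x + \<gamma> t *s v)) integrable_on cbox 0 1"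
        by (intro integrable_continuous contH)
    qed (use cont x0 in \<open>auto simp: U_def case_prod_beta\<close>)
    hence "((\<lambda>x. integral (cbox 0 1) (\<lambda>t. H (x + \<gamma> t *s v))) has_derivative
        integral (cbox 0 1) (\<lambda>t. H' (x0 + \<gamma> t *s v))) (at x0)"
      unfolding at .
    hence "(g has_derivative integral (cbox 0 1) (\<lambda>t. H' (x0 + \<gamma> t *s v))) (at x0)"
      by (rule has_derivative_transform_within_open[OF _ _ x0]) (simp_all add: eq, simp add: U_def)
    moreover have "blinfun_apply (integral (cbox 0 1) (\<lambda>t. H' (x0 + \<gamma> t *s v))) (c *s u) =
        c * blinfun_apply (integral (cbox 0 1) (\<lambda>t. H' (x0 + \<gamma> t *s v))) u" for c u
      using integrable_continuous[OF contH'[OF x0]] in_W[OF x0]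
      by (simp add: blinfun_apply_integral H'(3))
    ultimately show ?thesis by blast
  qed
  hence "entire g" unfolding holo_on_def by blast
  moreover have "f x = theta \<tau> (x $ i - x $ j) * g x" for x
    using zero[of x] by (auto simp: g_def T_def l_def theta_eq_0_iff)
  ultimately show ?thesis using that by blast
qed

end

section \<open>Values of meromorphic functions at a point\<close>

lemma has_valueI:
  assumes "eventually (\<lambda>x. f x = F x) generic" "open V" "x \<in> V" "holo_on F V"
  shows "has_value f x (F x)"
proof -
  obtain D where D: "open D" "closure D = UNIV" "\<forall>x\<in>D. f x = F x"
    using assms(1) by (auto simp: eventually_generic)
  have "agree_on V f F"
    unfolding agree_on_def
    using D assms(2) closure_open_Int_superset[of V D] closure_subset[of V]
    by (intro exI[of _ "V \<inter> D"]) auto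
  thus ?thesis unfolding has_value_def using assms by blast
qed

text \<open>If the values differed, then so would \<open>g\<close> and \<open>F\<close> on a whole
  neighbourhood of \<open>x\<close>. That neighbourhood meets the dense set where
  \<open>f = g\<close>, and the open intersection contains a point where also
  \<open>f = F\<close>.\<close>

lemma has_valueD:
  assumes "has_value f x c" "eventually (\<lambda>x. f x = F x) generic" "open V" "x \<in> V" "continuous_on V F"
  shows "c = F x"
proof (rule ccontr)
  assume ne: "c \<noteq> F x"
  obtain U g where U: "open U" "x \<in> U" "holo_on g U" "agree_on U f g" "g x = c"
    using assms(1) unfolding has_value_def by blast
  obtain D where D: "open D" "D \<subseteq> U" "U \<subseteq> closure D" "\<forall>x\<in>D. f x = g x"
    using U(4) unfolding agree_on_def by blast
  define S where "S = (U \<inter> V) \<inter> (\<lambda>y. g y - F y) -` (- {0})"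
  have "continuous_on (U \<inter> V) (\<lambda>y. g y - F y)"
    using holo_on_imp_continuous_on[OF U(3)] assms(5)
    by (intro continuous_intros) (auto intro: continuous_on_subset)
  hence S: "open S"
    unfolding S_def using U(1) assms(3) by (intro continuous_open_preimage) auto
  have "x \<in> S" using ne U assms(4) by (simp add: S_def)
  hence "S \<inter> closure D \<noteq> {}" using D(3) by (auto simp: S_def)
  hence "S \<inter> D \<noteq> {}" using open_Int_closure_eq_empty[OF S] by blast
  then obtain y where "y \<in> S \<inter> D" "f y = F y"
    using generic_imp_open[OF assms(2) open_Int[OF S D(1)]] by blast
  thus False using D(4) by (auto simp: S_def)
qed

section \<open>Quasi-periodicity\<close>

text \<open>The admissible arguments of theta functions: integrality on \<open>axis j 1\<close>
  makes a shift of one coordinate by \<open>1\<close> or \<open>\<tau>\<close> a lattice shift of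
  the argument.\<close>

definition int_linear :: "(complex ^ 'm::finite \<Rightarrow> complex) \<Rightarrow> bool" where
  "int_linear l \<longleftrightarrow> (\<forall>x y. l (x + y) = l x + l y) \<and> (\<forall>c x. l (c *s x) = c * l x) \<and> (\<forall>j. l (axis j 1) \<in> \<int>)"

named_theorems int_linear_intros

lemma int_linear_component [int_linear_intros]: "int_linear (\<lambda>x. x $ i)"
  by (auto simp: int_linear_def axis_def)

lemma int_linear_add [int_linear_intros]: "int_linear l \<Longrightarrow> int_linear m \<Longrightarrow> int_linear (\<lambda>x. l x + m x)"
  by (auto simp: int_linear_def algebra_simps)

lemma int_linear_diff [int_linear_intros]: "int_linear l \<Longrightarrow> int_linear m \<Longrightarrow> int_linear (\<lambda>x. l x - m x)"
  by (auto simp: int_linear_def algebra_simps)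

lemma int_linear_mult [int_linear_intros]: "c \<in> \<int> \<Longrightarrow> int_linear l \<Longrightarrow> int_linear (\<lambda>x. c * l x)"
  by (auto simp: int_linear_def algebra_simps)

lemma int_linear_expand:
  assumes "int_linear l"
  shows "l x = (\<Sum>i\<in>UNIV. x $ i * l (axis i 1))"
proof -
  have s: "l (\<Sum>i\<in>A. f i) = (\<Sum>i\<in>A. l (f i))" for f :: "_ \<Rightarrow> complex ^ 'a" and A
  proof (induction A rule: infinite_finite_induct)
    case (infinite A)
    have "l (0 *s 0) = 0" using assms unfolding int_linear_def by (metis mult_zero_left)
    thus ?case using infinite by simp
  next
    case empty
    have "l (0 *s 0) = 0" using assms unfolding int_linear_def by (metis mult_zero_left)
    thus ?case by simp
  qed (use assms in \<open>auto simp: int_linear_def\<close>)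
  have "l x = l (\<Sum>i\<in>UNIV. x $ i *s axis i 1)"
    by (simp add: basis_expansion)
  thus ?thesis using assms unfolding s by (simp add: int_linear_def)
qed

lemma holo_on_int_linear: "int_linear l \<Longrightarrow> holo_on l U"
proof -
  assume l: "int_linear l"
  have "holo_on (\<lambda>x. \<Sum>i\<in>UNIV. x $ i * l (axis i 1)) U" by (intro holo_intros)
  thus ?thesis unfolding int_linear_expand[OF l, symmetric] .
qed

text \<open>Forms are kept as functions, which can be added and compared without matrix
  computations; a symmetric integer matrix is extracted only where the section property asks for
  one.\<close>

definition integral_form :: "(complex ^ 'm::finite \<Rightarrow> complex) \<Rightarrow> bool" where
  "integral_form Q \<longleftrightarrow> (\<exists>N. transpose N = N \<and> Q = quad_form N)"

lemma integral_form_add [int_linear_intros]: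
  assumes "integral_form P" "integral_form Q"
  shows "integral_form (\<lambda>x. P x + Q x)"
proof -
  obtain M N where "transpose M = M" "P = quad_form M" "transpose N = N" "Q = quad_form N"
    using assms by (auto simp: integral_form_def)
  thus ?thesis unfolding integral_form_def
    by (intro exI[of _ "M + N"])
      (auto simp: quad_form_def fun_eq_iff algebra_simps sum.distrib transpose_def vec_eq_iff)
qed

lemma integral_form_minus [int_linear_intros]:
  assumes "integral_form P"
  shows "integral_form (\<lambda>x. - P x)"
proof -
  obtain M where "transpose M = M" "P = quad_form M"
    using assms by (auto simp: integral_form_def)
  thus ?thesis unfolding integral_form_def
    by (intro exI[of _ "- M"])
      (auto simp: quad_form_def fun_eq_iff sum_negf transpose_def vec_eq_iff)
qed

lemma integral_form_diff [int_linear_intros]: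
  "integral_form P \<Longrightarrow> integral_form Q \<Longrightarrow> integral_form (\<lambda>x. P x - Q x)"
  using integral_form_add[of P "\<lambda>x. - Q x"] by (simp add: integral_form_minus)

lemma integral_form_0 [int_linear_intros]: "integral_form (\<lambda>x. 0)"
  unfolding integral_form_def
  by (intro exI[of _ 0]) (auto simp: quad_form_def fun_eq_iff transpose_def vec_eq_iff)

lemma integral_form_sum [int_linear_intros]:
  "(\<And>i. i \<in> A \<Longrightarrow> integral_form (Q i)) \<Longrightarrow> integral_form (\<lambda>x. \<Sum>i\<in>A. Q i x)"
  by (induction A rule: infinite_finite_induct) (auto intro!: int_linear_intros)

lemma integral_form_square [int_linear_intros]:
  assumes "int_linear l"
  shows "integral_form (\<lambda>x. l x ^ 2)"
proof -
  have "\<exists>m. \<forall>j. l (axis j 1) = of_int (m j)"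
    using assms unfolding int_linear_def Ints_def by (intro choice) auto
  then obtain m where m: "\<And>j. l (axis j 1) = of_int (m j)" by blast
  have "l x ^ 2 = quad_form (\<chi> i j. m i * m j) x" for x
    unfolding int_linear_expand[OF assms, of x] power2_eq_square quad_form_def m sum_product
    by (simp add: mult_ac)
  thus ?thesis unfolding integral_form_def
    by (intro exI[of _ "\<chi> i j. m i * m j"]) (auto simp: transpose_def vec_eq_iff mult.commute)
qed

text \<open>The factor 2 is essential, since a symmetric integer matrix gives even coefficients to
  mixed monomials. Polarisation reduces the claim to squares.\<close>

lemma integral_form_mult [int_linear_intros]:
  assumes "int_linear l" "int_linear m"
  shows "integral_form (\<lambda>x. 2 * (l x * m x))"
proof -
  have "(\<lambda>x. 2 * (l x * m x)) = (\<lambda>x. (l x + m x) ^ 2 - l x ^ 2 - m x ^ 2)"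
    by (rule ext) (simp add: power2_eq_square algebra_simps)
  thus ?thesis using assms by (auto intro!: int_linear_intros)
qed

lemma holo_on_integral_form: "integral_form Q \<Longrightarrow> holo_on Q U"
  unfolding integral_form_def quad_form_def[abs_def] by (auto intro!: holo_intros)

context elliptic
begin

definition period :: "bool \<Rightarrow> complex" where
  "period b = (if b then \<tau> else 1)"

text \<open>Both multipliers of the bundle, read off from values of the form:
  \<open>Q (axis j 1)\<close> is the diagonal entry that determines the sign, and the difference
  quotient in direction \<open>\<tau>\<close> is
  \<open>2 * (\<Sum>k. N_jk x_k) + \<tau> N_jj\<close>. The exponent is additive in
  \<open>Q\<close>, which turns products of sections into sums of forms.\<close>

definition multiplier :: "(complex ^ 'm::finite \<Rightarrow> complex) \<Rightarrow> 'm \<Rightarrow> bool \<Rightarrow> complex ^ 'm \<Rightarrow> complex" where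
  "multiplier Q j b x = exp (of_real pi * \<i> * Q (axis j 1)
      - (if b then of_real pi * \<i> / \<tau> * (Q (x + axis j \<tau>) - Q x) else 0))"

definition quasi_periodic :: "(complex ^ 'm::finite \<Rightarrow> complex) \<Rightarrow> (complex ^ 'm \<Rightarrow> complex) \<Rightarrow> bool" where
  "quasi_periodic Q f \<longleftrightarrow> (\<forall>j b x. f (x + axis j (period b)) = multiplier Q j b x * f x)"

definition weakly_quasi_periodic :: "(complex ^ 'm::finite \<Rightarrow> complex) \<Rightarrow> (complex ^ 'm \<Rightarrow> complex) \<Rightarrow> bool" where
  "weakly_quasi_periodic Q f \<longleftrightarrow>
     (\<forall>j b. eventually (\<lambda>x. f (x + axis j (period b)) = multiplier Q j b x * f x) generic)"

lemma multiplier_add: "multiplier (\<lambda>x. P x + Q x) j b x = multiplier P j b x * multiplier Q j b x"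
  unfolding multiplier_def exp_add[symmetric]
  by (rule arg_cong[where f = exp]) (simp add: algebra_simps add_divide_distrib)

lemma multiplier_minus: "multiplier (\<lambda>x. - Q x) j b x = inverse (multiplier Q j b x)"
  unfolding multiplier_def exp_minus[symmetric] by (rule arg_cong[where f = exp]) (simp add: algebra_simps)

lemma multiplier_diff: "multiplier (\<lambda>x. P x - Q x) j b x = multiplier P j b x / multiplier Q j b x"
  using multiplier_add[of P "\<lambda>x. - Q x"] by (simp add: multiplier_minus divide_inverse)

lemma multiplier_nonzero [simp]: "multiplier Q j b x \<noteq> 0"
  by (simp add: multiplier_def)

lemma entire_multiplier:
  fixes Q :: "complex ^ 'm::finite \<Rightarrow> complex"
  assumes "entire Q"
  shows "entire (multiplier Q j b)"
proof -
  have 1: "holo_on (\<lambda>x. exp (g x)) UNIV" if "entire g" for g :: "complex ^ 'm \<Rightarrow> complex"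
    using that by (rule holo_on_compose[where A = UNIV]) (auto intro!: holomorphic_intros)
  have 2: "entire (\<lambda>x. if b then c * (Q (x + axis j \<tau>) - Q x) else 0)" for c
    by (cases b; simp only: if_True if_False; intro holo_intros entire_shift assms)
  show ?thesis
    unfolding multiplier_def[abs_def] by (intro 1 holo_intros 2)
qed

lemma quasi_periodic_imp_weakly: "quasi_periodic Q f \<Longrightarrow> weakly_quasi_periodic Q f"
  unfolding quasi_periodic_def weakly_quasi_periodic_def by simp

lemma quasi_periodic_mult:
  "quasi_periodic P f \<Longrightarrow> quasi_periodic Q g \<Longrightarrow> quasi_periodic (\<lambda>x. P x + Q x) (\<lambda>x. f x * g x)"
  unfolding quasi_periodic_def by (simp add: multiplier_add)

lemma quasi_periodic_divide:
  "quasi_periodic P f \<Longrightarrow> quasi_periodic Q g \<Longrightarrow> quasi_periodic (\<lambda>x. P x - Q x) (\<lambda>x. f x / g x)"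
  unfolding quasi_periodic_def by (simp add: multiplier_diff)

lemma quasi_periodic_sum:
  "(\<And>i. i \<in> A \<Longrightarrow> quasi_periodic Q (f i)) \<Longrightarrow> quasi_periodic Q (\<lambda>x. \<Sum>i\<in>A. f i x)"
  unfolding quasi_periodic_def by (simp add: sum_distrib_left)

lemma quasi_periodic_1: "quasi_periodic (\<lambda>x. 0) (\<lambda>x. 1)"
  unfolding quasi_periodic_def by (simp add: multiplier_def)

lemma quasi_periodic_prod:
  "(\<And>i. i \<in> A \<Longrightarrow> quasi_periodic (Q i) (f i)) \<Longrightarrow> quasi_periodic (\<lambda>x. \<Sum>i\<in>A. Q i x) (\<lambda>x. \<Prod>i\<in>A. f i x)"
  by (induction A rule: infinite_finite_induct) (auto intro!: quasi_periodic_1 quasi_periodic_mult)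

lemma tau_nonzero: "\<tau> \<noteq> 0" using im_tau by auto

text \<open>\<open>c^2 - c\<close> is even. This matches the sign \<open>(-1)^c\<close> produced by
  theta with the diagonal coefficient \<open>c^2\<close> of its form.\<close>

lemma exp_pi_square: "exp (of_real pi * \<i> * of_int c ^ 2) = exp (of_real pi * \<i> * of_int c)"
proof -
  have "even (c ^ 2 - c)" by simp
  then obtain m where "c ^ 2 - c = 2 * m" by (rule evenE)
  hence "c ^ 2 = c + 2 * m" by simp
  hence m: "of_int c ^ 2 = (of_int c + 2 * of_int m :: complex)"
    by (metis of_int_add of_int_mult of_int_numeral of_int_power)
  show ?thesis unfolding m exp_eq by (intro exI[of _ m]) (simp add: algebra_simps)
qed

text \<open>The basic building block: all forms of explicit functions below are integer combinations
  of such squares.\<close>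

lemma quasi_periodic_theta:
  assumes l: "int_linear l"
  shows "quasi_periodic (\<lambda>x. l x ^ 2) (\<lambda>x. theta \<tau> (l x))"
  unfolding quasi_periodic_def
proof (intro allI)
  fix j b x
  obtain c where c: "l (axis j 1) = of_int c"
    using l unfolding int_linear_def Ints_def by blast
  have ax: "l (x + axis j t) = l x + t * of_int c" for t
  proof -
    have "axis j t = t *s (axis j 1 :: complex ^ 'a)"
      by (simp add: vec_eq_iff axis_def)
    thus ?thesis using l c by (simp add: int_linear_def)
  qed
  show "theta \<tau> (l (x + axis j (period b))) = multiplier (\<lambda>x. l x ^ 2) j b x * theta \<tau> (l x)"
  proof (cases b)
    case False
    thus ?thesis
      using theta_shift[of "l x" c 0]
      by (simp add: ax period_def multiplier_def c exp_pi_square)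
  next
    case True
    have "of_real pi * \<i> / \<tau> * ((l x + \<tau> * of_int c) ^ 2 - l x ^ 2) =
        2 * of_real pi * \<i> * of_int c * l x + of_real pi * \<i> * \<tau> * of_int c ^ 2"
      using tau_nonzero by (simp add: field_simps power2_eq_square)
    thus ?thesis
      using True theta_shift[of "l x" 0 c]
      by (simp add: ax period_def multiplier_def c exp_diff exp_pi_square mult.commute[of \<tau>] exp_add)
  qed
qed

lemma weakly_quasi_periodic_cong:
  assumes "eventually (\<lambda>x. f x = g x) generic" "weakly_quasi_periodic Q f"
  shows "weakly_quasi_periodic Q g"
  unfolding weakly_quasi_periodic_def
proof (intro allI)
  fix j b
  have "eventually (\<lambda>x. f (x + axis j (period b)) = multiplier Q j b x * f x) generic"
    using assms(2) unfolding weakly_quasi_periodic_def by blast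
  with assms(1) generic_shift[OF assms(1), of "axis j (period b)"]
  show "eventually (\<lambda>x. g (x + axis j (period b)) = multiplier Q j b x * g x) generic"
    by eventually_elim simp
qed

text \<open>Turns a generic relation for a meromorphic product into an exact one for its entire
  factor. Off the zeros of \<open>A\<close> the relation can be divided by \<open>A\<close>; both
  sides of the result are continuous, so it holds everywhere.\<close>

lemma quasi_periodic_factor:
  assumes eq: "eventually (\<lambda>x. f x = A x * E x) generic"
    and f: "weakly_quasi_periodic P f" and A: "quasi_periodic Q A"
    and nz: "eventually (\<lambda>x. A x \<noteq> 0) generic" and E: "entire E" and PQ: "entire P" "entire Q"
  shows "quasi_periodic (\<lambda>x. P x - Q x) E"
  unfolding quasi_periodic_def
proof (intro allI)
  fix j b x
  have wf: "weakly_quasi_periodic P (\<lambda>x. A x * E x)"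
    using weakly_quasi_periodic_cong[OF eq f] .
  have "eventually (\<lambda>x. A (x + axis j (period b)) * E (x + axis j (period b)) =
      multiplier P j b x * (A x * E x)) generic"
    using wf unfolding weakly_quasi_periodic_def by blast
  with nz have "eventually (\<lambda>x. E (x + axis j (period b)) =
      multiplier (\<lambda>x. P x - Q x) j b x * E x) generic"
  proof eventually_elim
    case (elim x)
    have "A (x + axis j (period b)) = multiplier Q j b x * A x"
      using A unfolding quasi_periodic_def by blast
    with elim have "A x * (multiplier Q j b x * E (x + axis j (period b))) = A x * (multiplier P j b x * E x)"
      by (simp add: mult_ac)
    hence "multiplier Q j b x * E (x + axis j (period b)) = multiplier P j b x * E x"
      using elim(1) by simp
    thus ?case by (simp add: multiplier_diff field_simps)
  qed
  hence "(\<lambda>x. E (x + axis j (period b))) = (\<lambda>x. multiplier (\<lambda>x. P x - Q x) j b x * E x)"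
    by (rule generic_eq_imp_eq)
      (intro holo_on_imp_continuous_on holo_intros entire_shift E entire_multiplier PQ)+
  thus "E (x + axis j (period b)) = multiplier (\<lambda>x. P x - Q x) j b x * E x"
    by (rule fun_cong)
qed

lemma quad_form_axis: "quad_form N (axis j t) = of_int (N $ j $ j) * t ^ 2"
proof -
  have "quad_form N (axis j t) = (\<Sum>i\<in>UNIV. \<Sum>k\<in>UNIV. if i = j then (if k = j then of_int (N $ j $ j) * t ^ 2 else 0) else 0)"
    unfolding quad_form_def by (intro sum.cong) (auto simp: axis_def power2_eq_square)
  thus ?thesis by (simp add: sum.If_cases)
qed

lemma quad_form_shift:
  assumes "transpose N = N"
  shows "quad_form N (x + axis j t) = quad_form N x + 2 * t * (\<Sum>k\<in>UNIV. of_int (N $ j $ k) * x $ k) + of_int (N $ j $ j) * t ^ 2"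
proof -
  have sym: "N $ i $ k = N $ k $ i" for i k
    using assms by (metis transpose_def vec_lambda_beta)
  have "quad_form N (x + axis j t) = quad_form N x +
      (\<Sum>i\<in>UNIV. \<Sum>k\<in>UNIV. of_int (N $ i $ k) * x $ i * axis j t $ k) +
      (\<Sum>i\<in>UNIV. \<Sum>k\<in>UNIV. of_int (N $ i $ k) * axis j t $ i * x $ k) + quad_form N (axis j t)"
    unfolding quad_form_def sum.distrib[symmetric] by (simp add: algebra_simps)
  also have "(\<Sum>i\<in>UNIV. \<Sum>k\<in>UNIV. of_int (N $ i $ k) * x $ i * axis j t $ k) =
      (\<Sum>i\<in>UNIV. \<Sum>k\<in>UNIV. if k = j then of_int (N $ i $ j) * x $ i * t else 0)"
    by (intro sum.cong) (auto simp: axis_def)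
  also have "\<dots> = t * (\<Sum>k\<in>UNIV. of_int (N $ j $ k) * x $ k)"
    by (simp add: sum_distrib_left mult_ac sym)
  also have "(\<Sum>i\<in>UNIV. \<Sum>k\<in>UNIV. of_int (N $ i $ k) * axis j t $ i * x $ k) =
      (\<Sum>i\<in>UNIV. if i = j then (\<Sum>k\<in>UNIV. of_int (N $ j $ k) * t * x $ k) else 0)"
    by (intro sum.cong) (auto simp: axis_def)
  also have "\<dots> = t * (\<Sum>k\<in>UNIV. of_int (N $ j $ k) * x $ k)"
    by (simp add: sum_distrib_left mult_ac)
  finally show ?thesis by (simp add: quad_form_axis algebra_simps)
qed

lemma multiplier_quad_form:
  assumes "transpose N = N"
  shows "multiplier (quad_form N) j b x = (-1) powi (N $ j $ j) * (if b then
     exp (- (2 * of_real pi * \<i> * (\<Sum>k\<in>UNIV. of_int (N $ j $ k) * x $ k))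
                 - of_real pi * \<i> * \<tau> * of_int (N $ j $ j)) else 1)"
proof -
  have "exp (of_real pi * \<i>) powi (N $ j $ j) = exp (of_int (N $ j $ j) * (of_real pi * \<i>))"
    by (simp only: exp_power_int)
  hence 1: "exp (of_real pi * \<i> * of_int (N $ j $ j)) = (-1) powi (N $ j $ j)"
    by (simp add: mult_ac)
  have 2: "of_real pi * \<i> / \<tau> * (quad_form N (x + axis j \<tau>) - quad_form N x) =
      2 * of_real pi * \<i> * (\<Sum>k\<in>UNIV. of_int (N $ j $ k) * x $ k) + of_real pi * \<i> * \<tau> * of_int (N $ j $ j)"
    unfolding quad_form_shift[OF assms] using tau_nonzero by (simp add: divide_simps) (simp add: algebra_simps power2_eq_square)
  show ?thesis
    unfolding multiplier_def 2 quad_form_axis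
    by (simp add: 1 exp_diff exp_minus exp_add divide_inverse)
qed

lemma transforms_iff:
  assumes "transpose N = N"
  shows "transforms \<tau> N 0 f \<longleftrightarrow> weakly_quasi_periodic (quad_form N) f"
  unfolding transforms_def weakly_quasi_periodic_def mero_eq_iff_generic all_bool_eq multiplier_quad_form[OF assms]
  by (auto simp: period_def)

lemma quasi_periodic_unique:
  assumes M: "transpose M = M" and N: "transpose N = N"
    and f: "weakly_quasi_periodic (quad_form M) f" "weakly_quasi_periodic (quad_form N) f"
    and nz: "eventually (\<lambda>x. f x \<noteq> 0) generic"
  shows "M = N"
proof -
  have mult: "multiplier (quad_form M) j b = multiplier (quad_form N) j b" for j b
  proof (rule generic_eq_imp_eq)
    have "eventually (\<lambda>x. f (x + axis j (period b)) = multiplier (quad_form M) j b x * f x) generic"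
      "eventually (\<lambda>x. f (x + axis j (period b)) = multiplier (quad_form N) j b x * f x) generic"
      using f unfolding weakly_quasi_periodic_def by blast+
    with nz show "eventually (\<lambda>x. multiplier (quad_form M) j b x = multiplier (quad_form N) j b x) generic"
      by eventually_elim auto
    show "continuous_on UNIV (multiplier (quad_form M) j b)" "continuous_on UNIV (multiplier (quad_form N) j b)"
      unfolding quad_form_def[abs_def]
      by (intro holo_on_imp_continuous_on entire_multiplier holo_intros)+
  qed
  have "M $ j $ k = N $ j $ k" for j k
  proof -
    \<comment> \<open>At a purely imaginary point the exponential has the real value
      \<open>exp (2 pi P_jk)\<close>, whose norm recovers the integer entry without any ambiguity
      modulo \<open>2 pi i\<close>.\<close>
    define s where "s P = exp (- (2 * of_real pi * \<i> * (of_int (P $ j $ k) * \<i>)))" for P :: "int ^ 'a ^ 'a"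
    have s: "multiplier (quad_form P) j True (axis k \<i>) = s P * multiplier (quad_form P) j True 0"
      if "transpose P = P" for P
    proof -
      have "(\<Sum>l\<in>UNIV. of_int (P $ j $ l) * axis k \<i> $ l) = (\<Sum>l\<in>UNIV. if l = k then of_int (P $ j $ k) * \<i> else 0)"
        by (intro sum.cong) (auto simp: axis_def)
      thus ?thesis
        unfolding multiplier_quad_form[OF that] s_def
          by (simp add: exp_diff exp_minus divide_inverse mult_ac)
    qed
    have "s M = s N"
      using s[OF M] s[OF N] mult[of j True] by (metis multiplier_nonzero mult_right_cancel)
    hence "norm (s M) = norm (s N)" by simp
    thus ?thesis by (simp add: s_def norm_exp_eq_Re)
  qed
  thus ?thesis by (simp add: vec_eq_iff)
qed

lemma quasi_periodic_zero_shift: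
  fixes f :: "complex ^ 'm::finite \<Rightarrow> complex"
  assumes f: "quasi_periodic Q f" and zero: "f x = 0" and w: "w \<in> lattice"
  shows "f (x + axis j w) = 0"
proof -
  have axis_add: "axis j (s + t) = axis j s + axis j t" for s t :: complex
    by (auto simp: vec_eq_iff axis_def)
  have step: "f (y + axis j (period b)) = 0 \<longleftrightarrow> f y = 0" for y b
    using f unfolding quasi_periodic_def by simp
  have mult: "f (y + axis j (of_int c * period b)) = 0 \<longleftrightarrow> f y = 0" for y b c
  proof (induction c rule: int_induct[where k = 0])
    case base
    have "axis j 0 = (0 :: complex ^ 'm)" by (simp add: vec_eq_iff axis_def)
    thus ?case by (simp only: of_int_0 mult_zero_left add_0_right)
  next
    case (step1 i)
    thus ?case using step[of "y + axis j (of_int i * period b)" b]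
      by (simp add: axis_add distrib_right add.assoc)
  next
    case (step2 i)
    have "of_int i * period b = of_int (i - 1) * period b + period b" by (simp add: algebra_simps)
    thus ?case using step2 step[of "y + axis j (of_int (i - 1) * period b)" b]
      by (simp only: axis_add add.assoc[symmetric])
  qed
  obtain a b where "w = of_int a * period False + of_int b * period True"
    using w by (auto simp: lattice_def period_def)
  thus ?thesis
    using zero mult[of "x + axis j (of_int a * period False)" b True] mult[of x a False]
    by (simp only: axis_add add.assoc[symmetric])
qed

lemma theta_line_nonzero:
  assumes "int_linear l" "l v \<noteq> 0"
  shows "\<exists>c. theta \<tau> (l (x + c *s v)) \<noteq> 0"
proof (intro exI)
  \<comment> \<open>The parameter makes the argument of theta equal to \<open>1 / 2\<close>, which
    is not a lattice point.\<close>
  show "theta \<tau> (l (x + ((1 / 2 - l x) / l v) *s v)) \<noteq> 0"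
    using assms half_notin_lattice by (simp add: int_linear_def theta_eq_0_iff)
qed

lemma generic_theta_nonzero:
  assumes "int_linear l" "l v \<noteq> 0"
  shows "eventually (\<lambda>x. theta \<tau> (l x) \<noteq> 0) generic"
proof -
  obtain c where "theta \<tau> (l (0 + c *s v)) \<noteq> 0" using theta_line_nonzero[OF assms] by blast
  thus ?thesis
    by (intro generic_nonzero[where h = "\<lambda>x. theta \<tau> (l x)"] entire_theta holo_on_int_linear assms(1))
qed

lemma eventually_theta_line_nonzero:
  assumes "int_linear l" "l v \<noteq> 0"
  shows "eventually (\<lambda>\<zeta>. theta \<tau> (l (x + \<zeta> *s v)) \<noteq> 0) (at 0)"
proof -
  obtain c where "theta \<tau> (l (x + c *s v)) \<noteq> 0" using theta_line_nonzero[OF assms] by blast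
  thus ?thesis
    by (intro entire_line_nonzero[where h = "\<lambda>x. theta \<tau> (l x)"] entire_theta holo_on_int_linear assms(1))
qed

text \<open>After division by one theta factor the quotient must still vanish on the other divisors.
  The divisor of \<open>(k, l)\<close> contains lines on which \<open>x $ i - x $ j\<close> varies:
  move a coordinate \<open>r\<close> of \<open>{i, j}\<close> that is different from
  \<open>k\<close> and \<open>l\<close>. Such an \<open>r\<close> exists because the pairs differ
  even as unordered pairs.\<close>

lemma theta_prod_division:
  fixes f :: "complex ^ 'm::finite \<Rightarrow> complex"
  assumes "finite S" and "\<And>i j. (i, j) \<in> S \<Longrightarrow> i \<noteq> j \<and> (j, i) \<notin> S"
    and "entire f" and "\<And>i j x. (i, j) \<in> S \<Longrightarrow> x $ i - x $ j \<in> lattice \<Longrightarrow> f x = 0"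
  obtains g where "entire g" "\<And>x. f x = (\<Prod>(i, j)\<in>S. theta \<tau> (x $ i - x $ j)) * g x"
proof -
  have "\<exists>g. entire g \<and> (\<forall>x. f x = (\<Prod>(i, j)\<in>S. theta \<tau> (x $ i - x $ j)) * g x)"
    using assms
  proof (induction S arbitrary: f rule: finite_induct)
    case empty
    thus ?case by auto
  next
    case (insert p S)
    obtain i j where p: "p = (i, j)" by (cases p)
    have ij: "i \<noteq> j" using insert.prems(1)[of i j] p by auto
    obtain g where g: "entire g" "\<And>x. f x = theta \<tau> (x $ i - x $ j) * g x"
      using theta_division[OF ij insert.prems(2)] insert.prems(3)[of i j] p by blast
    have "g x = 0" if kl: "(k, l) \<in> S" "x $ k - x $ l \<in> lattice" for k l x
    proof -
      have "k \<noteq> l" "(k, l) \<noteq> (i, j)" "(k, l) \<noteq> (j, i)"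
        using insert.prems(1)[of k l] insert.hyps(2) kl(1) p by auto
      hence "\<not> ((i = k \<or> i = l) \<and> (j = k \<or> j = l))" using ij by auto
      then obtain r where r: "r \<in> {i, j}" "r \<noteq> k" "r \<noteq> l" by blast
      define v :: "complex ^ 'm" where "v = axis r 1"
      have v: "v $ k = v $ l" "v $ i - v $ j \<noteq> 0"
        using r ij by (auto simp: v_def axis_def)
      have L: "int_linear (\<lambda>x::complex ^ 'm. x $ i - x $ j)" by (intro int_linear_intros)
      obtain c where c: "theta \<tau> ((x + c *s v) $ i - (x + c *s v) $ j) \<noteq> 0"
        using theta_line_nonzero[OF L, of v x] v(2) by blast
      show ?thesis
      proof (rule line_cancel[OF g(1)])
        show "entire (\<lambda>x. theta \<tau> (x $ i - x $ j))" by (intro holo_intros)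
        show "g (x + \<zeta> *s v) * theta \<tau> ((x + \<zeta> *s v) $ i - (x + \<zeta> *s v) $ j) = 0" for \<zeta>
          using insert.prems(3)[of k l "x + \<zeta> *s v"] kl v(1) g(2)[of "x + \<zeta> *s v"]
          by (simp add: mult.commute)
      qed (rule c)
    qed
    then obtain h where "entire h" "\<And>x. g x = (\<Prod>(i, j)\<in>S. theta \<tau> (x $ i - x $ j)) * h x"
      using insert.IH[OF _ g(1)] insert.prems(1) by blast
    thus ?case using g insert.hyps p by (intro exI[of _ h]) (auto simp: mult.assoc)
  qed
  thus ?thesis using that by blast
qed

end

section \<open>Combinatorics of subsets\<close>

lemma elem_bij:
  assumes "finite K"
  shows "bij_betw (elem K) {1..card K} K"
proof -
  have "bij_betw ((!) (sorted_list_of_set K)) {..<card K} K"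
    using assms by (intro bij_betw_nth) auto
  moreover have "bij_betw (\<lambda>r. r - 1) {1..card K} {..<card K}"
    by (rule bij_betw_byWitness[where f' = Suc]) auto
  ultimately show ?thesis
    using bij_betw_trans unfolding elem_def[abs_def] by (force simp: o_def)
qed

lemma elem_less:
  assumes "finite K" "1 \<le> i" "i < j" "j \<le> card K"
  shows "elem K i < elem K j"
  using assms unfolding elem_def
  by (intro sorted_wrt_nth_less[OF strict_sorted_list_of_set]) auto

lemma card_greater_elem:
  assumes K: "finite K" and r: "r \<in> {1..card K}"
  shows "card {l \<in> K. l > elem K r} = card K - r"
proof -
  have "{l \<in> K. l > elem K r} = elem K ` {r<..card K}"
  proof (intro equalityI subsetI)
    fix l assume l: "l \<in> {l \<in> K. l > elem K r}"
    then obtain s where s: "s \<in> {1..card K}" "l = elem K s"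
      using elem_bij[OF K] unfolding bij_betw_def by blast
    have "r < s"
      using elem_less[OF K, of s r] l s r by (cases s r rule: linorder_cases) auto
    thus "l \<in> elem K ` {r<..card K}" using s by auto
  next
    fix l assume "l \<in> elem K ` {r<..card K}"
    then obtain s where s: "r < s" "s \<le> card K" "l = elem K s" by auto
    thus "l \<in> {l \<in> K. l > elem K r}"
      using elem_less[OF K, of r s] elem_bij[OF K] r unfolding bij_betw_def by auto
  qed
  moreover have "inj_on (elem K) {r<..card K}"
    using elem_bij[OF K] r unfolding bij_betw_def by (auto elim!: inj_on_subset)
  ultimately show ?thesis by (simp add: card_image)
qed

text \<open>Above the \<open>r\<close>-th element of \<open>K\<close> lie \<open>card K - r\<close>
  elements of \<open>K\<close>, and the other indices above it belong to the complement.\<close>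

lemma wnum_elem:
  assumes K: "K \<subseteq> {1..n}" and r: "r \<in> {1..card K}"
  shows "wnum n (elem K r) K = 2 * (int (card K) - int r) - int n + int (elem K r)"
proof -
  have fin: "finite K" using K finite_subset by blast
  have e: "elem K r \<in> K" using elem_bij[OF fin] r unfolding bij_betw_def by blast
  have "{l \<in> {1..n} - K. l > elem K r} = {elem K r<..n} - {l \<in> K. l > elem K r}"
    using e K by auto
  moreover have "{l \<in> K. l > elem K r} \<subseteq> {elem K r<..n}" using K by auto
  ultimately have "card {l \<in> {1..n} - K. l > elem K r} = (n - elem K r) - (card K - r)"
    using fin by (simp only: card_greater_elem[OF fin r, symmetric]) (subst card_Diff_subset, auto)
  moreover have "elem K r \<le> n" using e K by auto
  moreover have "card K - r \<le> n - elem K r"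
  proof -
    have "card {l \<in> K. l > elem K r} \<le> card {elem K r<..n}"
      by (rule card_mono) (use K in auto)
    thus ?thesis unfolding card_greater_elem[OF fin r] by simp
  qed
  ultimately show ?thesis
    unfolding wnum_def card_greater_elem[OF fin r] using e K r by (auto simp: of_nat_diff subset_iff)
qed

lemma sum_pairs_Suc:
  "(\<Sum>i=1..Suc k. \<Sum>j=Suc i..Suc k. g i j) = (\<Sum>i=1..k. \<Sum>j=Suc i..k. g i j) + (\<Sum>i=1..k. g i (Suc k))"
  for g :: "nat \<Rightarrow> nat \<Rightarrow> 'a::comm_monoid_add"
proof -
  have "(\<Sum>i=1..Suc k. \<Sum>j=Suc i..Suc k. g i j) = (\<Sum>i=1..k. \<Sum>j=Suc i..Suc k. g i j)"
    by simp
  also have "\<dots> = (\<Sum>i=1..k. (\<Sum>j=Suc i..k. g i j) + g i (Suc k))"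
    by (intro sum.cong) auto
  finally show ?thesis by (simp add: sum.distrib)
qed

lemma sum_pairs_symmetric:
  fixes g :: "nat \<Rightarrow> nat \<Rightarrow> complex"
  assumes "\<And>i j. g i j = g j i" "\<And>i. g i i = 0"
  shows "(\<Sum>i=1..k. \<Sum>j=Suc i..k. 2 * g i j) = (\<Sum>i=1..k. \<Sum>j=1..k. g i j)"
proof (induction k)
  case (Suc k)
  have "(\<Sum>i=1..Suc k. \<Sum>j=1..Suc k. g i j) =
      (\<Sum>i=1..k. (\<Sum>j=1..k. g i j) + g i (Suc k)) + ((\<Sum>j=1..k. g (Suc k) j) + g (Suc k) (Suc k))"
    by simp
  also have "\<dots> = (\<Sum>i=1..k. \<Sum>j=1..k. g i j) + (\<Sum>i=1..k. 2 * g i (Suc k))"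
    using assms(1)[of "Suc k"] assms(2) by (simp add: sum.distrib sum_distrib_left)
  finally show ?case using Suc unfolding sum_pairs_Suc by simp
qed simp

text \<open>\<open>t r\<close> occurs positively for the \<open>r - 1\<close> smaller indices and
  negatively for the \<open>k - r\<close> larger ones.\<close>

lemma sum_pairs_difference:
  fixes t :: "nat \<Rightarrow> complex"
  shows "(\<Sum>i=1..k. \<Sum>j=Suc i..k. t j - t i) = (\<Sum>r=1..k. (2 * of_nat r - of_nat k - 1) * t r)"
proof (induction k)
  case (Suc k)
  have "(\<Sum>r=1..Suc k. (2 * of_nat r - of_nat (Suc k) - 1) * t r) =
      (\<Sum>r=1..k. (2 * of_nat r - of_nat k - 1) * t r - t r) + of_nat k * t (Suc k)"
    by (simp add: algebra_simps)
  also have "\<dots> = (\<Sum>r=1..k. (2 * of_nat r - of_nat k - 1) * t r) + (\<Sum>r=1..k. t (Suc k) - t r)"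
    by (simp add: sum_subtractf)
  finally show ?case using Suc unfolding sum_pairs_Suc by simp
qed simp

section \<open>Weight functions on the components\<close>

locale weight_setup = elliptic \<tau> for \<tau> +
  fixes n k :: nat and e :: "nat \<Rightarrow> 'm::finite" and I :: "nat set"
  assumes kn: "k \<le> n" and bij: "bij_betw e {1..n+2} UNIV" and I: "I \<in> ksub n k"
begin

abbreviation Y :: "complex ^ 'm \<Rightarrow> complex" where "Y \<equiv> ycoord n e"
abbreviation L :: "complex ^ 'm \<Rightarrow> complex" where "L \<equiv> lcoord n e"
abbreviation \<psi> :: "complex ^ 'm \<Rightarrow> complex" where "\<psi> x \<equiv> psi \<tau> n I (Y x) (L x)"
abbreviation weight :: "nat set \<Rightarrow> complex ^ 'm \<Rightarrow> complex" where "weight \<equiv> pullback_weight \<tau> n k e I"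

lemma int_linear_YL [int_linear_intros]: "int_linear Y" "int_linear L"
  unfolding ycoord_def[abs_def] lcoord_def[abs_def] by (intro int_linear_intros)+

lemma holo_YL [holo_intros]: "holo_on Y U" "holo_on L U"
  by (intro holo_on_int_linear int_linear_intros)+

lemma ksub_finite: "J \<in> ksub n k \<Longrightarrow> finite J"
  and ksub_card: "J \<in> ksub n k \<Longrightarrow> card J = k"
  and ksub_subset: "J \<in> ksub n k \<Longrightarrow> J \<subseteq> {1..n}"
  by (auto simp: ksub_def intro: finite_subset)

lemma elem_perm_bij:
  assumes "J \<in> ksub n k" "\<sigma> permutes {1..k}"
  shows "bij_betw (\<lambda>r. elem J (\<sigma> r)) {1..k} J"
  using bij_betw_trans[OF permutes_imp_bij[OF assms(2)] elem_bij[OF ksub_finite[OF assms(1)], unfolded ksub_card[OF assms(1)]]]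
  by (simp add: o_def)

definition twist :: "nat set \<Rightarrow> complex ^ 'm \<Rightarrow> complex" where
  "twist J x = (\<Sum>a\<in>J. 2 * (x $ e a * (L x + of_nat (n - k) * Y x))) + (\<Sum>a\<in>J. \<Sum>b\<in>{1..n} - J. (x $ e a - x $ e b) ^ 2)"

lemma twist_form_eq:
  assumes J: "J \<in> ksub n k"
  shows "twist_form k n (zsub e x J) (zsub e x ({1..n} - J)) (Y x) (L x) = twist J x"
proof -
  have J': "finite J" "card J = k" "J \<subseteq> {1..n}"
    using J ksub_finite ksub_card ksub_subset by auto
  have c: "card ({1..n} - J) = n - k" using J' by (simp add: card_Diff_subset)
  have 1: "(\<Sum>i=1..k. f (zsub e x J i)) = (\<Sum>a\<in>J. f (x $ e a))" for f :: "complex \<Rightarrow> complex"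
    unfolding zsub_def using sum.reindex_bij_betw[OF elem_bij[OF J'(1)]] J'(2) by auto
  have 2: "(\<Sum>i=1..n-k. f (zsub e x ({1..n} - J) i)) = (\<Sum>a\<in>{1..n} - J. f (x $ e a))" for f :: "complex \<Rightarrow> complex"
    unfolding zsub_def using sum.reindex_bij_betw[OF elem_bij[of "{1..n} - J"], of "\<lambda>a. f (x $ e a)"] c by auto
  have "(\<Sum>i=1..k. zsub e x J i * C) = (\<Sum>a\<in>J. x $ e a * C)" for C
    using 1[of "\<lambda>t. t * C"] .
  moreover have "(\<Sum>i=1..k. \<Sum>j=1..n-k. (zsub e x J i - zsub e x ({1..n} - J) j) ^ 2) =
      (\<Sum>a\<in>J. \<Sum>b\<in>{1..n} - J. (x $ e a - x $ e b) ^ 2)"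
    unfolding 1[of "\<lambda>t. \<Sum>j=1..n-k. (t - zsub e x ({1..n} - J) j) ^ 2"]
    by (intro sum.cong refl 2[of "\<lambda>s. (_ - s) ^ 2"])
  ultimately show ?thesis
    unfolding twist_form_def twist_def by (simp add: sum_distrib_left)
qed

lemma integral_form_twist [int_linear_intros]: "integral_form (twist J)"
  unfolding twist_def[abs_def] by (intro int_linear_intros) (auto intro: Ints_of_nat)

definition psi_form :: "complex ^ 'm \<Rightarrow> complex" where
  "psi_form x = (\<Sum>j\<in>I. (L x - (of_int (wnum n j I) + 1) * Y x) ^ 2 + (L x - of_int (wnum n j I) * Y x) ^ 2)"

lemma integral_form_psi [int_linear_intros]: "integral_form psi_form"
  unfolding psi_form_def[abs_def] by (intro int_linear_intros) auto

lemma quasi_periodic_psi: "quasi_periodic psi_form (\<lambda>x. \<psi> x)"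
  unfolding psi_def psi_form_def[abs_def]
  by (intro quasi_periodic_prod quasi_periodic_mult quasi_periodic_theta int_linear_intros) auto

definition numerator :: "(nat \<Rightarrow> complex) \<Rightarrow> complex ^ 'm \<Rightarrow> complex" where
  "numerator t x = (\<Prod>r=1..k. (\<Prod>a\<in>{1..<elem I r}. theta \<tau> (t r - x $ e a + Y x)) *
        theta \<tau> (L x + t r - x $ e (elem I r) - of_int (wnum n (elem I r) I) * Y x) *
        (\<Prod>a\<in>{elem I r<..n}. theta \<tau> (t r - x $ e a)))"

definition vandermonde :: "(nat \<Rightarrow> complex) \<Rightarrow> complex" where
  "vandermonde t = (\<Prod>i=1..k. \<Prod>j=Suc i..k. theta \<tau> (t i - t j))"

definition pair_prod :: "(nat \<Rightarrow> complex) \<Rightarrow> complex \<Rightarrow> complex" where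
  "pair_prod t y = (\<Prod>i=1..k. \<Prod>j=Suc i..k. theta \<tau> (t j - t i + y))"

lemma weight_summand_eq:
  "weight_summand \<tau> n k I t (\<lambda>a. x $ e a) (Y x) (L x) = numerator t x / (vandermonde t * pair_prod t (Y x))"
  unfolding weight_summand_def numerator_def vandermonde_def pair_prod_def prod.distrib ..

text \<open>What is left of the exponent of a summand once the terms symmetric in \<open>t\<close>
  are split off. It depends on \<open>I\<close> only; together with \<open>- psi_form\<close> it
  will be the form \<open>N\<close> common to all components.\<close>

definition base_form :: "complex ^ 'm \<Rightarrow> complex" where
  "base_form x = (\<Sum>r=1..k. (\<Sum>a\<in>{1..<elem I r}. Y x ^ 2 - 2 * (Y x * x $ e a)) +
      (L x - of_int (wnum n (elem I r) I) * Y x) ^ 2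
      - 2 * (x $ e (elem I r) * (L x - of_int (wnum n (elem I r) I) * Y x)))
    - (\<Sum>i=1..k. \<Sum>j=Suc i..k. Y x ^ 2)"

lemma integral_form_base [int_linear_intros]: "integral_form base_form"
  unfolding base_form_def[abs_def] by (intro int_linear_intros) auto

definition weight_form :: "(nat \<Rightarrow> complex) \<Rightarrow> complex ^ 'm \<Rightarrow> complex" where
  "weight_form t x = (\<Sum>r=1..k. (\<Sum>a\<in>{1..<elem I r}. (t r - x $ e a + Y x) ^ 2) +
        (L x + t r - x $ e (elem I r) - of_int (wnum n (elem I r) I) * Y x) ^ 2 +
        (\<Sum>a\<in>{elem I r<..n}. (t r - x $ e a) ^ 2)) -
     ((\<Sum>i=1..k. \<Sum>j=Suc i..k. (t i - t j) ^ 2) + (\<Sum>i=1..k. \<Sum>j=Suc i..k. (t j - t i + Y x) ^ 2))"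

lemma quasi_periodic_summand:
  assumes "\<And>r. int_linear (\<lambda>x. t x r)"
  shows "quasi_periodic (\<lambda>x. weight_form (t x) x)
     (\<lambda>x. weight_summand \<tau> n k I (t x) (\<lambda>a. x $ e a) (Y x) (L x))"
  unfolding weight_summand_eq numerator_def vandermonde_def pair_prod_def weight_form_def
  by (intro quasi_periodic_divide quasi_periodic_prod quasi_periodic_mult quasi_periodic_theta
      int_linear_intros assms) auto

text \<open>The linear terms in \<open>t\<close> add up to a symmetric expression because
  \<open>w(i\<^sub>r, I) = 2 (k - r) - n + i\<^sub>r\<close>.\<close>

lemma weight_form_eq:
  "weight_form t x = base_form x + (\<Sum>r=1..k. 2 * (t r * (L x + of_nat (n - k) * Y x))) +
     (\<Sum>r=1..k. \<Sum>a=1..n. (t r - x $ e a) ^ 2) - (\<Sum>i=1..k. \<Sum>j=1..k. (t i - t j) ^ 2)"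
proof -
  define w where "w r = (of_int (wnum n (elem I r) I) :: complex)" for r
  have fin: "finite I" "card I = k" "I \<subseteq> {1..n}"
    using I ksub_finite ksub_card ksub_subset by auto
  have w: "w r = 2 * (of_nat k - of_nat r) - of_nat n + of_nat (elem I r)" if "r \<in> {1..k}" for r
    using wnum_elem[OF fin(3), of r] that fin(2) unfolding w_def by simp
  have el: "elem I r \<in> {1..n}" if "r \<in> {1..k}" for r
    using bij_betwE[OF elem_bij[OF fin(1)]] fin(2,3) that by blast
  \<comment> \<open>The coefficient of \<open>2 * t r * Y x\<close> is
    \<open>(i_r - 1) - w(i_r, I)\<close>: one contribution for each \<open>a < i_r\<close>, and one
    from the theta function containing \<open>\<lambda>\<close>. By the formula for \<open>w\<close>
    the number \<open>i_r\<close> cancels.\<close>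
  have row: "(\<Sum>a\<in>{1..<elem I r}. (t r - x $ e a + Y x) ^ 2) +
        (L x + t r - x $ e (elem I r) - w r * Y x) ^ 2 + (\<Sum>a\<in>{elem I r<..n}. (t r - x $ e a) ^ 2) =
      (\<Sum>a=1..n. (t r - x $ e a) ^ 2) + 2 * t r * (L x + (of_nat n - 1 - 2 * of_nat k + 2 * of_nat r) * Y x) +
      ((\<Sum>a\<in>{1..<elem I r}. Y x ^ 2 - 2 * (Y x * x $ e a)) + (L x - w r * Y x) ^ 2
        - 2 * (x $ e (elem I r) * (L x - w r * Y x)))"
    if r: "r \<in> {1..k}" for r
  proof -
    have "{1..n} = {1..<elem I r} \<union> {elem I r} \<union> {elem I r<..n}" using el[OF r] by auto
    hence "(\<Sum>a=1..n. (t r - x $ e a) ^ 2) = (\<Sum>a\<in>{1..<elem I r} \<union> {elem I r} \<union> {elem I r<..n}. (t r - x $ e a) ^ 2)"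
      by simp
    also have "\<dots> = (\<Sum>a\<in>{1..<elem I r}. (t r - x $ e a) ^ 2) + (t r - x $ e (elem I r)) ^ 2 +
        (\<Sum>a\<in>{elem I r<..n}. (t r - x $ e a) ^ 2)"
      by (subst sum.union_disjoint; (subst sum.union_disjoint)?) auto
    finally have 1: "(\<Sum>a=1..n. (t r - x $ e a) ^ 2) = \<dots>" .
    have "(\<Sum>a\<in>{1..<elem I r}. (t r - x $ e a + Y x) ^ 2) =
        (\<Sum>a\<in>{1..<elem I r}. (t r - x $ e a) ^ 2 + (Y x ^ 2 - 2 * (Y x * x $ e a)) + 2 * t r * Y x)"
      by (intro sum.cong) (auto simp: power2_eq_square algebra_simps)
    also have "\<dots> = (\<Sum>a\<in>{1..<elem I r}. (t r - x $ e a) ^ 2) +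
        (\<Sum>a\<in>{1..<elem I r}. Y x ^ 2 - 2 * (Y x * x $ e a)) + (of_nat (elem I r) - 1) * (2 * t r * Y x)"
      using el[OF r] by (simp add: sum.distrib of_nat_diff)
    finally have 2: "(\<Sum>a\<in>{1..<elem I r}. (t r - x $ e a + Y x) ^ 2) = \<dots>" .
    show ?thesis unfolding 1 2 w[OF r] by (simp add: power2_eq_square algebra_simps)
  qed
  \<comment> \<open>The shift by \<open>y\<close> in the denominator produces the linear term with
    coefficient \<open>2 r - k - 1\<close>. Subtracting it removes the dependence on
    \<open>r\<close> of the coefficients in \<open>row\<close> and leaves \<open>n - k\<close> for
    every \<open>r\<close>.\<close>
  have pairs: "(\<Sum>i=1..k. \<Sum>j=Suc i..k. (t i - t j) ^ 2) + (\<Sum>i=1..k. \<Sum>j=Suc i..k. (t j - t i + Y x) ^ 2) =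
     (\<Sum>i=1..k. \<Sum>j=1..k. (t i - t j) ^ 2) + 2 * Y x * (\<Sum>r=1..k. (2 * of_nat r - of_nat k - 1) * t r)
     + (\<Sum>i=1..k. \<Sum>j=Suc i..k. Y x ^ 2)"
  proof -
    have "(\<Sum>i=1..k. \<Sum>j=Suc i..k. (t i - t j) ^ 2) + (\<Sum>i=1..k. \<Sum>j=Suc i..k. (t j - t i + Y x) ^ 2) =
      (\<Sum>i=1..k. \<Sum>j=Suc i..k. 2 * (t i - t j) ^ 2 + 2 * Y x * (t j - t i) + Y x ^ 2)"
      unfolding sum.distrib[symmetric] by (intro sum.cong refl) (simp add: power2_eq_square algebra_simps)
    also have "\<dots> = (\<Sum>i=1..k. \<Sum>j=Suc i..k. 2 * (t i - t j) ^ 2) + 2 * Y x * (\<Sum>i=1..k. \<Sum>j=Suc i..k. t j - t i)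
       + (\<Sum>i=1..k. \<Sum>j=Suc i..k. Y x ^ 2)"
      unfolding sum_distrib_left sum.distrib[symmetric] ..
    finally show ?thesis
      unfolding sum_pairs_difference
      by (subst (asm) sum_pairs_symmetric) (simp_all add: power2_commute)
  qed
  have "weight_form t x = (\<Sum>r=1..k. (\<Sum>a=1..n. (t r - x $ e a) ^ 2) +
      2 * t r * (L x + (of_nat n - 1 - 2 * of_nat k + 2 * of_nat r) * Y x) +
      ((\<Sum>a\<in>{1..<elem I r}. Y x ^ 2 - 2 * (Y x * x $ e a)) + (L x - w r * Y x) ^ 2
        - 2 * (x $ e (elem I r) * (L x - w r * Y x)))) -
      ((\<Sum>i=1..k. \<Sum>j=1..k. (t i - t j) ^ 2) + 2 * Y x * (\<Sum>r=1..k. (2 * of_nat r - of_nat k - 1) * t r)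
     + (\<Sum>i=1..k. \<Sum>j=Suc i..k. Y x ^ 2))"
    unfolding weight_form_def pairs w_def[symmetric]
    by (intro arg_cong2[where f = "(-)"] refl sum.cong row)
  also have "\<dots> = base_form x + (\<Sum>r=1..k. 2 * t r * (L x + (of_nat n - 1 - 2 * of_nat k + 2 * of_nat r) * Y x)
        - 2 * Y x * ((2 * of_nat r - of_nat k - 1) * t r)) +
     (\<Sum>r=1..k. \<Sum>a=1..n. (t r - x $ e a) ^ 2) - (\<Sum>i=1..k. \<Sum>j=1..k. (t i - t j) ^ 2)"
    unfolding base_form_def w_def[symmetric] sum.distrib sum_subtractf sum_distrib_left by (simp add: algebra_simps)
  also have "(\<Sum>r=1..k. 2 * t r * (L x + (of_nat n - 1 - 2 * of_nat k + 2 * of_nat r) * Y x)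
        - 2 * Y x * ((2 * of_nat r - of_nat k - 1) * t r)) = (\<Sum>r=1..k. 2 * (t r * (L x + of_nat (n - k) * Y x)))"
    using kn by (intro sum.cong refl) (simp add: of_nat_diff algebra_simps)
  finally show ?thesis .
qed

text \<open>The exponent is symmetric in \<open>t\<close>, so all permutations give summands with
  the same multipliers. The squares with both indices in \<open>J\<close> cancel, and those between
  \<open>J\<close> and its complement remain as part of the twist.\<close>

lemma weight_form_component:
  assumes J: "J \<in> ksub n k" and \<sigma>: "\<sigma> permutes {1..k}"
  shows "weight_form (zsub e x J \<circ> \<sigma>) x = base_form x + twist J x"
proof -
  have re: "(\<Sum>r=1..k. f ((zsub e x J \<circ> \<sigma>) r)) = (\<Sum>a\<in>J. f (x $ e a))" for f :: "complex \<Rightarrow> complex"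
    unfolding zsub_def o_def using sum.reindex_bij_betw[OF elem_perm_bij[OF J \<sigma>], of "\<lambda>a. f (x $ e a)"] by simp
  define t where "t = zsub e x J \<circ> \<sigma>"
  have 1: "(\<Sum>a=1..n. f a) = (\<Sum>a\<in>{1..n} - J. f a) + (\<Sum>a\<in>J. f a)" for f :: "nat \<Rightarrow> complex"
    by (rule sum.subset_diff) (use ksub_subset[OF J] in auto)
  have 2: "(\<Sum>r=1..k. 2 * (t r * C)) = (\<Sum>a\<in>J. 2 * (x $ e a * C))" for C
    using re[of "\<lambda>u. 2 * (u * C)"] by (simp only: t_def)
  have 3: "(\<Sum>r=1..k. \<Sum>a=1..n. (t r - x $ e a) ^ 2) =
      (\<Sum>c\<in>J. (\<Sum>a\<in>{1..n} - J. (x $ e c - x $ e a) ^ 2) + (\<Sum>a\<in>J. (x $ e c - x $ e a) ^ 2))"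
    unfolding 1[symmetric] using re[of "\<lambda>u. \<Sum>a=1..n. (u - x $ e a) ^ 2"] by (simp only: t_def)
  have 4: "(\<Sum>i=1..k. \<Sum>j=1..k. (t i - t j) ^ 2) = (\<Sum>c\<in>J. \<Sum>a\<in>J. (x $ e c - x $ e a) ^ 2)"
    using re[of "\<lambda>u. \<Sum>j=1..k. (u - t j) ^ 2"] re[of "\<lambda>u. (_ - u) ^ 2"] by (simp only: t_def)
  show ?thesis
    unfolding t_def[symmetric] weight_form_eq 2 4 twist_def
    unfolding 3 by (simp add: sum.distrib)
qed

lemma quasi_periodic_pullback:
  assumes J: "J \<in> ksub n k"
  shows "quasi_periodic (\<lambda>x. base_form x + twist J x - psi_form x) (weight J)"
proof -
  have "quasi_periodic (\<lambda>x. base_form x + twist J x)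
      (\<lambda>x. weight_summand \<tau> n k I (zsub e x J \<circ> \<sigma>) (\<lambda>a. x $ e a) (Y x) (L x))"
    if \<sigma>: "\<sigma> \<in> {\<sigma>. \<sigma> permutes {1..k}}" for \<sigma>
    using quasi_periodic_summand[of "\<lambda>x. zsub e x J \<circ> \<sigma>"] weight_form_component[OF J] \<sigma>
    by (simp add: zsub_def int_linear_component)
  hence "quasi_periodic (\<lambda>x. base_form x + twist J x)
      (\<lambda>x. \<Sum>\<sigma> | \<sigma> permutes {1..k}. weight_summand \<tau> n k I (zsub e x J \<circ> \<sigma>) (\<lambda>a. x $ e a) (Y x) (L x))"
    by (rule quasi_periodic_sum)
  from quasi_periodic_divide[OF this quasi_periodic_psi]
  show ?thesis
    unfolding pullback_weight_def[abs_def] weight_fun_def by (simp add: divide_inverse mult.commute)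
qed

end

section \<open>Products over pairs of indices and their signs\<close>

lemma elem_image_greater:
  assumes K: "finite K" and r: "r \<in> {1..card K}"
  shows "bij_betw (elem K) {Suc r..card K} {l \<in> K. l > elem K r}"
proof -
  have inj: "inj_on (elem K) {Suc r..card K}"
    using elem_bij[OF K] r unfolding bij_betw_def by (auto elim!: inj_on_subset)
  moreover have "elem K ` {Suc r..card K} \<subseteq> {l \<in> K. l > elem K r}"
    using elem_less[OF K, of r] bij_betwE[OF elem_bij[OF K]] r by auto
  moreover have "card (elem K ` {Suc r..card K}) = card {l \<in> K. l > elem K r}"
    using card_greater_elem[OF K r] card_image[OF inj] by simp
  moreover have "finite {l \<in> K. l > elem K r}" using K by simp
  ultimately show ?thesis
    unfolding bij_betw_def using card_subset_eq by blast
qed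

lemma prod_pairs_elem:
  assumes K: "finite K"
  shows "(\<Prod>i=1..card K. \<Prod>j=Suc i..card K. f (elem K i) (elem K j)) = (\<Prod>a\<in>K. \<Prod>b\<in>{b \<in> K. b > a}. f a b)"
proof -
  have "(\<Prod>i=1..card K. \<Prod>j=Suc i..card K. f (elem K i) (elem K j)) =
      (\<Prod>i=1..card K. \<Prod>b\<in>{b \<in> K. b > elem K i}. f (elem K i) b)"
    by (intro prod.cong refl prod.reindex_bij_betw[OF elem_image_greater[OF K]])
  also have "\<dots> = (\<Prod>a\<in>K. \<Prod>b\<in>{b \<in> K. b > a}. f a b)"
    by (rule prod.reindex_bij_betw[OF elem_bij[OF K]])
  finally show ?thesis .
qed

lemma prod_pairs_swap:
  fixes K :: "nat set"
  assumes "finite K"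
  shows "(\<Prod>a\<in>K. \<Prod>b\<in>{b \<in> K. b > a}. f a b) = (\<Prod>b\<in>K. \<Prod>a\<in>{a \<in> K. a < b}. f a b)"
  using prod.swap_restrict[OF assms assms, of f "\<lambda>a b. b > a"] by simp

lemma prod_pairs_swap_nat:
  "(\<Prod>i=1..k. \<Prod>j=Suc i..k. f i j) = (\<Prod>j=1..k. \<Prod>i\<in>{1..<j}. f i j)"
proof -
  have "(\<Prod>i=1..k. \<Prod>j=Suc i..k. f i j) = (\<Prod>a\<in>{1..k}. \<Prod>b\<in>{b \<in> {1..k}. b > a}. f a b)"
    by (intro prod.cong) auto
  also have "\<dots> = (\<Prod>b\<in>{1..k}. \<Prod>a\<in>{a \<in> {1..k}. a < b}. f a b)"
    by (rule prod_pairs_swap) auto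
  also have "\<dots> = (\<Prod>j=1..k. \<Prod>i\<in>{1..<j}. f i j)"
    by (intro prod.cong) auto
  finally show ?thesis .
qed

text \<open>The transposition reverses exactly the pairs \<open>(p, q)\<close>,
  \<open>(p, i)\<close> and \<open>(i, q)\<close> with \<open>p < i < q\<close>, which is an odd
  number \<open>1 + 2 (q - p - 1)\<close> of sign changes.\<close>

lemma prod_pairs_transpose:
  fixes g :: "'b \<Rightarrow> 'b \<Rightarrow> 'a::comm_ring_1"
  assumes anti: "\<And>u v. g u v = - g v u" and pq: "p \<in> {1..k}" "q \<in> {1..k}" "p < q"
  shows "(\<Prod>i=1..k. \<Prod>j=Suc i..k. g (t (Transposition.transpose p q i)) (t (Transposition.transpose p q j))) =
     - (\<Prod>i=1..k. \<Prod>j=Suc i..k. g (t i) (t j))"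
proof -
  define P where "P = {(i, j). i \<in> {1..k} \<and> j \<in> {1..k} \<and> i < j}"
  define s where "s = Transposition.transpose p q"
  \<comment> \<open>Applies the transposition to both indices and sorts the result, an involution of
    the set of increasing pairs.\<close>
  define \<phi> where "\<phi> = (\<lambda>(i, j). (min (s i) (s j), max (s i) (s j)))"
  have s_in: "s i \<in> {1..k}" if "i \<in> {1..k}" for i
    using that pq by (auto simp: s_def Transposition.transpose_def)
  have ss: "s (s i) = i" for i by (simp add: s_def)
  have s_inj: "s i \<noteq> s j" if "i \<noteq> j" for i j using that ss by metis
  have P: "(\<Prod>i=1..k. \<Prod>j=Suc i..k. h i j) = (\<Prod>(i, j)\<in>P. h i j)" for h :: "nat \<Rightarrow> nat \<Rightarrow> 'a"
    unfolding P_def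
    by (subst prod.Sigma) (auto intro!: prod.cong)
  have P_fin: "finite P"
    by (rule finite_subset[of _ "{1..k} \<times> {1..k}"]) (auto simp: P_def)
  have \<phi>P: "\<phi> x \<in> P" if "x \<in> P" for x
    using that s_in s_inj by (auto simp: \<phi>_def P_def min_def max_def) (metis nat_less_le)+
  have \<phi>\<phi>: "\<phi> (\<phi> x) = x" if "x \<in> P" for x
    using that ss by (auto simp: \<phi>_def P_def min_def max_def)
  have \<phi>: "bij_betw \<phi> P P"
    by (rule bij_betw_byWitness[where f' = \<phi>]) (use \<phi>P \<phi>\<phi> in auto)
  have "(\<Prod>(i, j)\<in>P. g (t (s i)) (t (s j))) =
      (\<Prod>x\<in>P. (if s (fst x) < s (snd x) then 1 else - 1) * (case \<phi> x of (i, j) \<Rightarrow> g (t i) (t j)))"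
  proof (rule prod.cong[OF refl])
    fix x assume "x \<in> P"
    then obtain i j where x: "x = (i, j)" "i < j" by (auto simp: P_def)
    have "s i \<noteq> s j" using s_inj x by auto
    thus "(case x of (i, j) \<Rightarrow> g (t (s i)) (t (s j))) =
       (if s (fst x) < s (snd x) then 1 else - 1) * (case \<phi> x of (i, j) \<Rightarrow> g (t i) (t j))"
      using anti[of "t (s i)" "t (s j)"] by (auto simp: x \<phi>_def min_def max_def)
  qed
  also have "\<dots> = (\<Prod>x\<in>P. if s (fst x) < s (snd x) then 1 else - 1) * (\<Prod>(i, j)\<in>P. g (t i) (t j))"
    unfolding prod.distrib using prod.reindex_bij_betw[OF \<phi>, of "\<lambda>(i, j). g (t i) (t j)"] by simp
  also have "(\<Prod>x\<in>P. if s (fst x) < s (snd x) then 1 else - 1 :: 'a) = (- 1) ^ card (P \<inter> - {x. s (fst x) < s (snd x)})"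
    using P_fin by (simp add: prod.If_cases)
  also have "P \<inter> - {x. s (fst x) < s (snd x)} = insert (p, q) (Pair p ` {p<..<q} \<union> (\<lambda>i. (i, q)) ` {p<..<q})"
    using pq by (auto simp: P_def s_def Transposition.transpose_def split: if_splits)
  also have "card \<dots> = Suc (card (Pair p ` {p<..<q}) + card ((\<lambda>i. (i, q)) ` {p<..<q}))"
    by (subst card_insert_disjoint; (subst card_Un_disjoint)?) auto
  also have "\<dots> = Suc (2 * (q - p - 1))"
    by (simp add: card_image inj_on_def)
  finally show ?thesis unfolding P s_def by simp
qed

lemma prod_pairs_permutation:
  fixes g :: "'b \<Rightarrow> 'b \<Rightarrow> 'a::comm_ring_1"
  assumes anti: "\<And>u v. g u v = - g v u" and \<sigma>: "\<sigma> permutes {1..k}"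
  shows "(\<Prod>i=1..k. \<Prod>j=Suc i..k. g (t (\<sigma> i)) (t (\<sigma> j))) =
     of_int (sign \<sigma>) * (\<Prod>i=1..k. \<Prod>j=Suc i..k. g (t i) (t j))"
  using finite_atLeastAtMost[of 1 k] \<sigma>
proof (induction arbitrary: t rule: permutes_rev_induct)
  case id
  thus ?case by simp
next
  case (swap a b p)
  have tr: "(\<Prod>i=1..k. \<Prod>j=Suc i..k. g (u (Transposition.transpose a b i)) (u (Transposition.transpose a b j))) =
     - (\<Prod>i=1..k. \<Prod>j=Suc i..k. g (u i) (u j))" for u
    using prod_pairs_transpose[where g = g and p = a and q = b and t = u and k = k, OF anti]
      prod_pairs_transpose[where g = g and p = b and q = a and t = u and k = k, OF anti] swap.hyps
    by (cases a b rule: linorder_cases) (auto simp: Transposition.transpose_commute)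
  have "permutation p" using swap.hyps by (auto simp: permutation_permutes)
  hence "sign (p \<circ> Transposition.transpose a b) = - sign p"
    using swap.hyps by (simp add: sign_compose permutation_swap_id sign_swap_id)
  thus ?case
    using tr[of "\<lambda>i. t (p i)"] swap.IH[of t] by (simp add: o_def)
qed

section \<open>General position along transversal lines\<close>

context weight_setup
begin

text \<open>A direction that is real in the \<open>z\<close>-coordinates, with \<open>y\<close>-coordinate \<open>\<i>\<close> and
  \<open>\<lambda>\<close>-coordinate \<open>1\<close>, is transversal to the zero sets of all denominators.\<close>

definition transversal :: "(nat \<Rightarrow> complex) \<Rightarrow> complex ^ 'm" where
  "transversal f = (\<chi> i. let a = inv_into {1..n+2} e i in if a \<le> n then f a else if a = n + 1 then \<i> else 1)"

lemma transversal_simps: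
  "a \<in> {1..n} \<Longrightarrow> transversal f $ e a = f a" "Y (transversal f) = \<i>" "L (transversal f) = 1"
  using bij by (auto simp: transversal_def ycoord_def lcoord_def bij_betw_inv_into_left)

lemma e_eq_iff: "a \<in> {1..n+2} \<Longrightarrow> b \<in> {1..n+2} \<Longrightarrow> e a = e b \<longleftrightarrow> a = b"
  using bij unfolding bij_betw_def by (auto dest: inj_onD)

text \<open>One entire function whose nonvanishing excludes zero denominators in the summands of all
  permutations simultaneously. The middle product runs over all indices, so that it also controls
  the auxiliary products \<open>outer_prod\<close> and \<open>inner_prod\<close>.\<close>

definition regularity :: "nat set \<Rightarrow> complex ^ 'm \<Rightarrow> complex" where
  "regularity J x = (\<Prod>a\<in>J. \<Prod>b\<in>J - {a}. theta \<tau> (x $ e a - x $ e b)) *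
     (\<Prod>a=1..n. \<Prod>b=1..n. theta \<tau> (x $ e a - x $ e b + Y x)) * \<psi> x"

lemma regularity_nonzero_iff:
  assumes "J \<in> ksub n k"
  shows "regularity J x \<noteq> 0 \<longleftrightarrow> (\<forall>a\<in>J. \<forall>b\<in>J. a \<noteq> b \<longrightarrow> theta \<tau> (x $ e a - x $ e b) \<noteq> 0) \<and>
    (\<forall>a\<in>{1..n}. \<forall>b\<in>{1..n}. theta \<tau> (x $ e a - x $ e b + Y x) \<noteq> 0) \<and> \<psi> x \<noteq> 0"
  using ksub_finite[OF assms] by (auto simp: regularity_def)

lemma holo_psi [holo_intros]: "holo_on (\<lambda>x. \<psi> x) U"
  unfolding psi_def by (intro holo_intros)

lemma entire_regularity: "entire (regularity J)"
  unfolding regularity_def[abs_def] by (intro holo_intros)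

lemma eventually_psi_line:
  "eventually (\<lambda>\<zeta>. \<psi> (x + \<zeta> *s transversal f) \<noteq> 0) (at 0)"
proof -
  define v where "v = transversal f"
  have v: "Y v = \<i>" "L v = 1"
    by (simp_all add: v_def transversal_simps)
  have "eventually (\<lambda>\<zeta>. theta \<tau> (L (x + \<zeta> *s v) - c * Y (x + \<zeta> *s v)) \<noteq> 0) (at 0)" if c: "c \<in> \<int>" for c
  proof (rule eventually_theta_line_nonzero)
    show "int_linear (\<lambda>x. L x - c * Y x)" using c by (intro int_linear_intros)
    \<comment> \<open>The slope is \<open>1 - c * \<i>\<close>, whose real part is 1.\<close>
    show "L v - c * Y v \<noteq> 0" using c by (auto simp: v complex_eq_iff elim!: Ints_cases)
  qed
  hence "eventually (\<lambda>\<zeta>. \<forall>j\<in>I. theta \<tau> (L (x + \<zeta> *s v) - (of_int (wnum n j I) + 1) * Y (x + \<zeta> *s v)) \<noteq> 0 \<and>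
      theta \<tau> (L (x + \<zeta> *s v) - of_int (wnum n j I) * Y (x + \<zeta> *s v)) \<noteq> 0) (at 0)"
    using ksub_finite[OF I] by (intro eventually_ball_finite ballI eventually_conj) auto
  thus ?thesis
    unfolding v_def[symmetric] psi_def by eventually_elim (use ksub_finite[OF I] in auto)
qed

lemma eventually_y_line:
  fixes f x
  defines "p \<equiv> \<lambda>\<zeta>. x + \<zeta> *s transversal f"
  assumes f: "\<And>a. f a \<in> \<real>"
  shows "\<forall>\<^sub>F \<zeta> in at 0. \<forall>a\<in>{1..n}. \<forall>b\<in>{1..n}. theta \<tau> (p \<zeta> $ e a - p \<zeta> $ e b + Y (p \<zeta>)) \<noteq> 0"
proof -
  define v where "v = transversal f"
  have v: "Y v = \<i>" "\<And>a. a \<in> {1..n} \<Longrightarrow> v $ e a = f a"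
    by (simp_all add: v_def transversal_simps)
  have "eventually (\<lambda>\<zeta>. theta \<tau> ((x + \<zeta> *s v) $ e a - (x + \<zeta> *s v) $ e b + Y (x + \<zeta> *s v)) \<noteq> 0) (at 0)"
    if "a \<in> {1..n}" "b \<in> {1..n}" for a b
  proof (rule eventually_theta_line_nonzero[where l = "\<lambda>x. x $ e a - x $ e b + Y x"])
    show "v $ e a - v $ e b + Y v \<noteq> 0"
      using f[of a] f[of b] v(2)[OF that(1)] v(2)[OF that(2)] v(1)
      by (auto simp: complex_eq_iff elim!: Reals_cases)
  qed (intro int_linear_intros)
  thus ?thesis
    unfolding p_def v_def[symmetric] by (intro eventually_ball_finite ballI) auto
qed

text \<open>Distinct velocities on \<open>J\<close> separate the coordinates indexed by
  \<open>J\<close>; the components in \<open>y\<close> and \<open>\<lambda>\<close> take care of the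
  other factors. Injectivity on \<open>J\<close> alone leaves the freedom to keep a coordinate in
  \<open>J\<close> equal to one outside.\<close>

lemma eventually_regular_line:
  assumes J: "J \<in> ksub n k" and f: "inj_on f J" "\<And>a. f a \<in> \<real>"
  shows "eventually (\<lambda>\<zeta>. regularity J (x + \<zeta> *s transversal f) \<noteq> 0) (at 0)"
proof -
  define v where "v = transversal f"
  have v: "\<And>a. a \<in> {1..n} \<Longrightarrow> v $ e a = f a"
    by (simp add: v_def transversal_simps)
  have J': "finite J" "J \<subseteq> {1..n}" using J ksub_finite ksub_subset by auto
  have "eventually (\<lambda>\<zeta>. theta \<tau> ((x + \<zeta> *s v) $ e a - (x + \<zeta> *s v) $ e b) \<noteq> 0) (at 0)"
    if "a \<in> J" "b \<in> J" "a \<noteq> b" for a b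
  proof (rule eventually_theta_line_nonzero[where l = "\<lambda>x. x $ e a - x $ e b"])
    have "v $ e a = f a" "v $ e b = f b" using that J' v by blast+
    thus "v $ e a - v $ e b \<noteq> 0" using that f(1) by (auto dest: inj_onD)
  qed (intro int_linear_intros)
  hence "eventually (\<lambda>\<zeta>. \<forall>a\<in>J. \<forall>b\<in>J. a \<noteq> b \<longrightarrow> theta \<tau> ((x + \<zeta> *s v) $ e a - (x + \<zeta> *s v) $ e b) \<noteq> 0) (at 0)"
    using J' by (intro eventually_ball_finite ballI) auto
  moreover note eventually_y_line[of f x, OF f(2)] eventually_psi_line[of x f]
  ultimately show ?thesis
    unfolding regularity_nonzero_iff[OF J] v_def[symmetric] by eventually_elim blast
qed

lemma generic_regular:
  assumes J: "J \<in> ksub n k"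
  shows "eventually (\<lambda>x. regularity J x \<noteq> 0) generic"
proof -
  have "eventually (\<lambda>\<zeta>. regularity J (0 + \<zeta> *s transversal of_nat) \<noteq> 0) (at 0)"
    by (rule eventually_regular_line[OF J]) (auto simp: inj_on_def)
  then obtain p where "regularity J p \<noteq> 0"
    using eventually_happens'[OF trivial_limit_at] by blast
  thus ?thesis by (rule generic_nonzero[OF entire_regularity])
qed

lemma generic_psi_nonzero: "eventually (\<lambda>x. \<psi> x \<noteq> 0) generic"
  using generic_regular[OF I] by eventually_elim (simp add: regularity_nonzero_iff[OF I])

lemma regular_vandermonde_nonzero:
  assumes J: "J \<in> ksub n k" and \<sigma>: "\<sigma> permutes {1..k}" and x: "regularity J x \<noteq> 0"
  shows "vandermonde (zsub e x J \<circ> \<sigma>) \<noteq> 0" "pair_prod (zsub e x J \<circ> \<sigma>) (Y x) \<noteq> 0"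
proof -
  have b: "elem J (\<sigma> r) \<in> J" if "r \<in> {1..k}" for r
    using bij_betwE[OF elem_perm_bij[OF J \<sigma>]] that by blast
  have ne: "elem J (\<sigma> i) \<noteq> elem J (\<sigma> j)" if "i \<in> {1..k}" "j \<in> {1..k}" "i \<noteq> j" for i j
    using elem_perm_bij[OF J \<sigma>] that unfolding bij_betw_def by (auto dest: inj_onD)
  show "vandermonde (zsub e x J \<circ> \<sigma>) \<noteq> 0"
    using x b ne unfolding vandermonde_def zsub_def regularity_nonzero_iff[OF J] by auto
  have "elem J (\<sigma> r) \<in> {1..n}" if "r \<in> {1..k}" for r
    using b[OF that] ksub_subset[OF J] by blast
  thus "pair_prod (zsub e x J \<circ> \<sigma>) (Y x) \<noteq> 0"
    using x unfolding pair_prod_def zsub_def regularity_nonzero_iff[OF J] by auto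
qed

lemma vandermonde_permutation:
  "\<sigma> permutes {1..k} \<Longrightarrow> vandermonde (t \<circ> \<sigma>) = of_int (sign \<sigma>) * vandermonde t"
  unfolding vandermonde_def o_def
  by (rule prod_pairs_permutation[where g = "\<lambda>u v. theta \<tau> (u - v)"])
    (metis minus_diff_eq theta_minus)

lemma vandermonde_zsub:
  assumes "J \<in> ksub n k"
  shows "vandermonde (zsub e x J) = (\<Prod>a\<in>J. \<Prod>b\<in>{b \<in> J. b > a}. theta \<tau> (x $ e a - x $ e b))"
  unfolding vandermonde_def zsub_def
  using prod_pairs_elem[OF ksub_finite[OF assms], of "\<lambda>a b. theta \<tau> (x $ e a - x $ e b)"] ksub_card[OF assms] by simp

lemma pair_prod_zsub:
  assumes "J \<in> ksub n k"
  shows "pair_prod (zsub e x J) y = (\<Prod>a\<in>J. \<Prod>b\<in>{b \<in> J. b < a}. theta \<tau> (x $ e a - x $ e b + y))"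
  unfolding pair_prod_def zsub_def prod_pairs_swap[OF ksub_finite[OF assms], symmetric]
  using prod_pairs_elem[OF ksub_finite[OF assms], of "\<lambda>a b. theta \<tau> (x $ e b - x $ e a + y)"] ksub_card[OF assms] by simp

text \<open>One of the factors \<open>theta (t_r - z_a)\<close> with \<open>a > i_r\<close> has
  \<open>a = elem J (\<sigma> r)\<close> and is thus \<open>theta 0\<close>.\<close>

lemma numerator_eq_0:
  assumes J: "J \<in> ksub n k" and \<sigma>: "\<sigma> permutes {1..k}" and r: "r \<in> {1..k}" "elem I r < elem J (\<sigma> r)"
  shows "numerator (zsub e x J \<circ> \<sigma>) x = 0"
proof -
  have "elem J (\<sigma> r) \<in> {elem I r<..n}"
    using bij_betwE[OF elem_perm_bij[OF J \<sigma>]] ksub_subset[OF J] r by force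
  hence "(\<Prod>a\<in>{elem I r<..n}. theta \<tau> ((zsub e x J \<circ> \<sigma>) r - x $ e a)) = 0"
    by (subst prod_zero_iff) (auto simp: zsub_def intro!: bexI[of _ "elem J (\<sigma> r)"])
  thus ?thesis
    unfolding numerator_def using r(1)
    by (intro prod_zero finite_atLeastAtMost bexI[of _ r]) (simp_all only: mult_zero_right)
qed

end

section \<open>Cancellation of the denominators\<close>

lemma prod_pairs_full:
  "(\<Prod>i=1..k. \<Prod>j=Suc i..k. f j i) * (\<Prod>i=1..k. \<Prod>j=Suc i..k. f i j) =
     (\<Prod>i=1..k. \<Prod>j\<in>{1..k} - {i}. f i j)" for f :: "nat \<Rightarrow> nat \<Rightarrow> 'a::comm_monoid_mult"
proof -
  have "(\<Prod>j\<in>{1..<i}. f i j) * (\<Prod>j=Suc i..k. f i j) = (\<Prod>j\<in>{1..k} - {i}. f i j)" if "i \<in> {1..k}" for i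
  proof -
    have eq: "{1..k} - {i} = {1..<i} \<union> {Suc i..k}" using that by auto
    show ?thesis unfolding eq by (rule prod.union_disjoint[symmetric]) auto
  qed
  thus ?thesis
    unfolding prod_pairs_swap_nat[where f = "\<lambda>i j. f j i"] prod.distrib[symmetric] by (intro prod.cong) auto
qed

context weight_setup
begin

definition outer_prod :: "nat set \<Rightarrow> complex ^ 'm \<Rightarrow> complex" where
  "outer_prod J x = (\<Prod>a\<in>J. \<Prod>b\<in>{b \<in> {1..n} - J. b < a}. theta \<tau> (x $ e a - x $ e b + Y x))"

definition outer_form :: "nat set \<Rightarrow> complex ^ 'm \<Rightarrow> complex" where
  "outer_form J x = (\<Sum>a\<in>J. \<Sum>b\<in>{b \<in> {1..n} - J. b < a}. (x $ e a - x $ e b + Y x) ^ 2)"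

lemma holo_outer [holo_intros]: "holo_on (outer_prod J) U"
  unfolding outer_prod_def[abs_def] by (intro holo_intros)

lemma integral_form_outer [int_linear_intros]: "integral_form (outer_form J)"
  unfolding outer_form_def[abs_def] by (intro int_linear_intros)

lemma quasi_periodic_outer: "quasi_periodic (outer_form J) (outer_prod J)"
  unfolding outer_form_def[abs_def] outer_prod_def[abs_def]
  by (intro quasi_periodic_prod quasi_periodic_theta int_linear_intros)

text \<open>The product over ordered pairs in both directions. It is symmetric in the coordinates
  indexed by \<open>J\<close> and is a multiple of \<open>pair_prod\<close> for every
  permutation.\<close>

definition inner_prod :: "nat set \<Rightarrow> complex ^ 'm \<Rightarrow> complex" where
  "inner_prod J x = (\<Prod>a\<in>J. \<Prod>b\<in>J - {a}. theta \<tau> (x $ e a - x $ e b + Y x))"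

lemma holo_inner [holo_intros]: "holo_on (inner_prod J) U"
  unfolding inner_prod_def[abs_def] by (intro holo_intros)

lemma outer_inner_nonzero:
  assumes J: "J \<in> ksub n k" and "\<forall>a\<in>{1..n}. \<forall>b\<in>{1..n}. theta \<tau> (x $ e a - x $ e b + Y x) \<noteq> 0"
  shows "outer_prod J x \<noteq> 0" "inner_prod J x \<noteq> 0"
  using assms(2) ksub_subset[OF J] ksub_finite[OF J]
  unfolding outer_prod_def inner_prod_def by (auto simp: subset_iff)

lemma generic_outer_nonzero: "J \<in> ksub n k \<Longrightarrow> eventually (\<lambda>x. outer_prod J x \<noteq> 0) generic"
  using generic_regular[of J] outer_inner_nonzero[of J]
  by (auto elim!: eventually_mono simp: regularity_nonzero_iff)

text \<open>The numerator without the factors of \<open>pair_prod\<close> and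
  \<open>outer_prod\<close>. The removed indices in row \<open>r\<close> are
  \<open>elem J (\<sigma> s)\<close> for \<open>s < r\<close> and the elements outside
  \<open>J\<close> below \<open>elem J (\<sigma> r)\<close>. They are available only if no row
  exceeds \<open>elem I r\<close>; otherwise the numerator vanishes, whence the value 0.\<close>

definition cofactor :: "nat set \<Rightarrow> (nat \<Rightarrow> nat) \<Rightarrow> complex ^ 'm \<Rightarrow> complex" where
  "cofactor J \<sigma> x = (if \<exists>r\<in>{1..k}. elem I r < elem J (\<sigma> r) then 0 else
     (\<Prod>r=1..k. (\<Prod>a\<in>{1..<elem I r} - ((\<lambda>s. elem J (\<sigma> s)) ` {1..<r} \<union> {b \<in> {1..n} - J. b < elem J (\<sigma> r)}).
          theta \<tau> (x $ e (elem J (\<sigma> r)) - x $ e a + Y x)) *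
        theta \<tau> (L x + x $ e (elem J (\<sigma> r)) - x $ e (elem I r) - of_int (wnum n (elem I r) I) * Y x) *
        (\<Prod>a\<in>{elem I r<..n}. theta \<tau> (x $ e (elem J (\<sigma> r)) - x $ e a))))"

lemma holo_cofactor [holo_intros]: "holo_on (cofactor J \<sigma>) U"
  unfolding cofactor_def[abs_def]
  by (cases "\<exists>r\<in>{1..k}. elem I r < elem J (\<sigma> r)"; simp only: if_True if_False) (intro holo_intros)+

text \<open>Let \<open>a r = elem J (\<sigma> r) \<le> elem I r\<close> for all \<open>r\<close>.
  Then \<open>a s \<le> elem I s < elem I r\<close> for \<open>s < r\<close>, and every
  \<open>b < a r\<close> lies below \<open>elem I r\<close> too, so the factors to be extracted
  occur among those with index below \<open>elem I r\<close>. The two groups are disjoint as one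
  lies in \<open>J\<close> and the other outside.\<close>

lemma numerator_factor:
  assumes J: "J \<in> ksub n k" and \<sigma>: "\<sigma> permutes {1..k}"
  shows "numerator (zsub e x J \<circ> \<sigma>) x = pair_prod (zsub e x J \<circ> \<sigma>) (Y x) * outer_prod J x * cofactor J \<sigma> x"
proof (cases "\<exists>r\<in>{1..k}. elem I r < elem J (\<sigma> r)")
  case True
  thus ?thesis using numerator_eq_0[OF J \<sigma>] by (auto simp: cofactor_def)
next
  case False
  define a where "a r = elem J (\<sigma> r)" for r
  define T where "T c d = theta \<tau> (x $ e c - x $ e d + Y x)" for c d
  have le: "a r \<le> elem I r" if "r \<in> {1..k}" for r using False that by (force simp: a_def)
  have bij_a: "bij_betw a {1..k} J"
    using elem_perm_bij[OF J \<sigma>] unfolding a_def[abs_def] .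
  have aJ: "a r \<in> J" if "r \<in> {1..k}" for r using bij_betwE[OF bij_a] that by blast
  have el: "elem I s < elem I r" if "s \<in> {1..<r}" "r \<in> {1..k}" for r s
    using elem_less[OF ksub_finite[OF I], of s r] that ksub_card[OF I] by auto
  define S where "S r = {b \<in> {1..n} - J. b < a r}" for r
  have row: "(\<Prod>c\<in>{1..<elem I r}. T (a r) c) =
      (\<Prod>s\<in>{1..<r}. T (a r) (a s)) * (\<Prod>c\<in>S r. T (a r) c) * (\<Prod>c\<in>{1..<elem I r} - (a ` {1..<r} \<union> S r). T (a r) c)"
    if r: "r \<in> {1..k}" for r
  proof -
    have "a s \<in> {1..<elem I r}" if s: "s \<in> {1..<r}" for s
      using le[of s] el[OF s r] aJ[of s] ksub_subset[OF J] s r by force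
    moreover have "S r \<subseteq> {1..<elem I r}" using le[OF r] by (auto simp: S_def)
    ultimately have sub: "a ` {1..<r} \<union> S r \<subseteq> {1..<elem I r}" by blast
    have "a s \<in> J" if "s \<in> {1..<r}" for s using aJ that r by auto
    hence disj: "a ` {1..<r} \<inter> S r = {}" by (auto simp: S_def)
    have inj: "inj_on a {1..<r}"
      using bij_a r unfolding bij_betw_def by (auto elim!: inj_on_subset)
    have "(\<Prod>c\<in>{1..<elem I r}. T (a r) c) =
       (\<Prod>c\<in>{1..<elem I r} - (a ` {1..<r} \<union> S r). T (a r) c) * (\<Prod>c\<in>a ` {1..<r} \<union> S r. T (a r) c)"
      by (rule prod.subset_diff[OF sub]) simp
    also have "(\<Prod>c\<in>a ` {1..<r} \<union> S r. T (a r) c) = (\<Prod>c\<in>a ` {1..<r}. T (a r) c) * (\<Prod>c\<in>S r. T (a r) c)"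
      by (rule prod.union_disjoint) (use disj in \<open>auto simp: S_def\<close>)
    also have "(\<Prod>c\<in>a ` {1..<r}. T (a r) c) = (\<Prod>s\<in>{1..<r}. T (a r) (a s))"
      using prod.reindex[OF inj, of "T (a r)"] by (simp only: o_def)
    finally show ?thesis by (simp only: mult_ac)
  qed
  have z: "(zsub e x J \<circ> \<sigma>) r = x $ e (a r)" for r by (simp add: zsub_def a_def)
  have 1: "pair_prod (zsub e x J \<circ> \<sigma>) (Y x) = (\<Prod>r=1..k. \<Prod>s\<in>{1..<r}. T (a r) (a s))"
    unfolding pair_prod_def z prod_pairs_swap_nat T_def ..
  have 2: "outer_prod J x = (\<Prod>r=1..k. \<Prod>c\<in>S r. T (a r) c)"
    unfolding outer_prod_def S_def T_def
    using prod.reindex_bij_betw[OF bij_a, of "\<lambda>c. \<Prod>b\<in>{b \<in> {1..n} - J. b < c}. theta \<tau> (x $ e c - x $ e b + Y x)"] by simp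
  have 3: "cofactor J \<sigma> x = (\<Prod>r=1..k. (\<Prod>c\<in>{1..<elem I r} - (a ` {1..<r} \<union> S r). T (a r) c) *
        theta \<tau> (L x + x $ e (a r) - x $ e (elem I r) - of_int (wnum n (elem I r) I) * Y x) *
        (\<Prod>c\<in>{elem I r<..n}. theta \<tau> (x $ e (a r) - x $ e c)))"
    using False unfolding cofactor_def a_def S_def T_def by (simp only: if_False)
  have "numerator (zsub e x J \<circ> \<sigma>) x = (\<Prod>r=1..k. (\<Prod>c\<in>{1..<elem I r}. T (a r) c) *
        theta \<tau> (L x + x $ e (a r) - x $ e (elem I r) - of_int (wnum n (elem I r) I) * Y x) *
        (\<Prod>c\<in>{elem I r<..n}. theta \<tau> (x $ e (a r) - x $ e c)))"
    unfolding numerator_def z T_def ..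
  also have "\<dots> = (\<Prod>r=1..k. (\<Prod>s\<in>{1..<r}. T (a r) (a s)) * (\<Prod>c\<in>S r. T (a r) c) *
        ((\<Prod>c\<in>{1..<elem I r} - (a ` {1..<r} \<union> S r). T (a r) c) *
        theta \<tau> (L x + x $ e (a r) - x $ e (elem I r) - of_int (wnum n (elem I r) I) * Y x) *
        (\<Prod>c\<in>{elem I r<..n}. theta \<tau> (x $ e (a r) - x $ e c))))"
    by (rule prod.cong[OF refl]) (simp only: row mult_ac)
  also have "\<dots> = pair_prod (zsub e x J \<circ> \<sigma>) (Y x) * outer_prod J x * cofactor J \<sigma> x"
    unfolding 1 2 3 prod.distrib[symmetric] ..
  finally show ?thesis .
qed

text \<open>The numerator over the common denominator \<open>vandermonde (zsub e x J)\<close>; the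
  signs come from permuting the variables of the Vandermonde product.\<close>

definition antisymmetrized :: "nat set \<Rightarrow> complex ^ 'm \<Rightarrow> complex" where
  "antisymmetrized J x = (\<Sum>\<sigma> | \<sigma> permutes {1..k}. of_int (sign \<sigma>) * cofactor J \<sigma> x)"

lemma holo_antisymmetrized [holo_intros]: "holo_on (antisymmetrized J) U"
  unfolding antisymmetrized_def[abs_def] by (intro holo_intros)

lemma pullback_weight_regular:
  assumes J: "J \<in> ksub n k" and x: "regularity J x \<noteq> 0"
  shows "weight J x =
     outer_prod J x * antisymmetrized J x / (\<psi> x * vandermonde (zsub e x J))"
proof -
  have "weight_summand \<tau> n k I (zsub e x J \<circ> \<sigma>) (\<lambda>a. x $ e a) (Y x) (L x) =
      outer_prod J x / vandermonde (zsub e x J) * (of_int (sign \<sigma>) * cofactor J \<sigma> x)"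
    if \<sigma>: "\<sigma> \<in> {\<sigma>. \<sigma> permutes {1..k}}" for \<sigma>
  proof -
    have \<sigma>': "\<sigma> permutes {1..k}" using \<sigma> by simp
    have s: "of_int (sign \<sigma>) * of_int (sign \<sigma>) = (1 :: complex)"
      by (simp flip: of_int_mult)
    have "weight_summand \<tau> n k I (zsub e x J \<circ> \<sigma>) (\<lambda>a. x $ e a) (Y x) (L x) =
        outer_prod J x * cofactor J \<sigma> x / (of_int (sign \<sigma>) * vandermonde (zsub e x J))"
      using regular_vandermonde_nonzero[OF J \<sigma>' x]
      unfolding weight_summand_eq numerator_factor[OF J \<sigma>'] vandermonde_permutation[OF \<sigma>'] by simp
    also have "1 / of_int (sign \<sigma>) = (of_int (sign \<sigma>) :: complex)"
      using s by (metis divide_eq_eq mult_zero_left zero_neq_one)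
    hence "outer_prod J x * cofactor J \<sigma> x / (of_int (sign \<sigma>) * vandermonde (zsub e x J)) =
        outer_prod J x * cofactor J \<sigma> x * of_int (sign \<sigma>) / vandermonde (zsub e x J)"
      by (metis divide_divide_eq_left' mult.commute times_divide_eq_right mult.right_neutral divide_divide_eq_left)
    finally show ?thesis by (simp add: mult_ac)
  qed
  thus ?thesis
    unfolding pullback_weight_def weight_fun_def antisymmetrized_def sum_distrib_left
    by (simp add: sum_distrib_left sum_divide_distrib mult_ac)
qed

lemma inner_prod_eq:
  assumes J: "J \<in> ksub n k" and \<sigma>: "\<sigma> permutes {1..k}"
  shows "pair_prod (zsub e x J \<circ> \<sigma>) (Y x) *
     (\<Prod>i=1..k. \<Prod>j=Suc i..k. theta \<tau> ((zsub e x J \<circ> \<sigma>) i - (zsub e x J \<circ> \<sigma>) j + Y x)) = inner_prod J x"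
proof -
  define a where "a r = elem J (\<sigma> r)" for r
  have bij_a: "bij_betw a {1..k} J"
    using elem_perm_bij[OF J \<sigma>] unfolding a_def[abs_def] .
  have z: "(zsub e x J \<circ> \<sigma>) r = x $ e (a r)" for r by (simp add: zsub_def a_def)
  have "pair_prod (zsub e x J \<circ> \<sigma>) (Y x) *
     (\<Prod>i=1..k. \<Prod>j=Suc i..k. theta \<tau> ((zsub e x J \<circ> \<sigma>) i - (zsub e x J \<circ> \<sigma>) j + Y x)) =
     (\<Prod>i=1..k. \<Prod>j\<in>{1..k} - {i}. theta \<tau> (x $ e (a i) - x $ e (a j) + Y x))"
    unfolding pair_prod_def z prod_pairs_full ..
  also have "\<dots> = (\<Prod>i=1..k. \<Prod>b\<in>J - {a i}. theta \<tau> (x $ e (a i) - x $ e b + Y x))"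
  proof (rule prod.cong[OF refl], rule prod.reindex_bij_betw)
    fix i assume "i \<in> {1..k}"
    thus "bij_betw a ({1..k} - {i}) (J - {a i})"
      using bij_a by (intro bij_betw_DiffI) (auto simp: bij_betw_def)
  qed
  also have "\<dots> = inner_prod J x"
    unfolding inner_prod_def by (rule prod.reindex_bij_betw[OF bij_a])
  finally show ?thesis .
qed

text \<open>A cofactor depends on \<open>\<sigma>\<close> through its index sets, so its symmetry is
  not visible. Multiplied by \<open>outer_prod\<close> and \<open>inner_prod\<close> it becomes
  \<open>B \<sigma>\<close>, which depends only on \<open>t \<circ> \<sigma>\<close>. If the
  transposition \<open>s\<close> fixes \<open>t\<close>, then replacing \<open>\<sigma>\<close> by
  \<open>s \<circ> \<sigma>\<close> keeps \<open>B\<close> and changes the sign, so the sum equals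
  its negative.\<close>

lemma antisymmetrized_diagonal_aux:
  assumes J: "J \<in> ksub n k" and ab: "a \<in> J" "b \<in> J" "a \<noteq> b" and x: "x $ e a = x $ e b"
  shows "antisymmetrized J x * (outer_prod J x * inner_prod J x) = 0"
proof -
  obtain p q where pq: "p \<in> {1..k}" "q \<in> {1..k}" "a = elem J p" "b = elem J q"
    using elem_bij[OF ksub_finite[OF J]] ab unfolding bij_betw_def ksub_card[OF J] by blast
  have "p \<noteq> q" using ab pq by auto
  define s where "s = Transposition.transpose p q"
  have s: "s permutes {1..k}" unfolding s_def using pq by (intro permutes_swap_id)
  define t where "t = zsub e x J"
  have ts: "t \<circ> s = t"
    using x pq by (auto simp: t_def s_def zsub_def Transposition.transpose_def fun_eq_iff)
  define S where "S = antisymmetrized J x * (outer_prod J x * inner_prod J x)"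
  define B where "B \<sigma> = numerator (t \<circ> \<sigma>) x * (\<Prod>i=1..k. \<Prod>j=Suc i..k. theta \<tau> ((t \<circ> \<sigma>) i - (t \<circ> \<sigma>) j + Y x))" for \<sigma>
  have "of_int (sign \<sigma>) * cofactor J \<sigma> x * (outer_prod J x * inner_prod J x) = of_int (sign \<sigma>) * B \<sigma>"
    if "\<sigma> permutes {1..k}" for \<sigma>
    unfolding B_def t_def numerator_factor[OF J that] inner_prod_eq[OF J that, symmetric] by (simp only: mult_ac)
  hence 1: "antisymmetrized J x * (outer_prod J x * inner_prod J x) = (\<Sum>\<sigma> | \<sigma> permutes {1..k}. of_int (sign \<sigma>) * B \<sigma>)"
    unfolding antisymmetrized_def sum_distrib_right by (intro sum.cong) auto
  also have "\<dots> = (\<Sum>\<sigma> | \<sigma> permutes {1..k}. of_int (sign (s \<circ> \<sigma>)) * B (s \<circ> \<sigma>))"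
    by (rule setum_permutations_compose_left[OF s])
  also have "\<dots> = (\<Sum>\<sigma> | \<sigma> permutes {1..k}. - (of_int (sign \<sigma>) * B \<sigma>))"
  proof (rule sum.cong[OF refl])
    fix \<sigma> assume "\<sigma> \<in> {\<sigma>. \<sigma> permutes {1..k}}"
    hence "permutation \<sigma>" unfolding permutation_permutes using finite_atLeastAtMost by blast
    hence "sign (s \<circ> \<sigma>) = - sign \<sigma>"
      using \<open>p \<noteq> q\<close> unfolding s_def by (simp add: sign_compose permutation_swap_id sign_swap_id)
    moreover have "B (s \<circ> \<sigma>) = B \<sigma>"
      unfolding B_def o_assoc ts ..
    ultimately show "of_int (sign (s \<circ> \<sigma>)) * B (s \<circ> \<sigma>) = - (of_int (sign \<sigma>) * B \<sigma>)" by simp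
  qed
  also have "\<dots> = - (antisymmetrized J x * (outer_prod J x * inner_prod J x))"
    unfolding sum_negf 1 ..
  finally have neg: "S = - S" unfolding S_def .
  have "S + S = S + - S" by (rule arg_cong[OF neg])
  hence "2 * S = 0" by (simp only: mult_2 add.right_inverse)
  thus ?thesis unfolding S_def by (simp only: mult_eq_0_iff) simp
qed

lemma antisymmetrized_diagonal:
  assumes J: "J \<in> ksub n k" and ab: "a \<in> J" "b \<in> J" "a \<noteq> b" and x: "x $ e a = x $ e b"
  shows "antisymmetrized J x = 0"
proof -
  \<comment> \<open>The auxiliary product may vanish at \<open>x\<close>. A direction with zero
    \<open>z\<close>-part leaves its zero set while preserving
    \<open>x $ e a = x $ e b\<close>.\<close>
  define v where "v = transversal (\<lambda>_. 0)"
  have "eventually (\<lambda>\<zeta>. outer_prod J (x + \<zeta> *s v) * inner_prod J (x + \<zeta> *s v) \<noteq> 0) (at 0)"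
    using eventually_y_line[of "\<lambda>_. 0" x] outer_inner_nonzero[OF J]
    unfolding v_def by (auto elim!: eventually_mono)
  then obtain c where c: "outer_prod J (x + c *s v) * inner_prod J (x + c *s v) \<noteq> 0"
    using eventually_happens'[OF trivial_limit_at] by blast
  have "a \<in> {1..n}" "b \<in> {1..n}" using ab ksub_subset[OF J] by auto
  hence "(x + \<zeta> *s v) $ e a = (x + \<zeta> *s v) $ e b" for \<zeta>
    using x by (simp add: v_def transversal_simps)
  hence "antisymmetrized J (x + \<zeta> *s v) * (outer_prod J (x + \<zeta> *s v) * inner_prod J (x + \<zeta> *s v)) = 0" for \<zeta>
    by (rule antisymmetrized_diagonal_aux[OF J ab])
  thus ?thesis
    using c by (rule line_cancel[where h = "\<lambda>x. outer_prod J x * inner_prod J x", rotated 2]) (intro holo_intros)+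
qed

end

lemma (in elliptic) quasi_periodic_zero_lattice:
  fixes f :: "complex ^ 'm::finite \<Rightarrow> complex"
  assumes f: "quasi_periodic Q f" and ij: "i \<noteq> j"
    and zero: "\<And>x. x $ i = x $ j \<Longrightarrow> f x = 0" and x: "x $ i - x $ j \<in> lattice"
  shows "f x = 0"
proof -
  define y where "y = x - axis i (x $ i - x $ j)"
  have "y $ i = y $ j" using ij by (simp add: y_def axis_def)
  hence "f (y + axis i (x $ i - x $ j)) = 0"
    using quasi_periodic_zero_shift[OF f zero x] by blast
  thus ?thesis by (simp add: y_def)
qed

context weight_setup
begin

lemma holo_vandermonde [holo_intros]: "holo_on (\<lambda>x. vandermonde (zsub e x J \<circ> \<sigma>)) U"
  unfolding vandermonde_def zsub_def o_def by (intro holo_intros)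

lemma holo_pullback_weight:
  assumes J: "J \<in> ksub n k"
  shows "holo_on (weight J) {x. regularity J x \<noteq> 0}"
proof -
  have "holo_on (\<lambda>x. 1 / \<psi> x * (\<Sum>\<sigma> | \<sigma> permutes {1..k}.
       numerator (zsub e x J \<circ> \<sigma>) x / (vandermonde (zsub e x J \<circ> \<sigma>) * pair_prod (zsub e x J \<circ> \<sigma>) (Y x))))
      {x. regularity J x \<noteq> 0}"
    using regular_vandermonde_nonzero[OF J]
    by (intro holo_on_mult holo_on_divide holo_on_sum holo_vandermonde holo_psi holo_on_const;
        (simp add: regularity_nonzero_iff[OF J])?;
        (unfold numerator_def pair_prod_def zsub_def o_def)?; intro holo_intros)
  thus ?thesis
    unfolding pullback_weight_def[abs_def] weight_fun_def weight_summand_eq .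
qed

lemma open_regular: "open {x. regularity J x \<noteq> 0}"
  using open_Collect_neq[OF holo_on_imp_continuous_on[OF entire_regularity] continuous_on_const] by simp

definition vandermonde_form :: "nat set \<Rightarrow> complex ^ 'm \<Rightarrow> complex" where
  "vandermonde_form J x = (\<Sum>i=1..k. \<Sum>j=Suc i..k. (zsub e x J i - zsub e x J j) ^ 2)"

lemma integral_form_vandermonde [int_linear_intros]: "integral_form (vandermonde_form J)"
  unfolding vandermonde_form_def[abs_def] zsub_def by (intro int_linear_intros)

lemma quasi_periodic_vandermonde: "quasi_periodic (vandermonde_form J) (\<lambda>x. vandermonde (zsub e x J))"
  unfolding vandermonde_form_def[abs_def] vandermonde_def zsub_def
  by (intro quasi_periodic_prod quasi_periodic_theta int_linear_intros)

text \<open>The form itself is irrelevant: some quasi-periodicity is enough to carry the vanishing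
  from the diagonals to their lattice translates. It is obtained by dividing the weight by its
  explicit prefactor.\<close>

lemma quasi_periodic_antisymmetrized:
  assumes J: "J \<in> ksub n k"
  obtains Q where "quasi_periodic Q (antisymmetrized J)"
proof -
  have "quasi_periodic (\<lambda>x. (base_form x + twist J x - psi_form x) - (outer_form J x - (psi_form x + vandermonde_form J x)))
      (antisymmetrized J)"
  proof (rule quasi_periodic_factor[where f = "weight J"
        and A = "\<lambda>x. outer_prod J x / (\<psi> x * vandermonde (zsub e x J))"])
    show "\<forall>\<^sub>F x in generic. weight J x =
        outer_prod J x / (\<psi> x * vandermonde (zsub e x J)) * antisymmetrized J x"
      using generic_regular[OF J] by eventually_elim (simp add: pullback_weight_regular[OF J])
    show "\<forall>\<^sub>F x in generic. outer_prod J x / (\<psi> x * vandermonde (zsub e x J)) \<noteq> 0"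
      using generic_regular[OF J]
    proof eventually_elim
      case (elim x)
      thus ?case
        using regular_vandermonde_nonzero(1)[OF J permutes_id elim] outer_inner_nonzero(1)[OF J, of x]
        by (simp add: regularity_nonzero_iff[OF J])
    qed
  qed (intro quasi_periodic_imp_weakly quasi_periodic_pullback J quasi_periodic_divide quasi_periodic_mult
      quasi_periodic_outer quasi_periodic_psi quasi_periodic_vandermonde holo_intros
      holo_on_integral_form int_linear_intros)+
  thus ?thesis using that by blast
qed

text \<open>The quotient \<open>G\<close> is the holomorphic factor of property (3).\<close>

lemma antisymmetrized_division:
  assumes J: "J \<in> ksub n k"
  obtains G where "entire G" "\<And>x. antisymmetrized J x = vandermonde (zsub e x J) * G x"
proof -
  obtain Q where Q: "quasi_periodic Q (antisymmetrized J)" using quasi_periodic_antisymmetrized[OF J] .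
  define P where "P = Sigma J (\<lambda>a. {b \<in> J. b > a})"
  define S where "S = (\<lambda>(a, b). (e a, e b)) ` P"
  have J': "J \<subseteq> {1..n+2}" using ksub_subset[OF J] by auto
  have ee: "e a = e b \<longleftrightarrow> a = b" if "a \<in> J" "b \<in> J" for a b
    using e_eq_iff[of a b] that J' by blast
  have fin: "finite P" using ksub_finite[OF J] by (simp add: P_def)
  obtain G where G: "entire G" "\<And>x. antisymmetrized J x = (\<Prod>(i, j)\<in>S. theta \<tau> (x $ i - x $ j)) * G x"
  proof (rule theta_prod_division[of S "antisymmetrized J"])
    show "finite S" using fin by (simp add: S_def)
    show "i \<noteq> j \<and> (j, i) \<notin> S" if "(i, j) \<in> S" for i j
      using that ee by (auto simp: S_def P_def)
    show "entire (antisymmetrized J)" by (intro holo_intros)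
    show "antisymmetrized J x = 0" if ij: "(i, j) \<in> S" and x: "x $ i - x $ j \<in> lattice" for i j x
    proof -
      obtain a b where ab: "i = e a" "j = e b" "a \<in> J" "b \<in> J" "a < b"
        using ij by (auto simp: S_def P_def)
      show ?thesis
      proof (rule quasi_periodic_zero_lattice[OF Q _ _ x])
        show "i \<noteq> j" using ab ee by auto
        show "antisymmetrized J y = 0" if "y $ i = y $ j" for y
          using antisymmetrized_diagonal[OF J ab(3,4)] ab that by auto
      qed
    qed
  qed blast
  have "inj_on (\<lambda>(a, b). (e a, e b)) P"
    using ee by (auto simp: inj_on_def P_def)
  hence "(\<Prod>(i, j)\<in>S. theta \<tau> (x $ i - x $ j)) = (\<Prod>(a, b)\<in>P. theta \<tau> (x $ e a - x $ e b))" for x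
    unfolding S_def by (subst prod.reindex) (auto simp: case_prod_beta intro!: prod.cong)
  also have "\<dots> x = vandermonde (zsub e x J)" for x
    unfolding vandermonde_zsub[OF J] P_def using ksub_finite[OF J] by (subst prod.Sigma) auto
  finally show ?thesis using that G by simp
qed

lemma restriction_form_pullback: "restriction_form \<tau> n k e I (weight)"
  unfolding restriction_form_def
proof
  fix J assume J: "J \<in> ksub n k"
  obtain G where G: "entire G" "\<And>x. antisymmetrized J x = vandermonde (zsub e x J) * G x"
    by (rule antisymmetrized_division[OF J]) blast
  have "\<forall>\<^sub>F x in generic. weight J x = 1 / \<psi> x * outer_prod J x * G x"
    using generic_regular[OF J]
  proof eventually_elim
    case (elim x)
    thus ?case
      using regular_vandermonde_nonzero(1)[OF J permutes_id elim]
      by (simp add: pullback_weight_regular[OF J] G(2))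
  qed
  thus "\<exists>F. entire F \<and> mero_eq (weight J) (\<lambda>x. 1 / \<psi> x *
          (\<Prod>a\<in>J. \<Prod>b\<in>{b \<in> {1..n} - J. b < a}. theta \<tau> (x $ e a - x $ e b + Y x)) * F x)"
    using G(1) unfolding mero_eq_iff_generic outer_prod_def by blast
qed

text \<open>A permutation other than the identity satisfies \<open>\<sigma> r > r\<close> for some
  \<open>r\<close>, and its numerator vanishes. For the identity, the factors with both indices in
  \<open>I\<close> reproduce the denominators, those leaving \<open>I\<close> give the claimed
  product with \<open>eps\<close> recording the order of the indices, and the factors with
  \<open>\<lambda>\<close> cancel one half of \<open>\<psi>\<close>.\<close>

lemma diagonal_restriction_pullback: "diagonal_restriction \<tau> n e I (weight)"
  unfolding diagonal_restriction_def mero_eq_iff_generic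
  using generic_regular[OF I]
proof eventually_elim
  case (elim x)
  have I': "finite I" "card I = k" "I \<subseteq> {1..n}"
    using I ksub_finite ksub_card ksub_subset by auto
  define t where "t = zsub e x I"
  define w where "w a = (of_int (wnum n a I) :: complex)" for a
  have fin: "finite {\<sigma>. \<sigma> permutes {1..k}}" by (simp add: finite_permutations)
  have zero: "numerator (t \<circ> \<sigma>) x = 0" if \<sigma>: "\<sigma> permutes {1..k}" "\<sigma> \<noteq> id" for \<sigma>
  proof -
    obtain r where r: "r \<in> {1..k}" "\<sigma> r > r"
      using permutes_natset_le[OF \<sigma>(1)] \<sigma>(2) by force
    hence "elem I r < elem I (\<sigma> r)"
      using elem_less[OF I'(1), of r "\<sigma> r"] permutes_in_image[OF \<sigma>(1), of r] I'(2) by auto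
    thus ?thesis using numerator_eq_0[OF I \<sigma>(1) r(1)] by (simp add: t_def)
  qed
  have "(\<Sum>\<sigma> | \<sigma> permutes {1..k}. weight_summand \<tau> n k I (t \<circ> \<sigma>) (\<lambda>a. x $ e a) (Y x) (L x)) =
      (\<Sum>\<sigma>\<in>{id}. weight_summand \<tau> n k I (t \<circ> \<sigma>) (\<lambda>a. x $ e a) (Y x) (L x))"
    by (rule sum.mono_neutral_right[OF fin]) (use zero in \<open>auto simp: weight_summand_eq permutes_id\<close>)
  hence 1: "weight I x =
      1 / \<psi> x * (numerator t x / (vandermonde t * pair_prod t (Y x)))"
    unfolding pullback_weight_def weight_fun_def t_def[symmetric] weight_summand_eq by simp
  define up where "up a = (\<Prod>b\<in>{b \<in> I. b > a}. theta \<tau> (x $ e a - x $ e b))" for a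
  define dn where "dn a = (\<Prod>b\<in>{b \<in> I. b < a}. theta \<tau> (x $ e a - x $ e b + Y x))" for a
  define out where "out a = (\<Prod>b\<in>{1..n} - I. theta \<tau> (x $ e a - x $ e b + eps a b * Y x))" for a
  have row: "(\<Prod>b\<in>{1..<a}. theta \<tau> (x $ e a - x $ e b + Y x)) * (\<Prod>b\<in>{a<..n}. theta \<tau> (x $ e a - x $ e b)) =
      dn a * up a * out a" if a: "a \<in> I" for a
  proof -
    have "{1..<a} = {b \<in> I. b < a} \<union> {b \<in> {1..n} - I. b < a}" using a I'(3) by auto
    hence d: "(\<Prod>b\<in>{1..<a}. theta \<tau> (x $ e a - x $ e b + Y x)) =
        dn a * (\<Prod>b\<in>{b \<in> {1..n} - I. b < a}. theta \<tau> (x $ e a - x $ e b + Y x))"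
      unfolding dn_def using I'(1) by (simp only:) (rule prod.union_disjoint; auto)
    have "{a<..n} = {b \<in> I. b > a} \<union> {b \<in> {1..n} - I. b > a}" using a I'(3) by auto
    hence u: "(\<Prod>b\<in>{a<..n}. theta \<tau> (x $ e a - x $ e b)) =
        up a * (\<Prod>b\<in>{b \<in> {1..n} - I. b > a}. theta \<tau> (x $ e a - x $ e b))"
      unfolding up_def using I'(1) by (simp only:) (rule prod.union_disjoint; auto)
    have "b < a \<or> b > a" if "b \<notin> I" for b
      using that a by (cases b a rule: linorder_cases) auto
    hence "{1..n} - I = {b \<in> {1..n} - I. b < a} \<union> {b \<in> {1..n} - I. b > a}" by blast
    hence "out a = (\<Prod>b\<in>{b \<in> {1..n} - I. b < a} \<union> {b \<in> {1..n} - I. b > a}. theta \<tau> (x $ e a - x $ e b + eps a b * Y x))"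
      unfolding out_def by (simp only:)
    also have "\<dots> = (\<Prod>b\<in>{b \<in> {1..n} - I. b < a}. theta \<tau> (x $ e a - x $ e b + eps a b * Y x)) *
        (\<Prod>b\<in>{b \<in> {1..n} - I. b > a}. theta \<tau> (x $ e a - x $ e b + eps a b * Y x))"
      by (rule prod.union_disjoint) auto
    also have "(\<Prod>b\<in>{b \<in> {1..n} - I. b < a}. theta \<tau> (x $ e a - x $ e b + eps a b * Y x)) =
        (\<Prod>b\<in>{b \<in> {1..n} - I. b < a}. theta \<tau> (x $ e a - x $ e b + Y x))"
      by (rule prod.cong) (auto simp: eps_def)
    also have "(\<Prod>b\<in>{b \<in> {1..n} - I. b > a}. theta \<tau> (x $ e a - x $ e b + eps a b * Y x)) =
        (\<Prod>b\<in>{b \<in> {1..n} - I. b > a}. theta \<tau> (x $ e a - x $ e b))"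
      by (rule prod.cong) (auto simp: eps_def)
    finally show ?thesis unfolding d u by (simp only: mult_ac)
  qed
  have "numerator t x = (\<Prod>r=1..k. (\<lambda>a. (\<Prod>b\<in>{1..<a}. theta \<tau> (x $ e a - x $ e b + Y x)) *
        theta \<tau> (L x - w a * Y x) * (\<Prod>b\<in>{a<..n}. theta \<tau> (x $ e a - x $ e b))) (elem I r))"
    unfolding numerator_def t_def zsub_def w_def by simp
  also have "\<dots> = (\<Prod>a\<in>I. (\<Prod>b\<in>{1..<a}. theta \<tau> (x $ e a - x $ e b + Y x)) *
        theta \<tau> (L x - w a * Y x) * (\<Prod>b\<in>{a<..n}. theta \<tau> (x $ e a - x $ e b)))"
    using elem_bij[OF I'(1)] unfolding I'(2) by (rule prod.reindex_bij_betw)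
  also have "\<dots> = (\<Prod>a\<in>I. dn a * up a * (theta \<tau> (L x - w a * Y x) * out a))"
    by (rule prod.cong[OF refl]) (use row in \<open>simp add: mult_ac\<close>)
  also have "\<dots> = pair_prod t (Y x) * vandermonde t * ((\<Prod>a\<in>I. theta \<tau> (L x - w a * Y x)) * (\<Prod>a\<in>I. out a))"
    unfolding t_def pair_prod_zsub[OF I] vandermonde_zsub[OF I] up_def dn_def prod.distrib ..
  finally have 2: "numerator t x = \<dots>" .
  have 3: "\<psi> x = (\<Prod>a\<in>I. theta \<tau> (L x - (w a + 1) * Y x)) * (\<Prod>a\<in>I. theta \<tau> (L x - w a * Y x))"
    unfolding psi_def w_def prod.distrib ..
  have nz: "vandermonde t \<noteq> 0" "pair_prod t (Y x) \<noteq> 0" "(\<Prod>a\<in>I. theta \<tau> (L x - w a * Y x)) \<noteq> 0"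
    using regular_vandermonde_nonzero[OF I permutes_id elim] elim
    unfolding regularity_nonzero_iff[OF I] 3 by (auto simp: t_def)
  show ?case
    unfolding 1 2 3 out_def[symmetric] w_def[symmetric] using nz by simp
qed


section \<open>Agreement on intersections of components\<close>

lemma weight_summand_cong:
  assumes "\<And>r. r \<in> {1..k} \<Longrightarrow> t r = u r"
  shows "weight_summand \<tau> n k I t z y l = weight_summand \<tau> n k I u z y l"
proof -
  have "(\<Prod>r=1..k. f r (t r)) = (\<Prod>r=1..k. f r (u r))" for f :: "nat \<Rightarrow> complex \<Rightarrow> complex"
    using assms by (intro prod.cong) auto
  moreover have "(\<Prod>i=1..k. \<Prod>j=Suc i..k. theta \<tau> (t i - t j) * theta \<tau> (t j - t i + y)) =
      (\<Prod>i=1..k. \<Prod>j=Suc i..k. theta \<tau> (u i - u j) * theta \<tau> (u j - u i + y))"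
    using assms by (intro prod.cong) auto
  ultimately show ?thesis
    unfolding weight_summand_def
    using assms by (intro arg_cong2[where f = "(/)"] prod.cong) auto
qed

lemma weight_fun_permutation:
  assumes \<rho>: "\<rho> permutes {1..k}" and t: "\<And>r. r \<in> {1..k} \<Longrightarrow> t r = u (\<rho> r)"
  shows "weight_fun \<tau> n k I t z y l = weight_fun \<tau> n k I u z y l"
proof -
  have "weight_summand \<tau> n k I (t \<circ> \<sigma>) z y l = weight_summand \<tau> n k I (u \<circ> (\<rho> \<circ> \<sigma>)) z y l"
    if "\<sigma> \<in> {\<sigma>. \<sigma> permutes {1..k}}" for \<sigma>
    using that t permutes_in_image[of \<sigma> "{1..k}"] by (intro weight_summand_cong) auto
  hence "(\<Sum>\<sigma> | \<sigma> permutes {1..k}. weight_summand \<tau> n k I (t \<circ> \<sigma>) z y l) =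
     (\<Sum>\<sigma> | \<sigma> permutes {1..k}. weight_summand \<tau> n k I (u \<circ> (\<rho> \<circ> \<sigma>)) z y l)"
    by (intro sum.cong) auto
  also have "\<dots> = (\<Sum>\<sigma> | \<sigma> permutes {1..k}. weight_summand \<tau> n k I (u \<circ> \<sigma>) z y l)"
    by (rule setum_permutations_compose_left[OF \<rho>, symmetric])
  finally show ?thesis unfolding weight_fun_def by simp
qed

text \<open>Equal multisets mean that the two tuples of coordinates differ by a permutation, which
  the sum over all permutations absorbs. The terms correspond one to one, so this is valid for the
  formula as written, even where denominators are zero.\<close>

lemma pullback_weight_chi_lift:
  assumes J: "J \<in> ksub n k" and K: "K \<in> ksub n k"
    and eq: "image_mset (\<lambda>a. x $ e a) (mset_set J) = image_mset (\<lambda>a. x $ e a) (mset_set K)"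
  shows "weight J x = weight K x"
proof -
  have zs: "image_mset (zsub e x J) (mset_set {1..k}) = image_mset (\<lambda>a. x $ e a) (mset_set J)"
    if J: "J \<in> ksub n k" for J
  proof -
    have b: "bij_betw (elem J) {1..k} J"
      using elem_bij[OF ksub_finite[OF J]] ksub_card[OF J] by simp
    hence "mset_set J = image_mset (elem J) (mset_set {1..k})"
      unfolding bij_betw_def using image_mset_mset_set by metis
    thus ?thesis by (simp add: zsub_def[abs_def] image_mset.compositionality o_def)
  qed
  have "image_mset (zsub e x J) (mset_set {1..k}) = image_mset (zsub e x K) (mset_set {1..k})"
    using eq zs[OF J] zs[OF K] by simp
  then obtain \<rho> where "\<rho> permutes {1..k}" "\<forall>r\<in>{1..k}. zsub e x J r = zsub e x K (\<rho> r)"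
    by (rule image_mset_eq_implies_permutes[OF finite_atLeastAtMost])
  thus ?thesis unfolding pullback_weight_def by (intro weight_fun_permutation) auto
qed

text \<open>Pairing \<open>J - K\<close> with \<open>K - J\<close> (and fixing \<open>J \<inter> K\<close>) keeps the coordinates indexed by
  \<open>J\<close> distinct in general position.\<close>

lemma chi_lift_pairing:
  assumes J: "J \<in> ksub n k" and K: "K \<in> ksub n k"
    and eq: "image_mset (\<lambda>a. x $ e a) (mset_set J) = image_mset (\<lambda>a. x $ e a) (mset_set K)"
  obtains f :: "nat \<Rightarrow> complex" where "inj_on f J" "inj_on f K" "\<And>a. f a \<in> \<real>"
    "\<And>\<zeta>. image_mset (\<lambda>a. (x + \<zeta> *s transversal f) $ e a) (mset_set J) =
       image_mset (\<lambda>a. (x + \<zeta> *s transversal f) $ e a) (mset_set K)"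
proof -
  have fin: "finite J" "finite K" using J K ksub_finite by auto
  have split: "mset_set A = mset_set (A \<inter> B) + mset_set (A - B)" if "finite A" for A B :: "nat set"
    using that by (subst mset_set_Union[symmetric]) (auto intro: arg_cong[where f = mset_set])
  have "card J = card K" using J K ksub_card by simp
  hence "card (J - K) = card (K - J)"
    using fin card_Int_Diff[of J K] card_Int_Diff[of K J] by (simp add: Int_commute)
  then obtain h where h: "bij_betw h (J - K) (K - J)"
    using fin finite_same_card_bij[of "J - K" "K - J"] by auto
  have "image_mset (\<lambda>a. x $ e a) (mset_set (J - K)) = image_mset (\<lambda>a. x $ e a) (mset_set (K - J))"
    using eq split[OF fin(1), of K] split[OF fin(2), of J] by (simp add: Int_commute)
  also have "mset_set (K - J) = image_mset h (mset_set (J - K))"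
    using h unfolding bij_betw_def using image_mset_mset_set by metis
  finally have "image_mset (\<lambda>a. x $ e a) (mset_set (J - K)) = image_mset (\<lambda>a. x $ e (h a)) (mset_set (J - K))"
    by (simp add: image_mset.compositionality o_def)
  then obtain p where p: "p permutes (J - K)" "\<forall>a\<in>J - K. x $ e a = x $ e (h (p a))"
    by (rule image_mset_eq_implies_permutes[rotated]) (use fin in auto)
  \<comment> \<open>The bijection \<open>h\<close> is arbitrary; \<open>p\<close> corrects it so
    that paired indices have equal coordinates at \<open>x\<close>.\<close>
  define \<pi> where "\<pi> = h \<circ> p"
  have \<pi>: "bij_betw \<pi> (J - K) (K - J)"
    unfolding \<pi>_def using bij_betw_trans[OF permutes_imp_bij[OF p(1)] h] .
  \<comment> \<open>Paired indices get the same velocity, so their coordinates stay equal along the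
    line, while the velocities within \<open>J\<close> and within \<open>K\<close> are
    distinct.\<close>
  define g where "g a = (if a \<in> K - J then inv_into (J - K) \<pi> a else a)" for a
  have g_in: "g a \<in> J - K" if "a \<in> K - J" for a
  proof -
    have "a \<in> \<pi> ` (J - K)" using \<pi> that unfolding bij_betw_def by blast
    from inv_into_into[OF this] show ?thesis using that by (simp add: g_def)
  qed
  have g_\<pi>: "g (\<pi> a) = a" "g a = a" if "a \<in> J - K" for a
    using that \<pi> bij_betw_inv_into_left[OF \<pi> that] bij_betwE[OF \<pi>] by (auto simp: g_def)
  have "inj_on g J" by (auto simp: inj_on_def g_def)
  moreover have "inj_on g K"
  proof (rule inj_onI)
    fix a b assume ab: "a \<in> K" "b \<in> K" "g a = g b"
    show "a = b"
    proof (cases "a \<in> J"; cases "b \<in> J")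
      assume "a \<notin> J" "b \<notin> J"
      hence "inv_into (J - K) \<pi> a = inv_into (J - K) \<pi> b" using ab by (simp add: g_def)
      thus "a = b"
        using \<open>a \<notin> J\<close> \<open>b \<notin> J\<close> ab bij_betw_inv_into_right[OF \<pi>] by (metis DiffI)
    qed (use ab g_in[of a] g_in[of b] in \<open>auto simp: g_def\<close>)
  qed
  ultimately have "inj_on (\<lambda>a. of_nat (g a) :: complex) J" "inj_on (\<lambda>a. of_nat (g a) :: complex) K"
    by (auto simp: inj_on_def)
  moreover have "image_mset (\<lambda>a. (x + \<zeta> *s transversal (\<lambda>a. of_nat (g a))) $ e a) (mset_set J) =
       image_mset (\<lambda>a. (x + \<zeta> *s transversal (\<lambda>a. of_nat (g a))) $ e a) (mset_set K)" for \<zeta>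
  proof -
    define y where "y = x + \<zeta> *s transversal (\<lambda>a. of_nat (g a))"
    have y: "y $ e a = x $ e a + \<zeta> * of_nat (g a)" if "a \<in> {1..n}" for a
      using that by (simp add: y_def transversal_simps)
    have "y $ e a = y $ e (\<pi> a)" if a: "a \<in> J - K" for a
    proof -
      have "\<pi> a \<in> K - J" using a bij_betwE[OF \<pi>] by blast
      hence "a \<in> {1..n}" "\<pi> a \<in> {1..n}" using a ksub_subset[OF J] ksub_subset[OF K] by auto
      thus ?thesis using p(2) a g_\<pi>[OF a] by (simp add: y \<pi>_def)
    qed
    hence "image_mset (\<lambda>a. y $ e a) (mset_set (J - K)) = image_mset (\<lambda>a. y $ e (\<pi> a)) (mset_set (J - K))"
      using fin by (intro image_mset_cong) auto
    also have "\<dots> = image_mset (\<lambda>a. y $ e a) (image_mset \<pi> (mset_set (J - K)))"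
      by (simp add: image_mset.compositionality o_def)
    also have "image_mset \<pi> (mset_set (J - K)) = mset_set (K - J)"
      using \<pi> unfolding bij_betw_def using image_mset_mset_set by metis
    finally show ?thesis
      unfolding y_def[symmetric] using split[OF fin(1), of K] split[OF fin(2), of J] by (simp add: Int_commute)
  qed
  ultimately show ?thesis using that[of "\<lambda>a. of_nat (g a)"] by simp
qed

text \<open>At \<open>x\<close> the formulas may degenerate. On the line provided by the pairing
  both are regular near \<open>x\<close> apart from \<open>x\<close> itself and coincide there, so
  \<open>c\<close> and \<open>d\<close> are limits of the same function.\<close>

lemma pullback_weight_compatible:
  assumes J: "J \<in> ksub n k" and K: "K \<in> ksub n k" and chi: "chi_lift n e J x = chi_lift n e K x"
    and c: "has_value (weight J) x c" and d: "has_value (weight K) x d"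
  shows "c = d"
proof -
  have eq: "image_mset (\<lambda>a. x $ e a) (mset_set J) = image_mset (\<lambda>a. x $ e a) (mset_set K)"
    using chi by (simp add: chi_lift_def)
  obtain f :: "nat \<Rightarrow> complex" where f: "inj_on f J" "inj_on f K" "\<And>a. f a \<in> \<real>"
    and feq: "\<And>\<zeta>. image_mset (\<lambda>a. (x + \<zeta> *s transversal f) $ e a) (mset_set J) =
       image_mset (\<lambda>a. (x + \<zeta> *s transversal f) $ e a) (mset_set K)"
    using chi_lift_pairing[OF J K eq] by blast
  define v where "v = transversal f"
  have lim: "\<exists>g. ((\<lambda>\<zeta>. g (x + \<zeta> *s v)) \<longlongrightarrow> c) (at 0) \<and>
      (\<forall>\<^sub>F \<zeta> in at 0. g (x + \<zeta> *s v) = weight J (x + \<zeta> *s v))"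
    if J: "J \<in> ksub n k" and c: "has_value (weight J) x c" and inj: "inj_on f J" for J c
  proof -
    obtain U g where U: "open U" "x \<in> U" "holo_on g U" "agree_on U (weight J) g" "g x = c"
      using c unfolding has_value_def by blast
    have line: "((\<lambda>\<zeta>. x + \<zeta> *s v) \<longlongrightarrow> x) (at 0)" by (rule tendsto_line)
    have inU: "\<forall>\<^sub>F \<zeta> in at 0. x + \<zeta> *s v \<in> U" using line U(1,2) by (rule topological_tendstoD)
    have "((\<lambda>\<zeta>. g (x + \<zeta> *s v)) \<longlongrightarrow> c) (at 0)"
      using continuous_on_tendsto_compose[OF holo_on_imp_continuous_on[OF U(3)] line U(2) inU] U(5) by simp
    moreover have "\<forall>\<^sub>F \<zeta> in at 0. g (x + \<zeta> *s v) = weight J (x + \<zeta> *s v)"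
      using inU eventually_regular_line[OF J inj f(3), of x] unfolding v_def[symmetric]
    proof eventually_elim
      case (elim \<zeta>)
      have "has_value (weight J) (x + \<zeta> *s v) (g (x + \<zeta> *s v))"
        unfolding has_value_def using U elim by blast
      thus ?case
        by (rule has_valueD[OF _ always_eventually[OF allI[OF refl]] open_regular])
          (use elim holo_on_imp_continuous_on[OF holo_pullback_weight[OF J]] in auto)
    qed
    ultimately show ?thesis by blast
  qed
  obtain g where g: "((\<lambda>\<zeta>. g (x + \<zeta> *s v)) \<longlongrightarrow> c) (at 0)"
      "\<forall>\<^sub>F \<zeta> in at 0. g (x + \<zeta> *s v) = weight J (x + \<zeta> *s v)"
    using lim[OF J c f(1)] by blast
  obtain h where h: "((\<lambda>\<zeta>. h (x + \<zeta> *s v)) \<longlongrightarrow> d) (at 0)"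
      "\<forall>\<^sub>F \<zeta> in at 0. h (x + \<zeta> *s v) = weight K (x + \<zeta> *s v)"
    using lim[OF K d f(2)] by blast
  have "\<forall>\<^sub>F \<zeta> in at 0. g (x + \<zeta> *s v) = h (x + \<zeta> *s v)"
    using g(2) h(2)
    by eventually_elim (simp add: pullback_weight_chi_lift[OF J K feq, folded v_def])
  hence "((\<lambda>\<zeta>. h (x + \<zeta> *s v)) \<longlongrightarrow> c) (at 0)"
    using g(1) by (simp add: tendsto_cong)
  thus ?thesis using h(1) by (metis tendsto_unique trivial_limit_at)
qed

section \<open>Poles and components of intersections\<close>

lemma iota_eq:
  assumes "K \<subseteq> {1..n}"
  shows "iota \<tau> n e K x = (image_mset (\<lambda>a. curve_pt \<tau> (x $ e a)) (mset_set K),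
      image_mset (\<lambda>a. curve_pt \<tau> (x $ e a)) (mset_set ({1..n} - K)),
      restrict (\<lambda>a. curve_pt \<tau> (x $ e a)) {1..n}, curve_pt \<tau> (Y x), curve_pt \<tau> (L x))"
  by (simp add: iota_def chi_lift_def image_mset.compositionality o_def)

text \<open>The conditions that define an intersection of components concern only the
  \<open>z\<close>-coordinates. Sweeping \<open>A\<close> along a direction with zero
  \<open>z\<close>-part gives an affine subspace of the same preimage, which equals \<open>A\<close>
  by maximality.\<close>

lemma irr_component_translation:
  assumes F: "F \<subseteq> ksub n k" "J \<in> F"
    and A: "A \<in> irr_components (iota \<tau> n e J -` (\<Inter>K\<in>F. Ycomp \<tau> n e K))" and x: "x \<in> A"
  shows "x + c *s transversal (\<lambda>_. 0) \<in> A"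
proof -
  let ?X = "iota \<tau> n e J -` (\<Inter>K\<in>F. Ycomp \<tau> n e K)"
  define v where "v = transversal (\<lambda>_. 0)"
  have A': "affine A" "A \<subseteq> ?X" "\<And>B. affine B \<Longrightarrow> A \<subseteq> B \<Longrightarrow> B \<subseteq> ?X \<Longrightarrow> B = A"
    using A unfolding irr_components_def by blast+
  have X: "y + c *s v \<in> ?X" if y: "y \<in> ?X" for y c
  proof -
    have "iota \<tau> n e J (y + c *s v) \<in> Ycomp \<tau> n e K" if K: "K \<in> F" for K
    proof -
      obtain u where u: "iota \<tau> n e J y = iota \<tau> n e K u"
        using y K unfolding Ycomp_def by blast
      \<comment> \<open>The point of the other component takes its \<open>z\<close>-coordinates from
        \<open>u\<close> and the remaining ones from the translated point.\<close>
      define u' where "u' = (\<chi> i. if i \<in> e ` {1..n} then u $ i else (y + c *s v) $ i)"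
      have 1: "(y + c *s v) $ e a = y $ e a" if "a \<in> {1..n}" for a
        using that by (simp add: v_def transversal_simps)
      have "iota \<tau> n e J (y + c *s v) = iota \<tau> n e K u'"
      proof -
        have JK: "J \<subseteq> {1..n}" "K \<subseteq> {1..n}" using F K ksub_subset by auto
        have 2: "u' $ e a = u $ e a" if "a \<in> {1..n}" for a
          using that by (simp add: u'_def)
        have "e (n + 1) \<notin> e ` {1..n}" "e (n + 2) \<notin> e ` {1..n}"
          using e_eq_iff[of "n + 1"] e_eq_iff[of "n + 2"] by (auto simp: image_iff)
        hence 3: "Y u' = Y (y + c *s v)" "L u' = L (y + c *s v)"
          by (simp_all add: ycoord_def lcoord_def u'_def)
        have ms: "image_mset (\<lambda>a. curve_pt \<tau> (p $ e a)) (mset_set B) = image_mset (\<lambda>a. curve_pt \<tau> (q $ e a)) (mset_set B)"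
          if "B \<subseteq> {1..n}" "\<And>a. a \<in> {1..n} \<Longrightarrow> p $ e a = q $ e a" for p q B
          using that finite_subset[OF that(1)] by (intro image_mset_cong) auto
        have rs: "restrict (\<lambda>a. curve_pt \<tau> (p $ e a)) {1..n} = restrict (\<lambda>a. curve_pt \<tau> (q $ e a)) {1..n}"
          if "\<And>a. a \<in> {1..n} \<Longrightarrow> p $ e a = q $ e a" for p q
          using that by (intro restrict_ext) auto
        have "iota \<tau> n e J (y + c *s v) = (image_mset (\<lambda>a. curve_pt \<tau> (y $ e a)) (mset_set J),
            image_mset (\<lambda>a. curve_pt \<tau> (y $ e a)) (mset_set ({1..n} - J)),
            restrict (\<lambda>a. curve_pt \<tau> (y $ e a)) {1..n}, curve_pt \<tau> (Y (y + c *s v)), curve_pt \<tau> (L (y + c *s v)))"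
          unfolding iota_eq[OF JK(1)] prod.inject by (intro conjI ms rs JK(1) Diff_subset 1 refl)
        moreover have "iota \<tau> n e K u' = (image_mset (\<lambda>a. curve_pt \<tau> (u $ e a)) (mset_set K),
            image_mset (\<lambda>a. curve_pt \<tau> (u $ e a)) (mset_set ({1..n} - K)),
            restrict (\<lambda>a. curve_pt \<tau> (u $ e a)) {1..n}, curve_pt \<tau> (Y u'), curve_pt \<tau> (L u'))"
          unfolding iota_eq[OF JK(2)] prod.inject by (intro conjI ms rs JK(2) Diff_subset 2 refl)
        ultimately show ?thesis
          using u unfolding iota_eq[OF JK(1)] iota_eq[OF JK(2)] 3 prod.inject by metis
      qed
      thus ?thesis unfolding Ycomp_def by blast
    qed
    thus ?thesis by blast
  qed
  define B where "B = {y + c *s v | y c. y \<in> A}"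
  have "affine B"
    unfolding affine_def
  proof (intro ballI allI impI)
    fix p q :: "complex ^ 'm" and s t :: real
    assume pq: "p \<in> B" "q \<in> B" "s + t = 1"
    obtain y c y' c' where *: "p = y + c *s v" "q = y' + c' *s v" "y \<in> A" "y' \<in> A"
      using pq by (auto simp: B_def)
    have "s *\<^sub>R p + t *\<^sub>R q = (s *\<^sub>R y + t *\<^sub>R y') + (of_real s * c + of_real t * c') *s v"
      unfolding * by (simp add: vec_eq_iff algebra_simps) (simp add: scaleR_conv_of_real algebra_simps)
    moreover have "s *\<^sub>R y + t *\<^sub>R y' \<in> A"
      using A'(1) * pq(3) unfolding affine_def by blast
    ultimately show "s *\<^sub>R p + t *\<^sub>R q \<in> B" unfolding B_def by blast
  qed
  moreover have "A \<subseteq> B"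
  proof
    fix y assume "y \<in> A"
    moreover have "y = y + 0 *s v" by simp
    ultimately show "y \<in> B" unfolding B_def by blast
  qed
  moreover have "B \<subseteq> ?X" using X A'(2) by (auto simp: B_def)
  ultimately have "B = A" using A'(3) by blast
  thus ?thesis using x unfolding B_def v_def by blast
qed

text \<open>By property (3) poles can lie only over the zeros of \<open>\<psi>\<close>, a function
  of \<open>y\<close> and \<open>\<lambda>\<close>. Components of intersections are invariant under
  translations that change these two coordinates, so none of them is contained in the polar
  set.\<close>

lemma mero_section_pullback:
  obtains N :: "int ^ 'm ^ 'm" where "transpose N = N" "mero_section \<tau> n k e N (weight)"
proof -
  have "integral_form (\<lambda>x. base_form x - psi_form x)" by (intro int_linear_intros)
  then obtain N where N: "transpose N = N" "(\<lambda>x. base_form x - psi_form x) = quad_form N"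
    unfolding integral_form_def by blast
  have form: "\<exists>F. entire F \<and> (\<forall>\<^sub>F x in generic. weight J x =
      1 / \<psi> x * outer_prod J x * F x)" if "J \<in> ksub n k" for J
    using restriction_form_pullback that unfolding restriction_form_def mero_eq_iff_generic outer_prod_def by blast
  have mer: "mero (weight J)" if J: "J \<in> ksub n k" for J
  proof -
    obtain F where F: "entire F" "\<forall>\<^sub>F x in generic. weight J x =
      1 / \<psi> x * outer_prod J x * F x" using form[OF J] by blast
    have "\<forall>\<^sub>F x in generic. weight J x = outer_prod J x * F x / \<psi> x"
      using F(2) by eventually_elim simp
    moreover have "UNIV \<subseteq> closure {x \<in> UNIV. \<psi> x \<noteq> 0}"
    proof -
      obtain D where "closure D = UNIV" "\<forall>x\<in>D. \<psi> x \<noteq> 0"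
        using generic_psi_nonzero by (auto simp: eventually_generic)
      thus ?thesis using closure_mono[of D "{x \<in> UNIV. \<psi> x \<noteq> 0}"] by auto
    qed
    ultimately show ?thesis
      unfolding mero_def mero_eq_iff_generic[symmetric] using F(1)
      by (intro allI exI[of _ UNIV] exI[of _ "\<lambda>x. outer_prod J x * F x"] exI[of _ "\<lambda>x. \<psi> x"])
        (auto intro!: holo_intros)
  qed
  have trn: "\<exists>M. transpose M = M \<and> (\<forall>x. quad_form M x = quad_form N x +
      twist_form k n (zsub e x J) (zsub e x ({1..n} - J)) (Y x) (L x)) \<and> transforms \<tau> M 0 (weight J)"
    if J: "J \<in> ksub n k" for J
  proof -
    have "integral_form (\<lambda>x. base_form x + twist J x - psi_form x)" by (intro int_linear_intros)
    then obtain M where M: "transpose M = M" "(\<lambda>x. base_form x + twist J x - psi_form x) = quad_form M"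
      unfolding integral_form_def by blast
    have "quad_form M x = quad_form N x + twist J x" for x
      unfolding M(2)[symmetric] N(2)[symmetric] by simp
    moreover have "transforms \<tau> M 0 (weight J)"
      unfolding transforms_iff[OF M(1)] M(2)[symmetric]
      by (intro quasi_periodic_imp_weakly quasi_periodic_pullback J)
    ultimately show ?thesis using M(1) twist_form_eq[OF J] by auto
  qed
  have pol: "\<not> A \<subseteq> polar_set (weight J)"
    if F: "F \<subseteq> ksub n k" "J \<in> F" and A: "A \<in> irr_components (iota \<tau> n e J -` (\<Inter>K\<in>F. Ycomp \<tau> n e K))" for F J A
  proof -
    have J: "J \<in> ksub n k" using F by blast
    obtain G where G: "entire G" "\<forall>\<^sub>F x in generic. weight J x =
      1 / \<psi> x * outer_prod J x * G x" using form[OF J] by blast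
    obtain a where a: "a \<in> A" using A unfolding irr_components_def by blast
    obtain c where c: "\<psi> (a + c *s transversal (\<lambda>_. 0)) \<noteq> 0"
      using eventually_happens'[OF trivial_limit_at eventually_psi_line] by blast
    define x where "x = a + c *s transversal (\<lambda>_. 0)"
    have "x \<in> A" unfolding x_def by (rule irr_component_translation[OF F A a])
    moreover have "has_value (weight J) x (1 / \<psi> x * outer_prod J x * G x)"
    proof (rule has_valueI[OF G(2)])
      show "open {x. \<psi> x \<noteq> 0}"
        by (intro open_Collect_neq holo_on_imp_continuous_on holo_intros)
      show "holo_on (\<lambda>x. 1 / \<psi> x * outer_prod J x * G x) {x. \<psi> x \<noteq> 0}"
        by (intro holo_on_mult holo_on_divide holo_intros holo_on_subset[OF G(1)]) auto
    qed (use c in \<open>simp add: x_def\<close>)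
    ultimately show ?thesis unfolding polar_set_def by blast
  qed
  have "mero_section \<tau> n k e N (weight)"
    unfolding mero_section_def
  proof (intro conjI ballI allI impI)
    fix J K x c d assume JK: "J \<in> ksub n k" "K \<in> ksub n k"
      and *: "chi_lift n e J x = chi_lift n e K x \<and> has_value (weight J) x c \<and>
        has_value (weight K) x d"
    show "c = d" by (rule pullback_weight_compatible[OF JK]) (use * in auto)
  qed (rule mer trn pol; assumption)+
  thus ?thesis using that N(1) by blast
qed

end

section \<open>Uniqueness of the section\<close>

lemma sum_change_one:
  fixes f g :: "'a \<Rightarrow> 'b::comm_monoid_add"
  assumes "finite A" "a \<in> A" "\<And>p. p \<in> A \<Longrightarrow> p \<noteq> a \<Longrightarrow> g p = f p" "g a = f a + d"
  shows "sum g A = sum f A + d"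
proof -
  have "sum g A = g a + sum g (A - {a})" by (rule sum.remove[OF assms(1,2)])
  also have "sum g (A - {a}) = sum f (A - {a})" using assms(3) by (intro sum.cong) auto
  finally show ?thesis using sum.remove[OF assms(1,2), of f] assms(4) by (simp add: add_ac)
qed

context weight_setup
begin

definition diagonal_form :: "complex ^ 'm \<Rightarrow> complex" where
  "diagonal_form x = (\<Sum>a\<in>I. \<Sum>b\<in>{1..n} - I. (x $ e a - x $ e b + eps a b * Y x) ^ 2)
     - (\<Sum>a\<in>I. (L x - (of_int (wnum n a I) + 1) * Y x) ^ 2)"

definition diagonal_value :: "complex ^ 'm \<Rightarrow> complex" where
  "diagonal_value x = (\<Prod>a\<in>I. \<Prod>b\<in>{1..n} - I. theta \<tau> (x $ e a - x $ e b + eps a b * Y x)) /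
     (\<Prod>a\<in>I. theta \<tau> (L x - (of_int (wnum n a I) + 1) * Y x))"

lemma eps_in_Ints: "eps a b \<in> \<int>" by (simp add: eps_def)

lemma integral_form_diagonal [int_linear_intros]: "integral_form diagonal_form"
  unfolding diagonal_form_def[abs_def] by (intro int_linear_intros eps_in_Ints) auto

lemma quasi_periodic_diagonal: "quasi_periodic diagonal_form diagonal_value"
  unfolding diagonal_form_def[abs_def] diagonal_value_def[abs_def]
  by (intro quasi_periodic_divide quasi_periodic_prod quasi_periodic_theta int_linear_intros eps_in_Ints) auto

lemma generic_diagonal_nonzero: "eventually (\<lambda>x. diagonal_value x \<noteq> 0) generic"
proof -
  have fin: "finite I" "I \<subseteq> {1..n}" using I ksub_finite ksub_subset by auto
  have "\<forall>\<^sub>F x in generic. theta \<tau> (x $ e a - x $ e b + eps a b * Y x) \<noteq> 0"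
    if "a \<in> I" "b \<in> {1..n} - I" for a b
  proof (rule generic_theta_nonzero)
    have "a \<in> {1..n}" "b \<in> {1..n}" "a \<noteq> b" using that fin by auto
    thus "transversal of_nat $ e a - transversal of_nat $ e b + eps a b * Y (transversal of_nat) \<noteq> 0"
      by (auto simp: transversal_simps eps_def complex_eq_iff)
  qed (intro int_linear_intros eps_in_Ints)
  hence "\<forall>\<^sub>F x in generic. \<forall>a\<in>I. \<forall>b\<in>{1..n} - I. theta \<tau> (x $ e a - x $ e b + eps a b * Y x) \<noteq> 0"
    using fin by (intro eventually_ball_finite ballI) auto
  with generic_psi_nonzero show ?thesis
  proof eventually_elim
    case (elim x)
    have "(\<Prod>a\<in>I. \<Prod>b\<in>{1..n} - I. theta \<tau> (x $ e a - x $ e b + eps a b * Y x)) \<noteq> 0"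
      using elim(2) fin by auto
    moreover have "(\<Prod>a\<in>I. theta \<tau> (L x - (of_int (wnum n a I) + 1) * Y x)) \<noteq> 0"
      using elim(1) unfolding psi_def prod.distrib by simp
    ultimately show ?case unfolding diagonal_value_def divide_eq_0_iff by blast
  qed
qed

text \<open>The form that governs the holomorphic factor of property (3). The first bracket is the
  form on \<open>Y_J\<close>, with \<open>N = diagonal_form - twist I\<close> forced by property
  (2); the second belongs to the prefactor \<open>outer_prod J / \<psi>\<close>.\<close>

definition cofactor_form :: "nat set \<Rightarrow> complex ^ 'm \<Rightarrow> complex" where
  "cofactor_form J x = (diagonal_form x - twist I x + twist J x) - (outer_form J x - psi_form x)"

text \<open>Since \<open>diagonal_value\<close> is generically nonzero, its multipliers determine
  the matrix on \<open>Y_I\<close> and thereby \<open>N\<close>. The holomorphic factors of two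
  sections hence have identical multipliers and may be subtracted, although the sections are not
  assumed to have the same \<open>N\<close>.\<close>

lemma section_cofactors:
  assumes adm: "section_of_admissible \<tau> n k e s" and diag: "diagonal_restriction \<tau> n e I s"
    and restr: "restriction_form \<tau> n k e I s"
  obtains F where "\<And>J. J \<in> ksub n k \<Longrightarrow> entire (F J)"
    and "\<And>J. J \<in> ksub n k \<Longrightarrow> \<forall>\<^sub>F x in generic. s J x = 1 / \<psi> x * outer_prod J x * F J x"
    and "\<And>J. J \<in> ksub n k \<Longrightarrow> quasi_periodic (cofactor_form J) (F J)"
    and "\<And>J K x. J \<in> ksub n k \<Longrightarrow> K \<in> ksub n k \<Longrightarrow> chi_lift n e J x = chi_lift n e K x \<Longrightarrow>
        \<psi> x \<noteq> 0 \<Longrightarrow> outer_prod J x * F J x = outer_prod K x * F K x"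
proof -
  obtain N :: "int ^ 'm ^ 'm" where sec: "mero_section \<tau> n k e N s"
    using adm unfolding section_of_admissible_def by blast
  have M: "\<exists>M. transpose M = M \<and> quad_form M = (\<lambda>x. quad_form N x + twist J x) \<and> weakly_quasi_periodic (quad_form M) (s J)"
    if J: "J \<in> ksub n k" for J
  proof -
    obtain M where M: "transpose M = M" "\<forall>x. quad_form M x = quad_form N x +
        twist_form k n (zsub e x J) (zsub e x ({1..n} - J)) (Y x) (L x)" "transforms \<tau> M 0 (s J)"
      using conjunct2[OF bspec[OF conjunct1[OF sec[unfolded mero_section_def]] J]] by blast
    thus ?thesis using twist_form_eq[OF J] transforms_iff[OF M(1)] by (intro exI[of _ M]) auto
  qed
  obtain MI where MI: "transpose MI = MI" "quad_form MI = (\<lambda>x. quad_form N x + twist I x)"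
      "weakly_quasi_periodic (quad_form MI) (s I)" using M[OF I] by blast
  obtain M0 where M0: "transpose M0 = M0" "diagonal_form = quad_form M0"
    using integral_form_diagonal unfolding integral_form_def by blast
  have eqI: "\<forall>\<^sub>F x in generic. s I x = diagonal_value x"
    using diag unfolding diagonal_restriction_def mero_eq_iff_generic diagonal_value_def .
  have "MI = M0"
    using weakly_quasi_periodic_cong[OF eqI MI(3)] quasi_periodic_imp_weakly[OF quasi_periodic_diagonal]
    unfolding M0(2) by (rule quasi_periodic_unique[OF MI(1) M0(1) _ _ generic_diagonal_nonzero])
  hence N: "quad_form N x = diagonal_form x - twist I x" for x
    using MI(2) M0(2) by (simp add: fun_eq_iff)
  have "\<forall>J\<in>ksub n k. \<exists>F. entire F \<and> (\<forall>\<^sub>F x in generic. s J x = 1 / \<psi> x * outer_prod J x * F x)"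
    using restr unfolding restriction_form_def mero_eq_iff_generic outer_prod_def .
  from bchoice[OF this] obtain F where F0: "\<forall>J\<in>ksub n k. entire (F J) \<and>
      (\<forall>\<^sub>F x in generic. s J x = 1 / \<psi> x * outer_prod J x * F J x)"
    by (rule exE)
  have F: "\<And>J. J \<in> ksub n k \<Longrightarrow> entire (F J)"
    "\<And>J. J \<in> ksub n k \<Longrightarrow> \<forall>\<^sub>F x in generic. s J x = 1 / \<psi> x * outer_prod J x * F J x"
    using F0 by simp_all
  have "quasi_periodic (cofactor_form J) (F J)" if J: "J \<in> ksub n k" for J
  proof -
    obtain MJ where MJ: "transpose MJ = MJ" "quad_form MJ = (\<lambda>x. diagonal_form x - twist I x + twist J x)"
      "weakly_quasi_periodic (quad_form MJ) (s J)" using M[OF J] unfolding N by blast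
    show ?thesis
      unfolding cofactor_form_def[abs_def]
    proof (rule quasi_periodic_factor[where f = "s J" and A = "\<lambda>x. outer_prod J x / \<psi> x"])
      show "\<forall>\<^sub>F x in generic. s J x = outer_prod J x / \<psi> x * F J x"
        using F(2)[OF J] by eventually_elim simp
      show "\<forall>\<^sub>F x in generic. outer_prod J x / \<psi> x \<noteq> 0"
        using generic_outer_nonzero[OF J] generic_psi_nonzero by eventually_elim simp
      show "weakly_quasi_periodic (\<lambda>x. diagonal_form x - twist I x + twist J x) (s J)"
        using MJ(2,3) by simp
    qed (intro quasi_periodic_divide quasi_periodic_outer quasi_periodic_psi F(1) J
        holo_on_integral_form int_linear_intros)+
  qed
  moreover have "outer_prod J x * F J x = outer_prod K x * F K x"
    if J: "J \<in> ksub n k" and K: "K \<in> ksub n k" and chi: "chi_lift n e J x = chi_lift n e K x"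
      and psi: "\<psi> x \<noteq> 0" for J K x
  proof -
    have hv: "has_value (s J) x (1 / \<psi> x * outer_prod J x * F J x)" if J: "J \<in> ksub n k" for J
    proof (rule has_valueI[OF F(2)[OF J]])
      show "open {x. \<psi> x \<noteq> 0}"
        by (intro open_Collect_neq holo_on_imp_continuous_on holo_intros)
      show "holo_on (\<lambda>x. 1 / \<psi> x * outer_prod J x * F J x) {x. \<psi> x \<noteq> 0}"
        by (intro holo_on_mult holo_on_divide holo_intros holo_on_subset[OF F(1)[OF J]]) auto
    qed (use psi in simp)
    have "1 / \<psi> x * outer_prod J x * F J x = 1 / \<psi> x * outer_prod K x * F K x"
      using bspec[OF bspec[OF conjunct2[OF conjunct2[OF sec[unfolded mero_section_def]]] J] K]
        chi hv[OF J] hv[OF K] by blast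
    thus ?thesis using psi by simp
  qed
  ultimately show ?thesis using that[of F] F by blast
qed

lemma shift_coordinates:
  assumes "a \<in> {1..n}"
  shows "b \<in> {1..n} \<Longrightarrow> (x + axis (e a) c) $ e b = x $ e b + (if b = a then c else 0)"
    "Y (x + axis (e a) c) = Y x" "L (x + axis (e a) c) = L x"
proof -
  have *: "axis (e a) c $ e b = (if b = a then c else 0)" if "b \<in> {1..n+2}" for b
    using e_eq_iff[of a b] assms that by (auto simp: axis_def)
  show "b \<in> {1..n} \<Longrightarrow> (x + axis (e a) c) $ e b = x $ e b + (if b = a then c else 0)"
    using *[of b] by simp
  show "Y (x + axis (e a) c) = Y x" "L (x + axis (e a) c) = L x"
    using *[of "n + 1"] *[of "n + 2"] assms by (simp_all add: ycoord_def lcoord_def)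
qed

text \<open>The \<open>z\<^sub>a\<close>-dependence of the quotient of the cofactor by the theta functions that it contains is
  linear, with coefficient \<open>\<lambda>\<close> up to a multiple of \<open>y\<close>.\<close>

lemma cofactor_form_shift:
  assumes J: "J \<in> ksub n k" and a: "a \<in> J" "a \<notin> I"
  obtains m :: int where "\<And>x c. cofactor_form J (x + axis (e a) c) - (\<Sum>b\<in>{b \<in> {1..n} - J. b > a}. ((x + axis (e a) c) $ e a - (x + axis (e a) c) $ e b) ^ 2)
     = cofactor_form J x - (\<Sum>b\<in>{b \<in> {1..n} - J. b > a}. (x $ e a - x $ e b) ^ 2) + 2 * c * (L x + of_int m * Y x)"
proof -
  have fin: "finite J" "J \<subseteq> {1..n}" "finite I" "I \<subseteq> {1..n}" using J I ksub_finite ksub_subset by auto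
  have an: "a \<in> {1..n}" using a fin by auto
  define lo where "lo = {b \<in> {1..n} - J. b < a}"
  define hi where "hi = {b \<in> {1..n} - J. b > a}"
  \<comment> \<open>The three terms are the coefficients of \<open>y\<close> in the derivative along
    \<open>z_a\<close>: from the twist of \<open>J\<close>, from the factors of
    \<open>outer_prod\<close> with \<open>b < a\<close>, and from \<open>eps\<close> in the diagonal
    value.\<close>
  define m where "m = int (n - k) - int (card lo) - int (card {p \<in> I. p > a})"
  have "cofactor_form J (x + axis (e a) c) - (\<Sum>b\<in>hi. ((x + axis (e a) c) $ e a - (x + axis (e a) c) $ e b) ^ 2)
     = cofactor_form J x - (\<Sum>b\<in>hi. (x $ e a - x $ e b) ^ 2) + 2 * c * (L x + of_int m * Y x)" for x c
  proof -
    define x' where "x' = x + axis (e a) c"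
    have xa: "x' $ e a = x $ e a + c" using shift_coordinates(1)[OF an an] by (simp add: x'_def)
    have xb: "x' $ e b = x $ e b" if "b \<in> {1..n}" "b \<noteq> a" for b
      using shift_coordinates(1)[OF an that(1)] that by (simp add: x'_def)
    have yl: "Y x' = Y x" "L x' = L x" using shift_coordinates[OF an] by (simp_all add: x'_def)
    have J_ne: "b \<noteq> a" "b \<in> {1..n}" if "b \<in> {1..n} - J" for b using that a by auto
    have I_ne: "p \<noteq> a" "p \<in> {1..n}" if "p \<in> I" for p using that a fin by auto
    have J_in: "p \<in> {1..n}" if "p \<in> J" for p using that fin by auto
    \<comment> \<open>As \<open>a\<close> is outside \<open>I\<close>, the shifted coordinate occurs
      only in the inner terms with \<open>b = a\<close>.\<close>
    have d1: "(\<Sum>p\<in>I. \<Sum>b\<in>{1..n} - I. (x' $ e p - x' $ e b + h p b) ^ 2) =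
        (\<Sum>p\<in>I. \<Sum>b\<in>{1..n} - I. (x $ e p - x $ e b + h p b) ^ 2) +
        (\<Sum>p\<in>I. c ^ 2 - 2 * c * (x $ e p - x $ e a + h p a))" for h
      unfolding sum.distrib[symmetric]
    proof (rule sum.cong[OF refl])
      fix p assume p: "p \<in> I"
      show "(\<Sum>b\<in>{1..n} - I. (x' $ e p - x' $ e b + h p b) ^ 2) =
        (\<Sum>b\<in>{1..n} - I. (x $ e p - x $ e b + h p b) ^ 2) + (c ^ 2 - 2 * c * (x $ e p - x $ e a + h p a))"
        by (rule sum_change_one[where a = a])
          (use an a xb[OF I_ne(2,1)[OF p]] xb xa in \<open>auto simp: power2_eq_square algebra_simps\<close>)
    qed
    have d2: "(\<Sum>p\<in>I. 2 * (x' $ e p * C)) = (\<Sum>p\<in>I. 2 * (x $ e p * C))" for C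
      using xb I_ne by (intro sum.cong) auto
    have d3: "(\<Sum>p\<in>J. 2 * (x' $ e p * C)) = (\<Sum>p\<in>J. 2 * (x $ e p * C)) + 2 * c * C" for C
      by (rule sum_change_one[where a = a]) (use fin a xa xb J_in in \<open>auto simp: algebra_simps\<close>)
    have d4: "(\<Sum>p\<in>J. \<Sum>b\<in>S p. (x' $ e p - x' $ e b + h) ^ 2) =
        (\<Sum>p\<in>J. \<Sum>b\<in>S p. (x $ e p - x $ e b + h) ^ 2) + (\<Sum>b\<in>S a. c ^ 2 + 2 * c * (x $ e a - x $ e b + h))"
      if S: "\<And>p. S p \<subseteq> {1..n} - J" for S h
    proof (rule sum_change_one[where a = a])
      fix p assume "p \<in> J" "p \<noteq> a"
      thus "(\<Sum>b\<in>S p. (x' $ e p - x' $ e b + h) ^ 2) = (\<Sum>b\<in>S p. (x $ e p - x $ e b + h) ^ 2)"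
        using xb J_in J_ne S[of p] by (intro sum.cong) auto
    next
      have "(\<Sum>b\<in>S a. (x' $ e a - x' $ e b + h) ^ 2) =
          (\<Sum>b\<in>S a. (x $ e a - x $ e b + h) ^ 2 + (c ^ 2 + 2 * c * (x $ e a - x $ e b + h)))"
      proof (rule sum.cong[OF refl])
        fix b assume "b \<in> S a"
        hence "x' $ e b = x $ e b" using xb J_ne S[of a] by blast
        thus "(x' $ e a - x' $ e b + h) ^ 2 =
          (x $ e a - x $ e b + h) ^ 2 + (c ^ 2 + 2 * c * (x $ e a - x $ e b + h))"
          by (simp add: xa power2_eq_square algebra_simps)
      qed
      thus "(\<Sum>b\<in>S a. (x' $ e a - x' $ e b + h) ^ 2) =
          (\<Sum>b\<in>S a. (x $ e a - x $ e b + h) ^ 2) + (\<Sum>b\<in>S a. c ^ 2 + 2 * c * (x $ e a - x $ e b + h))"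
        by (simp only: sum.distrib)
    qed (use fin a in auto)
    have d5: "(\<Sum>b\<in>hi. (x' $ e a - x' $ e b) ^ 2) =
       (\<Sum>b\<in>hi. (x $ e a - x $ e b) ^ 2) +
       (\<Sum>b\<in>hi. c ^ 2 + 2 * c * (x $ e a - x $ e b))"
      unfolding sum.distrib[symmetric]
      by (rule sum.cong) (use xa xb in \<open>auto simp: hi_def power2_eq_square algebra_simps\<close>)
    have split: "(\<Sum>b\<in>{1..n} - J. f b) = (\<Sum>b\<in>lo. f b) + (\<Sum>b\<in>hi. f b)"
      for f :: "nat \<Rightarrow> complex"
    proof -
      have "b < a \<or> b > a" if "b \<notin> J" for b using that a by (cases b a rule: linorder_cases) auto
      hence "{1..n} - J = lo \<union> hi" unfolding lo_def hi_def by blast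
      hence "(\<Sum>b\<in>{1..n} - J. f b) = sum f (lo \<union> hi)"
        by (rule arg_cong)
      also have "\<dots> = (\<Sum>b\<in>lo. f b) + (\<Sum>b\<in>hi. f b)"
        by (rule sum.union_disjoint) (auto simp: lo_def hi_def)
      finally show ?thesis .
    qed
    have D1: "diagonal_form x' = diagonal_form x + (\<Sum>p\<in>I. c ^ 2 - 2 * c * (x $ e p - x $ e a + eps p a * Y x))"
      unfolding diagonal_form_def yl by (simp only: d1[of "\<lambda>p b. eps p b * Y x"]) (simp only: algebra_simps)
    have D2: "twist I x' = twist I x + (\<Sum>p\<in>I. c ^ 2 - 2 * c * (x $ e p - x $ e a + 0))"
      unfolding twist_def yl using d1[of "\<lambda>_ _. 0"] by (simp only: d2 add_0_right) (simp only: add.assoc)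
    have D3: "twist J x' = twist J x + 2 * c * (L x + of_nat (n - k) * Y x) + (\<Sum>b\<in>{1..n} - J. c ^ 2 + 2 * c * (x $ e a - x $ e b))"
      unfolding twist_def yl using d4[of "\<lambda>_. {1..n} - J" 0] by (simp only: d3 add_0_right order_refl) (simp only: add_ac)
    have D4: "outer_form J x' = outer_form J x + (\<Sum>b\<in>lo. c ^ 2 + 2 * c * (x $ e a - x $ e b + Y x))"
      unfolding outer_form_def yl lo_def by (rule d4) auto
    have D5: "psi_form x' = psi_form x" unfolding psi_form_def yl ..
    have E1: "(\<Sum>p\<in>I. c ^ 2 - 2 * c * (x $ e p - x $ e a + eps p a * Y x)) =
        (\<Sum>p\<in>I. c ^ 2 - 2 * c * (x $ e p - x $ e a + 0)) - 2 * c * Y x * of_nat (card {p \<in> I. p > a})"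
    proof -
      have "(\<Sum>p\<in>I. c ^ 2 - 2 * c * (x $ e p - x $ e a + eps p a * Y x)) =
        (\<Sum>p\<in>I. (c ^ 2 - 2 * c * (x $ e p - x $ e a + 0)) - 2 * c * Y x * eps p a)"
        by (rule sum.cong) (simp_all add: algebra_simps)
      also have "\<dots> = (\<Sum>p\<in>I. c ^ 2 - 2 * c * (x $ e p - x $ e a + 0)) - 2 * c * Y x * (\<Sum>p\<in>I. eps p a)"
        by (simp only: sum_subtractf sum_distrib_left)
      also have "(\<Sum>p\<in>I. eps p a) = (\<Sum>p\<in>{p \<in> I. p > a}. 1)"
        unfolding eps_def by (rule sum.inter_filter[OF fin(3), symmetric])
      finally show ?thesis by simp
    qed
    have E2: "(\<Sum>b\<in>lo. c ^ 2 + 2 * c * (x $ e a - x $ e b + Y x)) =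
        (\<Sum>b\<in>lo. c ^ 2 + 2 * c * (x $ e a - x $ e b)) + 2 * c * Y x * of_nat (card lo)"
    proof -
      have "(\<Sum>b\<in>lo. c ^ 2 + 2 * c * (x $ e a - x $ e b + Y x)) =
        (\<Sum>b\<in>lo. (c ^ 2 + 2 * c * (x $ e a - x $ e b)) + 2 * c * Y x)"
        by (rule sum.cong) (simp_all add: algebra_simps)
      thus ?thesis by (simp add: sum.distrib mult.commute)
    qed
    \<comment> \<open>The quadratic terms cancel: \<open>twist I\<close> removes those of
      \<open>diagonal_form\<close>, and the terms from \<open>twist J\<close> over \<open>lo\<close>
      and \<open>hi\<close> are removed by \<open>outer_form\<close> and by the subtracted squares.
      Only the linear term survives.\<close>
    show ?thesis
      unfolding x'_def[symmetric] cofactor_form_def D1 D2 D3 D4 D5 E1 E2 d5 split m_def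
      by (simp add: algebra_simps)
  qed
  thus ?thesis using that unfolding hi_def by blast
qed

lemma chi_lift_exchange:
  assumes J: "J \<in> ksub n k" and ab: "a \<in> J" "b \<in> {1..n} - J" and x: "x $ e a = x $ e b"
  shows "chi_lift n e (insert b (J - {a})) x = chi_lift n e J x"
proof -
  have fin: "finite J" "J \<subseteq> {1..n}" using J ksub_finite ksub_subset by auto
  have 1: "mset_set J = add_mset a (mset_set (J - {a}))"
    using mset_set.insert_remove[of J a] fin ab by (simp add: insert_absorb)
  have 2: "mset_set (insert b (J - {a})) = add_mset b (mset_set (J - {a}))"
    using fin ab by (subst mset_set.insert) auto
  let ?R = "{1..n} - J - {b}"
  have "{1..n} - J = insert b ?R" "{1..n} - insert b (J - {a}) = insert a ?R" using ab fin by auto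
  moreover have "mset_set (insert b ?R) = add_mset b (mset_set ?R)" "mset_set (insert a ?R) = add_mset a (mset_set ?R)"
    using ab by (subst mset_set.insert; auto)+
  ultimately have 3: "mset_set ({1..n} - J) = add_mset b (mset_set ?R)"
    "mset_set ({1..n} - insert b (J - {a})) = add_mset a (mset_set ?R)" by metis+
  show ?thesis unfolding chi_lift_def 1 2 3 using x by simp
qed

text \<open>The exponent \<open>L x + m * Y x\<close> contains \<open>\<lambda>\<close> with
  coefficient 1, so it avoids the lattice for generic \<open>x\<close>. There the one-variable
  vanishing theorem applies to the slice in \<open>z_a\<close>, and continuity gives the
  rest.\<close>

lemma cofactor_eq_0:
  assumes J: "J \<in> ksub n k" and a: "a \<in> J" "a \<notin> I" and D: "entire D"
    and qp: "quasi_periodic (cofactor_form J) D"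
    and zero: "\<And>b x. b \<in> {1..n} - J \<Longrightarrow> b > a \<Longrightarrow> x $ e a = x $ e b \<Longrightarrow> D x = 0"
  shows "D x = 0"
proof -
  have fin: "finite J" "J \<subseteq> {1..n}" "a \<in> {1..n}"
    using ksub_finite[OF J] ksub_subset[OF J] a by blast+
  define B where "B = {b \<in> {1..n} - J. b > a}"
  define S where "S = (\<lambda>b. (e a, e b)) ` B"
  have ne: "e a \<noteq> e b" if "b \<in> B" for b
    using that e_eq_iff[of a b] fin a by (auto simp: B_def)
  have inj: "inj_on (\<lambda>b. (e a, e b)) B"
    using e_eq_iff by (auto simp: inj_on_def B_def)
  have prodS: "(\<Prod>(i, j)\<in>S. theta \<tau> (x $ i - x $ j)) = (\<Prod>b\<in>B. theta \<tau> (x $ e a - x $ e b))" for x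
    unfolding S_def by (simp add: prod.reindex[OF inj])
  obtain G where G: "entire G" "\<And>x. D x = (\<Prod>b\<in>B. theta \<tau> (x $ e a - x $ e b)) * G x"
  proof (rule theta_prod_division[of S D, unfolded prodS])
    show "finite S" by (simp add: S_def B_def)
    show "i \<noteq> j \<and> (j, i) \<notin> S" if "(i, j) \<in> S" for i j
      using that ne by (auto simp: S_def)
    show "D x = 0" if ij: "(i, j) \<in> S" and x: "x $ i - x $ j \<in> lattice" for i j x
    proof -
      obtain b where b: "i = e a" "j = e b" "b \<in> B" using ij by (auto simp: S_def)
      show ?thesis
        by (rule quasi_periodic_zero_lattice[OF qp _ _ x]) (use b ne zero[of b] in \<open>auto simp: B_def\<close>)
    qed
  qed (use D in blast)+
  obtain m where m: "\<And>x c. cofactor_form J (x + axis (e a) c) - (\<Sum>b\<in>B. ((x + axis (e a) c) $ e a - (x + axis (e a) c) $ e b) ^ 2)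
     = cofactor_form J x - (\<Sum>b\<in>B. (x $ e a - x $ e b) ^ 2) + 2 * c * (L x + of_int m * Y x)"
    unfolding B_def using cofactor_form_shift[OF J a] by blast
  define Q where "Q x = cofactor_form J x - (\<Sum>b\<in>B. (x $ e a - x $ e b) ^ 2)" for x
  have shift: "Q (x + axis (e a) c) = Q x + 2 * c * (L x + of_int m * Y x)" for x c
    unfolding Q_def by (rule m)
  have form: "integral_form (cofactor_form J)" "integral_form (\<lambda>x. \<Sum>b\<in>B. (x $ e a - x $ e b) ^ 2)"
    unfolding cofactor_form_def[abs_def] by (intro int_linear_intros)+
  have "quasi_periodic Q G"
    unfolding Q_def[abs_def]
  proof (rule quasi_periodic_factor[where f = D and A = "\<lambda>x. \<Prod>b\<in>B. theta \<tau> (x $ e a - x $ e b)"])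
    have "\<forall>\<^sub>F x in generic. theta \<tau> (x $ e a - x $ e b) \<noteq> 0" if b: "b \<in> B" for b
    proof (rule generic_theta_nonzero)
      show "axis (e a) 1 $ e a - axis (e a) 1 $ e b \<noteq> (0 :: complex)" using ne[OF b] by (simp add: axis_def)
    qed (intro int_linear_intros)
    hence "\<forall>\<^sub>F x in generic. \<forall>b\<in>B. theta \<tau> (x $ e a - x $ e b) \<noteq> 0"
      by (intro eventually_ball_finite) (auto simp: B_def)
    thus "\<forall>\<^sub>F x in generic. (\<Prod>b\<in>B. theta \<tau> (x $ e a - x $ e b)) \<noteq> 0"
      by eventually_elim (simp add: B_def)
    show "\<forall>\<^sub>F x in generic. D x = (\<Prod>b\<in>B. theta \<tau> (x $ e a - x $ e b)) * G x"
      using G(2) by simp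
  qed (intro quasi_periodic_imp_weakly qp quasi_periodic_prod quasi_periodic_theta int_linear_intros
      holo_on_integral_form form G(1))+
  hence G_shift: "G (x + axis (e a) (period b)) = multiplier Q (e a) b x * G x" for b x
    unfolding quasi_periodic_def by blast
  \<comment> \<open>A quadratic form vanishes at 0, and so do \<open>L\<close> and \<open>Y\<close>.
    The shift formula then gives \<open>Q (axis (e a) 1) = 0\<close>: the multiplier under
    \<open>z_a + 1\<close> is trivial, without a sign.\<close>
  have "Q 0 = 0"
  proof -
    have "integral_form Q" unfolding Q_def[abs_def] using form by (intro int_linear_intros)
    then obtain M where "Q = quad_form M" unfolding integral_form_def by blast
    thus ?thesis by (simp add: quad_form_def)
  qed
  hence Q1: "Q (axis (e a) 1) = 0"
    using shift[of 0 1] by (simp add: ycoord_def lcoord_def)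
  have p1: "G (x + axis (e a) 1) = G x" for x
    using G_shift[of x False] by (simp add: period_def multiplier_def Q1)
  have p2: "G (x + axis (e a) \<tau>) = exp (2 * of_real pi * \<i> * - (L x + of_int m * Y x)) * G x" for x
    using G_shift[of x True] tau_nonzero by (simp add: period_def multiplier_def Q1 shift algebra_simps)
  have "G x = 0" if nz: "theta \<tau> (L x + of_int m * Y x) \<noteq> 0" for x
  proof -
    define g where "g z = G (x + z *s axis (e a) 1)" for z
    have ax: "z *s axis (e a) 1 = (axis (e a) z :: complex ^ 'm)" for z
      by (simp add: vec_eq_iff axis_def)
    have ax_add: "axis (e a) (u + w) = (axis (e a) u + axis (e a) w :: complex ^ 'm)" for u w
      by (simp add: vec_eq_iff axis_def)
    have "g 0 = 0"
    proof (rule entire_quasiperiodic_eq_0[where g = g and c = "- (L x + of_int m * Y x)"])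
      show "g holomorphic_on UNIV" unfolding g_def[abs_def] by (rule holo_on_entire_line[OF G(1)])
      show "g (z + 1) = g z" for z
        unfolding g_def ax ax_add using p1[of "x + axis (e a) z"] by (simp add: add.assoc)
      show "g (z + \<tau>) = exp (2 * of_real pi * \<i> * - (L x + of_int m * Y x)) * g z" for z
        unfolding g_def ax ax_add using p2[of "x + axis (e a) z"] shift_coordinates(2,3)[OF fin(3)]
        by (simp add: add.assoc)
      show "- (L x + of_int m * Y x) \<notin> lattice"
        using nz theta_minus[of "L x + of_int m * Y x"] unfolding theta_eq_0_iff[symmetric] by simp
    qed
    thus ?thesis by (simp add: g_def)
  qed
  moreover have "\<forall>\<^sub>F x in generic. theta \<tau> (L x + of_int m * Y x) \<noteq> 0"
  proof (rule generic_theta_nonzero)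
    show "L (transversal (\<lambda>_. 0)) + of_int m * Y (transversal (\<lambda>_. 0)) \<noteq> 0"
      by (simp add: transversal_simps complex_eq_iff)
  qed (intro int_linear_intros Ints_of_int)
  ultimately have "\<forall>\<^sub>F x in generic. G x = 0" by (auto elim: eventually_mono)
  hence "G = (\<lambda>_. 0)"
    by (rule generic_eq_imp_eq) (intro holo_on_imp_continuous_on G(1) continuous_on_const)+
  thus ?thesis using G(2) by simp
qed

lemma section_unique:
  assumes s: "section_of_admissible \<tau> n k e s" "diagonal_restriction \<tau> n e I s" "restriction_form \<tau> n k e I s"
    and s': "section_of_admissible \<tau> n k e s'" "diagonal_restriction \<tau> n e I s'" "restriction_form \<tau> n k e I s'"
    and J: "J \<in> ksub n k"
  shows "mero_eq (s J) (s' J)"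
proof -
  obtain F where F: "\<And>J. J \<in> ksub n k \<Longrightarrow> entire (F J)"
    "\<And>J. J \<in> ksub n k \<Longrightarrow> \<forall>\<^sub>F x in generic. s J x = 1 / \<psi> x * outer_prod J x * F J x"
    "\<And>J. J \<in> ksub n k \<Longrightarrow> quasi_periodic (cofactor_form J) (F J)"
    "\<And>J K x. J \<in> ksub n k \<Longrightarrow> K \<in> ksub n k \<Longrightarrow> chi_lift n e J x = chi_lift n e K x \<Longrightarrow>
        \<psi> x \<noteq> 0 \<Longrightarrow> outer_prod J x * F J x = outer_prod K x * F K x"
    by (rule section_cofactors[OF s]) blast
  obtain F' where F': "\<And>J. J \<in> ksub n k \<Longrightarrow> entire (F' J)"
    "\<And>J. J \<in> ksub n k \<Longrightarrow> \<forall>\<^sub>F x in generic. s' J x = 1 / \<psi> x * outer_prod J x * F' J x"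
    "\<And>J. J \<in> ksub n k \<Longrightarrow> quasi_periodic (cofactor_form J) (F' J)"
    "\<And>J K x. J \<in> ksub n k \<Longrightarrow> K \<in> ksub n k \<Longrightarrow> chi_lift n e J x = chi_lift n e K x \<Longrightarrow>
        \<psi> x \<noteq> 0 \<Longrightarrow> outer_prod J x * F' J x = outer_prod K x * F' K x"
    by (rule section_cofactors[OF s']) blast
  define D where "D J x = F J x - F' J x" for J x
  have D: "entire (D J)" if "J \<in> ksub n k" for J
    unfolding D_def[abs_def] using F(1) F'(1) that by (intro holo_intros) auto
  have qp: "quasi_periodic (cofactor_form J) (D J)" if "J \<in> ksub n k" for J
    using F(3)[OF that] F'(3)[OF that] unfolding quasi_periodic_def D_def by (simp add: algebra_simps)
  have comp: "outer_prod J x * D J x = outer_prod K x * D K x"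
    if "J \<in> ksub n k" "K \<in> ksub n k" "chi_lift n e J x = chi_lift n e K x" "\<psi> x \<noteq> 0" for J K x
    using F(4)[OF that] F'(4)[OF that] by (simp add: D_def right_diff_distrib)
  have DI: "D I x = 0" for x
  proof -
    have "\<forall>\<^sub>F x in generic. D I x = 0"
      using F(2)[OF I] F'(2)[OF I] s(2)[unfolded diagonal_restriction_def mero_eq_iff_generic]
        s'(2)[unfolded diagonal_restriction_def mero_eq_iff_generic]
        generic_psi_nonzero generic_outer_nonzero[OF I]
    proof eventually_elim
      case (elim x)
      have "1 / \<psi> x * outer_prod I x * F I x = 1 / \<psi> x * outer_prod I x * F' I x"
        using elim(1-4) by metis
      thus ?case using elim(5,6) by (simp add: D_def)
    qed
    hence "D I = (\<lambda>_. 0)"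
      by (rule generic_eq_imp_eq) (intro holo_on_imp_continuous_on D I continuous_on_const)+
    thus ?thesis by simp
  qed
  \<comment> \<open>The bound makes \<open>n * k - \<Sum>J\<close> strictly decrease under natural
    number subtraction when \<open>J\<close> is replaced by a set of larger sum.\<close>
  have sum_le: "\<Sum>J \<le> n * k" if "J \<in> ksub n k" for J
  proof -
    have "a \<le> n" if "a \<in> J" for a using ksub_subset[OF \<open>J \<in> ksub n k\<close>] that by auto
    thus ?thesis using sum_bounded_above[of J "\<lambda>a. a" n] ksub_card[OF that] by (simp add: mult.commute)
  qed
  have D0: "D J x = 0" if "J \<in> ksub n k" for J x
    using that
  proof (induction "n * k - \<Sum>J" arbitrary: J x rule: less_induct)
    case (less J)
    note J = less.prems
    have J': "finite J" "J \<subseteq> {1..n}" "card J = k" using J ksub_finite ksub_subset ksub_card by auto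
    show ?case
    proof (cases "J = I")
      case True
      thus ?thesis using DI by simp
    next
      case False
      have "\<not> J \<subseteq> I"
        using False card_subset_eq[OF ksub_finite[OF I], of J] J'(3) ksub_card[OF I] by auto
      then obtain a where a: "a \<in> J" "a \<notin> I" by blast
      show ?thesis
      proof (rule cofactor_eq_0[OF J a D[OF J] qp[OF J]])
        fix b and x :: "complex ^ 'm" assume b: "b \<in> {1..n} - J" "b > a" and x: "x $ e a = x $ e b"
        define K where "K = insert b (J - {a})"
        have "card K = k"
          unfolding K_def using J' b card.remove[OF J'(1) a(1)] by (subst card_insert_disjoint) auto
        hence K: "K \<in> ksub n k" unfolding ksub_def K_def using J' b by auto
        have "\<Sum>K = b + \<Sum>(J - {a})" unfolding K_def using J' b by (subst sum.insert) auto
        moreover have "\<Sum>J = a + \<Sum>(J - {a})" using J' a by (simp add: sum.remove)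
        ultimately have "n * k - \<Sum>K < n * k - \<Sum>J" using b sum_le[OF K] by linarith
        hence DK: "D K y = 0" for y using less.hyps[OF _ K] by blast
        \<comment> \<open>The comparison with \<open>K\<close> needs
          \<open>\<psi> \<noteq> 0\<close> and determines \<open>D J\<close> only up to the factor
          \<open>outer_prod J\<close>. Both may vanish at \<open>x\<close>; moving in
          \<open>y\<close> and \<open>\<lambda>\<close> avoids this while keeping
          \<open>z_a = z_b\<close>.\<close>
        define v where "v = transversal (\<lambda>_. 0)"
        have "\<forall>\<^sub>F \<zeta> in at 0. \<psi> (x + \<zeta> *s v) * outer_prod J (x + \<zeta> *s v) \<noteq> 0"
          using eventually_psi_line[of x "\<lambda>_. 0"] eventually_y_line[of "\<lambda>_. 0" x, OF Reals_0] unfolding v_def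
          by eventually_elim (use outer_inner_nonzero[OF J] in auto)
        then obtain c where c: "\<psi> (x + c *s v) * outer_prod J (x + c *s v) \<noteq> 0"
          using eventually_happens'[OF trivial_limit_at] by blast
        have "D J (x + \<zeta> *s v) * (\<psi> (x + \<zeta> *s v) * outer_prod J (x + \<zeta> *s v)) = 0" for \<zeta>
        proof (cases "\<psi> (x + \<zeta> *s v) = 0")
          case False
          have "a \<in> {1..n}" "b \<in> {1..n}" using a b J' by auto
          hence "(x + \<zeta> *s v) $ e a = (x + \<zeta> *s v) $ e b" using x by (simp add: v_def transversal_simps)
          from chi_lift_exchange[OF J a(1) b(1) this]
          have "outer_prod K (x + \<zeta> *s v) * D K (x + \<zeta> *s v) = outer_prod J (x + \<zeta> *s v) * D J (x + \<zeta> *s v)"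
            unfolding K_def[symmetric] by (rule comp[OF K J _ False])
          thus ?thesis using DK by auto
        qed simp
        thus "D J x = 0"
          using c by (rule line_cancel[where h = "\<lambda>x. \<psi> x * outer_prod J x", rotated 2])
            (intro D J holo_intros)+
      qed
    qed
  qed
  show ?thesis
    unfolding mero_eq_iff_generic using F(2)[OF J] F'(2)[OF J]
    by eventually_elim (use D0[OF J] in \<open>simp add: D_def\<close>)
qed

end

theorem theoremA1:
  fixes \<tau> :: complex and n k :: nat and e :: "nat \<Rightarrow> 'm::finite" and I :: "nat set"
  assumes "Im \<tau> > 0"
    and "k \<le> n"
    and "bij_betw e {1..n+2} UNIV"
    and "I \<subseteq> {1..n}" and "card I = k"
  shows "section_of_admissible \<tau> n k e (pullback_weight \<tau> n k e I) \<and>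
    diagonal_restriction \<tau> n e I (pullback_weight \<tau> n k e I) \<and>
    restriction_form \<tau> n k e I (pullback_weight \<tau> n k e I) \<and>
    (\<forall>s :: nat set \<Rightarrow> complex ^ 'm \<Rightarrow> complex.
       section_of_admissible \<tau> n k e s \<and>
       diagonal_restriction \<tau> n e I s \<and>
       restriction_form \<tau> n k e I s \<longrightarrow>
       (\<forall>J. J \<subseteq> {1..n} \<and> card J = k \<longrightarrow> mero_eq (s J) (pullback_weight \<tau> n k e I J)))"
proof -
  interpret weight_setup \<tau> n k e I
    by unfold_locales (use assms in \<open>auto simp: ksub_def\<close>)
  have "section_of_admissible \<tau> n k e (pullback_weight \<tau> n k e I)"
    unfolding section_of_admissible_def using mero_section_pullback by blast
  thus ?thesis
    using diagonal_restriction_pullback restriction_form_pullback section_unique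
    by (auto simp: ksub_def)
qed

end
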